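(* Let $V$ be the ground model, let $\mathcal{A}\in V$ be an infinite Boolean algebra, and let $\mathbb{P}\in V$ be a notion of forcing which adds at least one of the following: a Cohen real over $V$, an unsplit real over $V$, or a random real over $V$. Let $G$ be a $\mathbb{P}$-generic filter over $V$. Then, in $V[G]$, $\mathcal{A}$ has neither the Nikodym property nor the Grothendieck property.
   Context: A measure on a Boolean algebra $\mathcal{A}$ is a finitely additive function $\mu\colon\mathcal{A}\to\mathbb{R}$ of bounded total variation $\|\mu\|=\sup\{|\mu(A)|+|\mu(B)|: A,B\in\mathcal{A}, A\wedge B=0\}<\infty$; it extends uniquely to a signed Radon measure on the Stone space $St(\mathcal{A})$ (identifying $\mathcal{A}$ with the clopen subsets of $St(\mathcal{A})$). A sequence $(\mu_n)$ of measures on $\mathcal{A}$ is pointwise null if $\mu_n(A)\to0$ for all $A\in\mathcal{A}$; weak* null if $\int f\,d\mu_n\to0$ for all continuous $f\colon St(\mathcal{A})\to\mathbb{R}$; weakly null if $\mu_n(B)\to0$ for every Borel $B\subseteq St(\mathcal{A})$. $\mathcal{A}$ has the Nikodym property if every pointwise null sequence of measures on $\mathcal{A}$ is weak* null, and the Grothendieck property if every weak* null sequence of measures on $\mathcal{A}$ is weakly null. A real $x\in 2^\omega\cap V[G]$ is Cohen over $V$ if it meets (via its finite restrictions) every dense subset $D\in V$ of the poset of finite partial functions $\omega\to2$ ordered by reverse inclusion. A set $U\in\wp(\omega)\cap V[G]$ (infinite) is unsplit over $V$ if for every $A\in\wp(\omega)\cap V$, either $U\cap A$ or $U\setminus A$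 is finite. A real $r\in2^\omega\cap V[G]$ is random over $V$ if it does not belong to (the reinterpretation of) any Borel set $B\subseteq 2^\omega$ coded in $V$ with Lebesgue (product) measure zero in $V$. *)

theory Defs
  imports "HOL-Probability.Probability"
begin

text \<open>
  The ground model V is the universe of HOL. A notion of forcing is a preordered type
  \<open>'p\<close>, smaller conditions being stronger, and truth in V[G] is expressed by the forcing
  relation: a sentence of the forcing language is identified with the set of conditions that
  force it, and ``for every \<open>'p\<close>-generic G over V, the sentence holds in V[G]'' means that
  every condition forces it.

  A subset of a ground set is given in V[G] by a \<open>'p\<close>-name consisting of pairs (ground
  element, condition), a set of such subsets by a \<open>'p\<close>-name consisting of pairs (name,
  condition), and so on. Every subset in V[G] of a set whose elements have names in a type
  \<open>'x\<close> has a name in \<open>('x \<times> 'p) set\<close>, so quantifying over a type of names amounts to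
  quantifying over all the objects of that kind in V[G].
\<close>

section \<open>The forcing relation\<close>

type_synonym 'p fm = "'p \<Rightarrow> bool"

definition forced :: "'p::preorder fm \<Rightarrow> bool" where
  "forced \<phi> \<longleftrightarrow> (\<forall>p. \<phi> p)"

definition ground :: "bool \<Rightarrow> 'p::preorder fm" where
  "ground b = (\<lambda>p. b)"

definition fnot :: "'p::preorder fm \<Rightarrow> 'p fm" (\<open>\<^bold>\<not> _\<close> [40] 40) where
  "(\<^bold>\<not> \<phi>) = (\<lambda>p. \<forall>q\<le>p. \<not> \<phi> q)"

definition fand :: "'p::preorder fm \<Rightarrow> 'p fm \<Rightarrow> 'p fm" (infixr \<open>\<^bold>\<and>\<close> 35) where
  "(\<phi> \<^bold>\<and> \<psi>) = (\<lambda>p. \<phi> p \<and> \<psi> p)"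

definition f_or :: "'p::preorder fm \<Rightarrow> 'p fm \<Rightarrow> 'p fm" (infixr \<open>\<^bold>\<or>\<close> 30) where
  "(\<phi> \<^bold>\<or> \<psi>) = (\<lambda>p. \<forall>q\<le>p. \<exists>r\<le>q. \<phi> r \<or> \<psi> r)"

definition fimp :: "'p::preorder fm \<Rightarrow> 'p fm \<Rightarrow> 'p fm" (infixr \<open>\<^bold>\<longrightarrow>\<close> 25) where
  "(\<phi> \<^bold>\<longrightarrow> \<psi>) = (\<lambda>p. \<forall>q\<le>p. \<phi> q \<longrightarrow> \<psi> q)"

definition fiff :: "'p::preorder fm \<Rightarrow> 'p fm \<Rightarrow> 'p fm" (infixr \<open>\<^bold>\<longleftrightarrow>\<close> 25) where
  "(\<phi> \<^bold>\<longleftrightarrow> \<psi>) = ((\<phi> \<^bold>\<longrightarrow> \<psi>) \<^bold>\<and> (\<psi> \<^bold>\<longrightarrow> \<phi>))"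

definition fall :: "('x \<Rightarrow> 'p::preorder fm) \<Rightarrow> 'p fm" (binder \<open>\<^bold>\<forall>\<close> 10) where
  "fall \<Phi> = (\<lambda>p. \<forall>x. \<Phi> x p)"

definition fex :: "('x \<Rightarrow> 'p::preorder fm) \<Rightarrow> 'p fm" (binder \<open>\<^bold>\<exists>\<close> 10) where
  "fex \<Phi> = (\<lambda>p. \<forall>q\<le>p. \<exists>r\<le>q. \<exists>x. \<Phi> x r)"

section \<open>Names\<close>

type_synonym ('x, 'p) name = "('x \<times> 'p) set"

text \<open>
  Membership and equality of names depend on the equality \<open>E\<close> that V[G] assigns to the
  (names of the) elements: \<open>geq\<close> for ground elements, \<open>set_eq E\<close> for names of sets, and
  \<open>prod_eq E F\<close> for ordered pairs.
\<close>

definition geq :: "'x \<Rightarrow> 'x \<Rightarrow> 'p::preorder fm" where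
  "geq x y = ground (x = y)"

definition mem :: "('x \<Rightarrow> 'x \<Rightarrow> 'p::preorder fm) \<Rightarrow> 'x \<Rightarrow> ('x, 'p) name \<Rightarrow> 'p fm" where
  "mem E x \<tau> = (\<lambda>p. \<forall>q\<le>p. \<exists>r\<le>q. \<exists>(y, s)\<in>\<tau>. r \<le> s \<and> E x y r)"

definition set_eq ::
    "('x \<Rightarrow> 'x \<Rightarrow> 'p::preorder fm) \<Rightarrow> ('x, 'p) name \<Rightarrow> ('x, 'p) name \<Rightarrow> 'p fm" where
  "set_eq E \<sigma> \<tau> = (\<^bold>\<forall>x. mem E x \<sigma> \<^bold>\<longleftrightarrow> mem E x \<tau>)"

definition prod_eq ::
    "('x \<Rightarrow> 'x \<Rightarrow> 'p::preorder fm) \<Rightarrow> ('y \<Rightarrow> 'y \<Rightarrow> 'p fm) \<Rightarrow> 'x \<times> 'y \<Rightarrow> 'x \<times> 'y \<Rightarrow> 'p fm" where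
  "prod_eq E F a b = (E (fst a) (fst b) \<^bold>\<and> F (snd a) (snd b))"

text \<open>The canonical name for the set of all \<open>x\<close> such that \<open>\<Phi> x\<close> holds in V[G].\<close>

definition compr :: "('x \<Rightarrow> 'p::preorder fm) \<Rightarrow> ('x, 'p) name" where
  "compr \<Phi> = {(x, p). \<Phi> x p}"

section \<open>The real numbers of the extension\<close>

text \<open>A real of V[G] is an open lower Dedekind cut of rationals.\<close>

type_synonym 'p rname = "(rat, 'p) name"

abbreviation rmem :: "rat \<Rightarrow> 'p::preorder rname \<Rightarrow> 'p fm" where
  "rmem \<equiv> mem geq"

abbreviation req :: "'p::preorder rname \<Rightarrow> 'p rname \<Rightarrow> 'p fm" where
  "req \<equiv> set_eq geq"

definition is_real :: "'p::preorder rname \<Rightarrow> 'p fm" where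
  "is_real x =
     ((\<^bold>\<exists>q. rmem q x) \<^bold>\<and> (\<^bold>\<exists>q. \<^bold>\<not> rmem q x) \<^bold>\<and>
      (\<^bold>\<forall>q r. rmem q x \<^bold>\<and> ground (r < q) \<^bold>\<longrightarrow> rmem r x) \<^bold>\<and>
      (\<^bold>\<forall>q. rmem q x \<^bold>\<longrightarrow> (\<^bold>\<exists>r. ground (q < r) \<^bold>\<and> rmem r x)))"

definition rof :: "rat \<Rightarrow> 'p::preorder rname" where
  "rof c = compr (\<lambda>q. ground (q < c))"

definition rle :: "'p::preorder rname \<Rightarrow> 'p rname \<Rightarrow> 'p fm" where
  "rle x y = (\<^bold>\<forall>q. rmem q x \<^bold>\<longrightarrow> rmem q y)"

definition rlt :: "'p::preorder rname \<Rightarrow> 'p rname \<Rightarrow> 'p fm" where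
  "rlt x y = (\<^bold>\<exists>q. rmem q y \<^bold>\<and> \<^bold>\<not> rmem q x)"

definition radd :: "'p::preorder rname \<Rightarrow> 'p rname \<Rightarrow> 'p rname" where
  "radd x y = compr (\<lambda>q. \<^bold>\<exists>r s. ground (q = r + s) \<^bold>\<and> rmem r x \<^bold>\<and> rmem s y)"

definition rscale :: "rat \<Rightarrow> 'p::preorder rname \<Rightarrow> 'p rname" where
  "rscale c x =
     (if c = 0 then rof 0
      else if c > 0 then compr (\<lambda>q. rmem (q / c) x)
      else compr (\<lambda>q. \<^bold>\<exists>t. ground (q < t) \<^bold>\<and> \<^bold>\<not> rmem (t / c) x))"

definition rdiff :: "'p::preorder rname \<Rightarrow> 'p rname \<Rightarrow> 'p rname" where
  "rdiff x y = radd x (rscale (-1) y)"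

definition rabs :: "'p::preorder rname \<Rightarrow> 'p rname" where
  "rabs x = compr (\<lambda>q. rmem q x \<^bold>\<or> rmem q (rscale (-1) x))"

primrec rsum :: "(nat \<Rightarrow> 'p::preorder rname) \<Rightarrow> nat \<Rightarrow> 'p rname" where
  "rsum s 0 = rof 0"
| "rsum s (Suc n) = radd (rsum s n) (s n)"

definition converges :: "(nat \<Rightarrow> 'p::preorder rname) \<Rightarrow> 'p rname \<Rightarrow> 'p fm" where
  "converges s l =
     (\<^bold>\<forall>\<epsilon>. ground (0 < \<epsilon>) \<^bold>\<longrightarrow>
        (\<^bold>\<exists>N. \<^bold>\<forall>n. ground (N \<le> n) \<^bold>\<longrightarrow> rlt (rabs (rdiff (s n) l)) (rof \<epsilon>)))"

text \<open>
  \<open>is_fun E D f\<close>: in V[G], \<open>f\<close> is a function, as a set of ordered pairs, from the set of all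
  \<open>x\<close> with \<open>D x\<close> to the reals; \<open>app E f x\<close> is a name for its value at \<open>x\<close>.
\<close>

definition is_fun :: "('x \<Rightarrow> 'x \<Rightarrow> 'p::preorder fm) \<Rightarrow> ('x \<Rightarrow> 'p fm) \<Rightarrow>
    ('x \<times> 'p rname, 'p) name \<Rightarrow> 'p fm" where
  "is_fun E D f =
     ((\<^bold>\<forall>x y. mem (prod_eq E req) (x, y) f \<^bold>\<longrightarrow> D x \<^bold>\<and> is_real y) \<^bold>\<and>
      (\<^bold>\<forall>x. D x \<^bold>\<longrightarrow> (\<^bold>\<exists>y. mem (prod_eq E req) (x, y) f)) \<^bold>\<and>
      (\<^bold>\<forall>x y z. mem (prod_eq E req) (x, y) f \<^bold>\<and> mem (prod_eq E req) (x, z) f \<^bold>\<longrightarrow> req y z))"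

definition app :: "('x \<Rightarrow> 'x \<Rightarrow> 'p::preorder fm) \<Rightarrow>
    ('x \<times> 'p rname, 'p) name \<Rightarrow> 'x \<Rightarrow> 'p rname" where
  "app E f x = compr (\<lambda>q. \<^bold>\<exists>y. mem (prod_eq E req) (x, y) f \<^bold>\<and> rmem q y)"

section \<open>The Stone space, computed in the extension\<close>

type_synonym ('a, 'p) point = "('a, 'p) name"
type_synonym ('a, 'p) pset = "(('a, 'p) point, 'p) name"

abbreviation pmem :: "('a, 'p) point \<Rightarrow> ('a, 'p::preorder) pset \<Rightarrow> 'p fm" where
  "pmem \<equiv> mem (set_eq geq)"

abbreviation pset_eq :: "('a, 'p) pset \<Rightarrow> ('a, 'p::preorder) pset \<Rightarrow> 'p fm" where
  "pset_eq \<equiv> set_eq (set_eq geq)"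

definition stone :: "('a::boolean_algebra, 'p::preorder) point \<Rightarrow> 'p fm" where
  "stone u =
     (mem geq top u \<^bold>\<and> \<^bold>\<not> mem geq bot u \<^bold>\<and>
      (\<^bold>\<forall>a b. mem geq a u \<^bold>\<and> ground (a \<le> b) \<^bold>\<longrightarrow> mem geq b u) \<^bold>\<and>
      (\<^bold>\<forall>a b. mem geq a u \<^bold>\<and> mem geq b u \<^bold>\<longrightarrow> mem geq (inf a b) u) \<^bold>\<and>
      (\<^bold>\<forall>a. mem geq a u \<^bold>\<or> mem geq (- a) u))"

definition psub :: "('a, 'p) pset \<Rightarrow> ('a, 'p::preorder) pset \<Rightarrow> 'p fm" where
  "psub B C = (\<^bold>\<forall>u. pmem u B \<^bold>\<longrightarrow> pmem u C)"

definition pdisj :: "('a, 'p) pset \<Rightarrow> ('a, 'p::preorder) pset \<Rightarrow> 'p fm" where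
  "pdisj B C = (\<^bold>\<forall>u. \<^bold>\<not> (pmem u B \<^bold>\<and> pmem u C))"

definition stone_space :: "('a::boolean_algebra, 'p::preorder) pset" where
  "stone_space = compr stone"

definition clopen :: "'a::boolean_algebra \<Rightarrow> ('a, 'p::preorder) pset" where
  "clopen a = compr (\<lambda>u. stone u \<^bold>\<and> mem geq a u)"

definition pcompl :: "('a::boolean_algebra, 'p::preorder) pset \<Rightarrow> ('a, 'p) pset" where
  "pcompl B = compr (\<lambda>u. stone u \<^bold>\<and> \<^bold>\<not> pmem u B)"

definition is_open :: "('a::boolean_algebra, 'p::preorder) pset \<Rightarrow> 'p fm" where
  "is_open B =
     (psub B stone_space \<^bold>\<and>
      (\<^bold>\<forall>u. pmem u B \<^bold>\<longrightarrow> (\<^bold>\<exists>a. mem geq a u \<^bold>\<and> psub (clopen a) B)))"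

definition is_closed :: "('a::boolean_algebra, 'p::preorder) pset \<Rightarrow> 'p fm" where
  "is_closed B = (psub B stone_space \<^bold>\<and> is_open (pcompl B))"

text \<open>
  A sequence of subsets of the Stone space is a name for a set of pairs (index, point).
\<close>

type_synonym ('a, 'p) pseq = "(nat \<times> ('a, 'p) point, 'p) name"

definition pnth :: "('a, 'p::preorder) pseq \<Rightarrow> nat \<Rightarrow> ('a, 'p) pset" where
  "pnth S n = compr (\<lambda>u. mem (prod_eq geq (set_eq geq)) (n, u) S)"

definition pUnion :: "('a, 'p::preorder) pseq \<Rightarrow> ('a, 'p) pset" where
  "pUnion S = compr (\<lambda>u. \<^bold>\<exists>n. pmem u (pnth S n))"

definition is_sigma_algebra ::
    "(('a::boolean_algebra, 'p::preorder) pset, 'p) name \<Rightarrow> 'p fm" where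
  "is_sigma_algebra \<S> =
     ((\<^bold>\<forall>B. mem pset_eq B \<S> \<^bold>\<longrightarrow> psub B stone_space) \<^bold>\<and>
      mem pset_eq stone_space \<S> \<^bold>\<and>
      (\<^bold>\<forall>B. mem pset_eq B \<S> \<^bold>\<longrightarrow> mem pset_eq (pcompl B) \<S>) \<^bold>\<and>
      (\<^bold>\<forall>S. (\<^bold>\<forall>n. mem pset_eq (pnth S n) \<S>) \<^bold>\<longrightarrow> mem pset_eq (pUnion S) \<S>))"

definition is_borel :: "('a::boolean_algebra, 'p::preorder) pset \<Rightarrow> 'p fm" where
  "is_borel B =
     (\<^bold>\<forall>\<S>. is_sigma_algebra \<S> \<^bold>\<and> (\<^bold>\<forall>C. is_open C \<^bold>\<longrightarrow> mem pset_eq C \<S>)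
        \<^bold>\<longrightarrow> mem pset_eq B \<S>)"

definition is_continuous ::
    "(('a::boolean_algebra, 'p::preorder) point \<times> 'p rname, 'p) name \<Rightarrow> 'p fm" where
  "is_continuous f =
     (is_fun (set_eq geq) stone f \<^bold>\<and>
      (\<^bold>\<forall>u \<epsilon>. stone u \<^bold>\<and> ground (0 < \<epsilon>) \<^bold>\<longrightarrow>
         (\<^bold>\<exists>a. mem geq a u \<^bold>\<and>
            (\<^bold>\<forall>v. stone v \<^bold>\<and> mem geq a v \<^bold>\<longrightarrow>
               rlt (rabs (rdiff (app (set_eq geq) f v) (app (set_eq geq) f u))) (rof \<epsilon>)))))"

section \<open>Measures in the extension\<close>

definition is_measure :: "('a::boolean_algebra \<Rightarrow> 'p::preorder rname) \<Rightarrow> 'p fm" where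
  "is_measure m =
     ((\<^bold>\<forall>a b. ground (inf a b = bot) \<^bold>\<longrightarrow> req (m (sup a b)) (radd (m a) (m b))) \<^bold>\<and>
      (\<^bold>\<exists>c. \<^bold>\<forall>a b. ground (inf a b = bot) \<^bold>\<longrightarrow>
         rle (radd (rabs (m a)) (rabs (m b))) (rof c)))"

text \<open>
  \<open>v\<close> is the signed Radon measure on the Borel sets of the Stone space that extends \<open>m\<close>: it is
  countably additive and its variation is inner regular with respect to the closed sets, which
  are the compact sets of the Stone space.
\<close>

definition is_radon_extension :: "('a::boolean_algebra \<Rightarrow> 'p::preorder rname) \<Rightarrow>
    (('a, 'p) pset \<Rightarrow> 'p rname) \<Rightarrow> 'p fm" where
  "is_radon_extension m v =
     ((\<^bold>\<forall>S. (\<^bold>\<forall>n. is_borel (pnth S n)) \<^bold>\<and>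
             (\<^bold>\<forall>i j. ground (i \<noteq> j) \<^bold>\<longrightarrow> pdisj (pnth S i) (pnth S j))
          \<^bold>\<longrightarrow> converges (rsum (\<lambda>n. v (pnth S n))) (v (pUnion S))) \<^bold>\<and>
      (\<^bold>\<forall>B \<epsilon>. is_borel B \<^bold>\<and> ground (0 < \<epsilon>) \<^bold>\<longrightarrow>
         (\<^bold>\<exists>K. is_closed K \<^bold>\<and> psub K B \<^bold>\<and>
            (\<^bold>\<forall>C. is_borel C \<^bold>\<and> psub C B \<^bold>\<and> pdisj C K \<^bold>\<longrightarrow> rlt (rabs (v C)) (rof \<epsilon>)))) \<^bold>\<and>
      (\<^bold>\<forall>a. req (v (clopen a)) (m a)))"

text \<open>
  The integral of a bounded Borel function \<open>f\<close> is the limit of the integrals of the simple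
  functions, here with rational values, that approximate \<open>f\<close> uniformly. A finite sequence of
  rationals in V[G] belongs to V, so the values are given by a ground list.
\<close>

definition is_integral :: "(('a::boolean_algebra, 'p::preorder) point \<Rightarrow> 'p rname) \<Rightarrow>
    (('a, 'p) pset \<Rightarrow> 'p rname) \<Rightarrow> 'p rname \<Rightarrow> 'p fm" where
  "is_integral f v l =
     (is_real l \<^bold>\<and>
      (\<^bold>\<forall>\<epsilon>. ground (0 < \<epsilon>) \<^bold>\<longrightarrow>
        (\<^bold>\<exists>\<delta>. ground (0 < \<delta>) \<^bold>\<and>
          (\<^bold>\<forall>c S.
             (\<^bold>\<forall>i. ground (i < length c) \<^bold>\<longrightarrow> is_borel (pnth S i)) \<^bold>\<and>
             (\<^bold>\<forall>i j. ground (i < j \<and> j < length c) \<^bold>\<longrightarrow> pdisj (pnth S i) (pnth S j)) \<^bold>\<and>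
             (\<^bold>\<forall>u. stone u \<^bold>\<longrightarrow> (\<^bold>\<exists>i. ground (i < length c) \<^bold>\<and> pmem u (pnth S i))) \<^bold>\<and>
             (\<^bold>\<forall>i u. ground (i < length c) \<^bold>\<and> pmem u (pnth S i) \<^bold>\<longrightarrow>
                rle (rabs (rdiff (f u) (rof (c ! i)))) (rof \<delta>))
             \<^bold>\<longrightarrow> rlt (rabs (rdiff (rsum (\<lambda>i. rscale (c ! i) (v (pnth S i))) (length c)) l))
                   (rof \<epsilon>)))))"

text \<open>
  A sequence of measures on the algebra is a name for a function on pairs (index, element); a
  sequence of Radon measures is a name for a function on pairs (index, Borel set).
\<close>

type_synonym ('a, 'p) mseq = "((nat \<times> 'a) \<times> 'p rname, 'p) name"
type_synonym ('a, 'p) rseq = "((nat \<times> ('a, 'p) pset) \<times> 'p rname, 'p) name"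

abbreviation mval :: "('a, 'p::preorder) mseq \<Rightarrow> nat \<Rightarrow> 'a \<Rightarrow> 'p rname" where
  "mval \<mu> n a \<equiv> app geq \<mu> (n, a)"

abbreviation rval :: "('a, 'p::preorder) rseq \<Rightarrow> nat \<Rightarrow> ('a, 'p) pset \<Rightarrow> 'p rname" where
  "rval \<nu> n B \<equiv> app (prod_eq geq pset_eq) \<nu> (n, B)"

definition is_mseq :: "('a::boolean_algebra, 'p::preorder) mseq \<Rightarrow> 'p fm" where
  "is_mseq \<mu> = (is_fun geq (\<lambda>x. ground True) \<mu> \<^bold>\<and> (\<^bold>\<forall>n. is_measure (mval \<mu> n)))"

definition is_radon_seq ::
    "('a::boolean_algebra, 'p::preorder) mseq \<Rightarrow> ('a, 'p) rseq \<Rightarrow> 'p fm" where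
  "is_radon_seq \<mu> \<nu> =
     (is_fun (prod_eq geq pset_eq) (\<lambda>x. is_borel (snd x)) \<nu> \<^bold>\<and>
      (\<^bold>\<forall>n. is_radon_extension (mval \<mu> n) (rval \<nu> n)))"

definition pointwise_null :: "('a::boolean_algebra, 'p::preorder) mseq \<Rightarrow> 'p fm" where
  "pointwise_null \<mu> = (\<^bold>\<forall>a. converges (\<lambda>n. mval \<mu> n a) (rof 0))"

text \<open>
  Since the Radon extensions and the integrals exist and are unique, the existential quantifiers
  over \<open>\<nu>\<close> and \<open>l\<close> below only serve to name them.
\<close>

definition weak_star_null :: "('a::boolean_algebra, 'p::preorder) mseq \<Rightarrow> 'p fm" where
  "weak_star_null \<mu> =
     (\<^bold>\<exists>\<nu>. is_radon_seq \<mu> \<nu> \<^bold>\<and>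
        (\<^bold>\<forall>f. is_continuous f \<^bold>\<longrightarrow>
           (\<^bold>\<exists>l. is_fun geq (\<lambda>x. ground True) l \<^bold>\<and>
              (\<^bold>\<forall>n. is_integral (app (set_eq geq) f) (rval \<nu> n) (app geq l n)) \<^bold>\<and>
              converges (app geq l) (rof 0))))"

definition weakly_null :: "('a::boolean_algebra, 'p::preorder) mseq \<Rightarrow> 'p fm" where
  "weakly_null \<mu> =
     (\<^bold>\<exists>\<nu>. is_radon_seq \<mu> \<nu> \<^bold>\<and>
        (\<^bold>\<forall>B. is_borel B \<^bold>\<longrightarrow> converges (\<lambda>n. rval \<nu> n B) (rof 0)))"

definition nikodym :: "'a::boolean_algebra itself \<Rightarrow> 'p::preorder fm" where
  "nikodym _ =
     (\<^bold>\<forall>\<mu> :: ('a, 'p) mseq. is_mseq \<mu> \<^bold>\<and> pointwise_null \<mu> \<^bold>\<longrightarrow> weak_star_null \<mu>)"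

definition grothendieck :: "'a::boolean_algebra itself \<Rightarrow> 'p::preorder fm" where
  "grothendieck _ =
     (\<^bold>\<forall>\<mu> :: ('a, 'p) mseq. is_mseq \<mu> \<^bold>\<and> weak_star_null \<mu> \<^bold>\<longrightarrow> weakly_null \<mu>)"

section \<open>Cohen, unsplit and random reals over the ground model\<close>

definition in_cantor :: "(nat \<times> bool, 'p::preorder) name \<Rightarrow> 'p fm" where
  "in_cantor x =
     (\<^bold>\<forall>n. \<^bold>\<exists>b. mem geq (n, b) x \<^bold>\<and> (\<^bold>\<forall>b'. mem geq (n, b') x \<^bold>\<longrightarrow> ground (b' = b)))"

definition cohen_dense :: "(nat \<rightharpoonup> bool) set \<Rightarrow> bool" where
  "cohen_dense D \<longleftrightarrow>
     (\<forall>s\<in>D. finite (dom s)) \<and> (\<forall>t. finite (dom t) \<longrightarrow> (\<exists>s\<in>D. t \<subseteq>\<^sub>m s))"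

definition cohen_over_ground :: "(nat \<times> bool, 'p::preorder) name \<Rightarrow> 'p fm" where
  "cohen_over_ground x =
     (in_cantor x \<^bold>\<and>
      (\<^bold>\<forall>D. ground (cohen_dense D) \<^bold>\<longrightarrow>
         (\<^bold>\<exists>s. ground (s \<in> D) \<^bold>\<and> (\<^bold>\<forall>n b. ground (s n = Some b) \<^bold>\<longrightarrow> mem geq (n, b) x))))"

definition fin :: "(nat, 'p::preorder) name \<Rightarrow> 'p fm" where
  "fin U = (\<^bold>\<exists>m. \<^bold>\<forall>n. mem geq n U \<^bold>\<longrightarrow> ground (n < m))"

definition unsplit_over_ground :: "(nat, 'p::preorder) name \<Rightarrow> 'p fm" where
  "unsplit_over_ground U =
     (\<^bold>\<not> fin U \<^bold>\<and>
      (\<^bold>\<forall>A. fin (compr (\<lambda>n. mem geq n U \<^bold>\<and> ground (n \<in> A))) \<^bold>\<or>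
           fin (compr (\<lambda>n. mem geq n U \<^bold>\<and> ground (n \<notin> A)))))"

datatype borel_code = CBasic nat bool | CCompl borel_code | CUnion "nat \<Rightarrow> borel_code"

primrec code_set :: "borel_code \<Rightarrow> (nat \<Rightarrow> bool) set" where
  "code_set (CBasic n b) = {x. x n = b}"
| "code_set (CCompl c) = - code_set c"
| "code_set (CUnion c) = (\<Union>n. code_set (c n))"

text \<open>Membership of a real of V[G] in the Borel set of V[G] with the given ground code.\<close>

primrec in_code :: "(nat \<times> bool, 'p::preorder) name \<Rightarrow> borel_code \<Rightarrow> 'p fm" where
  "in_code x (CBasic n b) = mem geq (n, b) x"
| "in_code x (CCompl c) = (\<^bold>\<not> in_code x c)"
| "in_code x (CUnion c) = (\<^bold>\<exists>n. in_code x (c n))"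

definition cantor_measure :: "(nat \<Rightarrow> bool) measure" where
  "cantor_measure = Pi\<^sub>M UNIV (\<lambda>_. measure_pmf (bernoulli_pmf (1/2)))"

definition random_over_ground :: "(nat \<times> bool, 'p::preorder) name \<Rightarrow> 'p fm" where
  "random_over_ground x =
     (in_cantor x \<^bold>\<and>
      (\<^bold>\<forall>c. ground (code_set c \<in> null_sets cantor_measure) \<^bold>\<longrightarrow> \<^bold>\<not> in_code x c))"

end

theory Submission
  imports Defs
begin

text \<open>
  In V[G] it suffices to find points \<open>v i\<close>, \<open>v' i\<close> of the Stone space and disjoint elements
  \<open>d i\<close> with \<open>d i\<close> in \<open>v i\<close> but in no \<open>v' j\<close>, such that the sums of \<open>\<delta>\<^bsub>v i\<^esub> - \<delta>\<^bsub>v' i\<^esub>\<close> over \<open>i < 8 ^ n\<close>,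
  divided by \<open>4 ^ n\<close>, are pointwise null. These measures are then not weak* null: a continuous
  function that is constant on each \<open>d i\<close>, with values tending to 0 slowly, has integrals at least 1.
  Dividing by \<open>8 ^ n\<close> instead makes the norms bounded, hence the sequence is weak* null by compactness,
  but every term gives measure 1 to the open union of the \<open>d i\<close>.

  If the algebra has an element with infinitely many parts that cannot be split into two such
  elements, then there is a convergent sequence of points already in V. Otherwise there is a
  binary tree of elements. A Cohen real \<open>c\<close> then determines an ultrafilter \<open>u(c)\<close>, and flipping the
  \<open>i\<close>-th digit of \<open>c\<close> gives ultrafilters converging to \<open>u(c)\<close>. For the other two cases take ground
  points \<open>x m\<close> in disjoint elements: an unsplit set with elements \<open>u 0 < u 1 < \<dots>\<close> gives the pairs
  \<open>x (u (2 i))\<close>, \<open>x (u (2 i + 1))\<close>, and a random real gives the pairs \<open>x (2 i)\<close>, \<open>x (2 i + 1)\<close> in the order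
  chosen by its \<open>i\<close>-th digit, by Hoeffding's inequality and the Borel-Cantelli lemma.

  A formula of the forcing language is regular if it is inherited by stronger conditions and holds
  wherever it holds densely; all arguments in V[G] are carried out for regular formulas, passing to
  conditions that decide the finitely many facts in question. All values of the measures are
  thereby decided to be rational.
\<close>

section \<open>Density and regular formulas\<close>

text \<open>The bases 8 and 4 answer two competing demands. A pointwise null sequence with bounded
  norms is weak* null, so refuting the Nikodym property needs unbounded norms, here of order 8 ^ n /
  4 ^ n = 2 ^ n. Pointwise nullity then asks that a signed count of 8 ^ n pairs be o(4 ^ n). Random
  signs give counts of order sqrt(8) ^ n, and 4 lies strictly between sqrt 8 and 8; the other
  constructions give bounded counts. So one counting condition serves all cases and both
  normalisations.

  The obstacle is that the points, the disjoint elements, the test function and the open set may all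
  fail to lie in V, and that the forcing notion is an arbitrary preorder: infinitely many decisions
  cannot be made at once. Each argument is therefore cut down to finitely many ground data. Every
  measure has finite support, each element of the algebra is tested against finitely many points at
  a time, and only finite initial segments of the disjoint sequence are ever decided. Passing to
  infinitely many indices is left to the names themselves, which are written so that they make sense
  before anything is decided.\<close>

definition dns :: "'p::preorder \<Rightarrow> ('p \<Rightarrow> bool) \<Rightarrow> bool" where
  "dns p Q \<longleftrightarrow> (\<forall>q\<le>p. \<exists>r\<le>q. Q r)"

definition reg :: "'p::preorder fm \<Rightarrow> bool" where
  "reg \<phi> \<longleftrightarrow> (\<forall>p q. q \<le> p \<longrightarrow> \<phi> p \<longrightarrow> \<phi> q) \<and> (\<forall>p. dns p \<phi> \<longrightarrow> \<phi> p)"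

lemma regD: "reg \<phi> \<Longrightarrow> \<phi> p \<Longrightarrow> q \<le> p \<Longrightarrow> \<phi> q"
  by (auto simp: reg_def)

lemma reg_dns: "reg \<phi> \<Longrightarrow> dns p \<phi> \<Longrightarrow> \<phi> p"
  by (auto simp: reg_def)

lemma regI: "(\<And>p q. q \<le> p \<Longrightarrow> \<phi> p \<Longrightarrow> \<phi> q) \<Longrightarrow> (\<And>p. dns p \<phi> \<Longrightarrow> \<phi> p) \<Longrightarrow> reg \<phi>"
  by (auto simp: reg_def)

lemma dns_obtain:
  assumes "dns p Q" obtains r where "r \<le> p" "Q r"
  using assms unfolding dns_def by blast

lemma dns_mono: "dns p Q \<Longrightarrow> q \<le> p \<Longrightarrow> (\<And>r. r \<le> q \<Longrightarrow> Q r \<Longrightarrow> R r) \<Longrightarrow> dns q R"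
  unfolding dns_def by (meson order_trans)

lemma dns_le: "dns p Q \<Longrightarrow> q \<le> p \<Longrightarrow> dns q Q"
  by (rule dns_mono)

lemma dns_bind: "dns p Q \<Longrightarrow> (\<And>r. r \<le> p \<Longrightarrow> Q r \<Longrightarrow> dns r R) \<Longrightarrow> dns p R"
  unfolding dns_def by (meson order_trans order_refl)

lemma dns_now: "(\<And>r. r \<le> p \<Longrightarrow> Q r) \<Longrightarrow> dns p Q"
  unfolding dns_def by (meson order_refl)

lemma reg_bind:
  "reg \<phi> \<Longrightarrow> dns p Q \<Longrightarrow> (\<And>r. r \<le> p \<Longrightarrow> Q r \<Longrightarrow> \<phi> r) \<Longrightarrow> \<phi> p"
  by (rule reg_dns) (auto intro: dns_mono)

lemma dns_dns [simp]: "dns p (\<lambda>r. dns r Q) \<longleftrightarrow> dns p Q"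
  by (auto intro: dns_bind dns_now dns_le)

lemma dns_const [simp]: "dns p (\<lambda>r. b) \<longleftrightarrow> b"
  unfolding dns_def by blast

text \<open>The decisions are made one after another, and heredity of \<open>P\<close> keeps the
  earlier ones. Finiteness is essential, since a preorder need not have lower bounds for infinite
  descending sequences.\<close>

lemma dns_ball_finite:
  assumes "finite F" "\<And>i. i \<in> F \<Longrightarrow> dns p (P i)"
    "\<And>i q r. i \<in> F \<Longrightarrow> P i q \<Longrightarrow> r \<le> q \<Longrightarrow> P i r"
  shows "dns p (\<lambda>r. \<forall>i\<in>F. P i r)"
  using assms
proof (induction F rule: finite_induct)
  case empty
  then show ?case by simp
next
  case (insert x F)
  have "dns p (P x)" using insert by blast
  then show ?case
  proof (rule dns_bind)
    fix r assume r: "r \<le> p" "P x r"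
    have "dns p (\<lambda>r. \<forall>i\<in>F. P i r)" using insert by blast
    then show "dns r (\<lambda>r. \<forall>i\<in>insert x F. P i r)"
      by (rule dns_mono) (use r insert.prems in auto)
  qed
qed

lemma ground_iff [simp]: "ground b p \<longleftrightarrow> b"
  by (simp add: ground_def)

lemma fand_iff [simp]: "fand \<phi> \<psi> p \<longleftrightarrow> \<phi> p \<and> \<psi> p"
  by (simp add: fand_def)

lemma fall_iff [simp]: "fall \<Phi> p \<longleftrightarrow> (\<forall>x. \<Phi> x p)"
  by (simp add: fall_def)

lemma fnot_iff: "fnot \<phi> p \<longleftrightarrow> (\<forall>q\<le>p. \<not> \<phi> q)"
  by (simp add: fnot_def)

lemma fimp_iff: "fimp \<phi> \<psi> p \<longleftrightarrow> (\<forall>q\<le>p. \<phi> q \<longrightarrow> \<psi> q)"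
  by (simp add: fimp_def)

lemma fiff_iff: "fiff \<phi> \<psi> p \<longleftrightarrow> (\<forall>q\<le>p. \<phi> q \<longleftrightarrow> \<psi> q)"
  by (auto simp: fiff_def fimp_iff)

lemma f_or_iff [simp]: "f_or \<phi> \<psi> p \<longleftrightarrow> dns p (\<lambda>r. \<phi> r \<or> \<psi> r)"
  by (simp add: f_or_def dns_def)

lemma fex_iff [simp]: "fex \<Phi> p \<longleftrightarrow> dns p (\<lambda>r. \<exists>x. \<Phi> x r)"
  by (simp add: fex_def dns_def)

lemma decide: "dns p (\<lambda>r. \<phi> r \<or> fnot \<phi> r)"
  unfolding dns_def fnot_iff by (meson order_refl)

lemma reg_ground [intro, simp]: "reg (ground b)"
  by (rule regI) (auto simp: dns_def)

lemma reg_dnsI [intro, simp]: "reg (\<lambda>p. dns p Q)"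
  by (rule regI) (auto intro: dns_le)

lemma reg_fex [intro, simp]: "reg (fex \<Phi>)"
  unfolding fex_iff[abs_def] by simp

lemma reg_f_or [intro, simp]: "reg (f_or \<phi> \<psi>)"
  unfolding f_or_iff[abs_def] by simp

lemma reg_conj [intro]: "reg \<phi> \<Longrightarrow> reg \<psi> \<Longrightarrow> reg (\<lambda>p. \<phi> p \<and> \<psi> p)"
  by (rule regI) (auto intro: regD reg_bind)

lemma reg_fand [intro, simp]: "reg \<phi> \<Longrightarrow> reg \<psi> \<Longrightarrow> reg (fand \<phi> \<psi>)"
  unfolding fand_iff[abs_def] by (rule reg_conj)

lemma reg_all [intro]: "(\<And>x. reg (\<Phi> x)) \<Longrightarrow> reg (\<lambda>p. \<forall>x. \<Phi> x p)"
  by (rule regI) (auto intro: regD reg_bind)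

lemma reg_fall [intro, simp]: "(\<And>x. reg (\<Phi> x)) \<Longrightarrow> reg (fall \<Phi>)"
  unfolding fall_iff[abs_def] by (rule reg_all)

lemma reg_fimp [intro, simp]:
  assumes "reg \<phi>" "reg \<psi>" shows "reg (fimp \<phi> \<psi>)"
proof (rule regI)
  fix p q :: 'a assume "q \<le> p" "fimp \<phi> \<psi> p"
  then show "fimp \<phi> \<psi> q" by (auto simp: fimp_iff intro: order_trans)
next
  fix p assume d: "dns p (fimp \<phi> \<psi>)"
  show "fimp \<phi> \<psi> p" unfolding fimp_iff
  proof (intro allI impI)
    fix q assume q: "q \<le> p" "\<phi> q"
    show "\<psi> q"
      by (rule reg_bind[OF assms(2) dns_le[OF d q(1)]])
        (use q assms(1) in \<open>auto simp: fimp_iff intro: regD\<close>)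
  qed
qed

lemma reg_fnot [intro, simp]:
  assumes "reg \<phi>" shows "reg (fnot \<phi>)"
proof -
  have "fnot \<phi> = fimp \<phi> (ground False)"
    by (auto simp: fimp_iff fnot_iff)
  then show ?thesis using assms by simp
qed

lemma reg_fiff [intro, simp]: "reg \<phi> \<Longrightarrow> reg \<psi> \<Longrightarrow> reg (fiff \<phi> \<psi>)"
  by (simp add: fiff_def)

lemma fnotD: "fnot \<phi> p \<Longrightarrow> \<phi> p \<Longrightarrow> False"
  by (auto simp: fnot_iff)

lemma fnot_le: "fnot \<phi> p \<Longrightarrow> q \<le> p \<Longrightarrow> fnot \<phi> q"
  by (auto simp: fnot_iff intro: order_trans)

lemma fnot_fnotD: "reg \<phi> \<Longrightarrow> fnot (fnot \<phi>) p \<Longrightarrow> \<phi> p"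
  by (rule reg_bind[OF _ decide[of p \<phi>]]) (auto simp: fnot_iff)

section \<open>Equality and membership of names\<close>

text \<open>The equality that V[G] assigns to names, treated abstractly so that membership,
  functions and comprehension are handled once for ground elements, points, sets and pairs.\<close>

definition eqv :: "('x \<Rightarrow> 'x \<Rightarrow> 'p::preorder fm) \<Rightarrow> bool" where
  "eqv E \<longleftrightarrow> (\<forall>x p. E x x p) \<and> (\<forall>x y p. E x y p \<longrightarrow> E y x p) \<and>
     (\<forall>x y z p. E x y p \<longrightarrow> E y z p \<longrightarrow> E x z p) \<and> (\<forall>x y. reg (E x y))"

lemma eqv_refl: "eqv E \<Longrightarrow> E x x p"
  and eqv_sym: "eqv E \<Longrightarrow> E x y p \<Longrightarrow> E y x p"
  and eqv_trans: "eqv E \<Longrightarrow> E x y p \<Longrightarrow> E y z p \<Longrightarrow> E x z p"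
  and eqv_reg: "eqv E \<Longrightarrow> reg (E x y)"
  unfolding eqv_def by blast+

lemma geq_iff: "geq x y p \<longleftrightarrow> x = y"
  by (simp add: geq_def)

lemma geq_refl: "geq x x p"
  by (simp add: geq_iff)

lemma eqv_geq [simp]: "eqv geq"
  by (auto simp: eqv_def geq_def[abs_def])

lemma mem_iff: "mem E x \<tau> p \<longleftrightarrow> dns p (\<lambda>r. \<exists>(y, s)\<in>\<tau>. r \<le> s \<and> E x y r)"
  by (simp add: mem_def dns_def)

lemma reg_mem [intro, simp]: "reg (mem E x \<tau>)"
  unfolding mem_iff[abs_def] by simp

lemma set_eq_iff': "set_eq E \<sigma> \<tau> p \<longleftrightarrow> (\<forall>x. \<forall>q\<le>p. mem E x \<sigma> q \<longleftrightarrow> mem E x \<tau> q)"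
  by (simp add: set_eq_def fiff_iff)

lemma set_eqD: "set_eq E \<sigma> \<tau> p \<Longrightarrow> q \<le> p \<Longrightarrow> mem E x \<sigma> q \<longleftrightarrow> mem E x \<tau> q"
  by (simp add: set_eq_iff')

lemma set_eq_memD: "set_eq E \<sigma> \<tau> p \<Longrightarrow> mem E x \<sigma> p \<Longrightarrow> mem E x \<tau> p"
  using set_eqD[of E \<sigma> \<tau> p p] by auto

lemma eqv_set_eq [simp]: "eqv (set_eq E)"
proof -
  have "reg (set_eq E x y)" for x y by (simp add: set_eq_def)
  moreover have "set_eq E x x p" for x p by (simp add: set_eq_iff')
  moreover have "set_eq E x y p \<Longrightarrow> set_eq E y x p" for x y p by (simp add: set_eq_iff')
  moreover have "set_eq E x y p \<Longrightarrow> set_eq E y z p \<Longrightarrow> set_eq E x z p" for x y z p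
    by (simp add: set_eq_iff')
  ultimately show ?thesis unfolding eqv_def by blast
qed

lemma eqv_prod_eq [simp]: "eqv E \<Longrightarrow> eqv F \<Longrightarrow> eqv (prod_eq E F)"
proof -
  assume E: "eqv E" and F: "eqv F"
  have "prod_eq E F x x p" for x p by (simp add: prod_eq_def eqv_refl[OF E] eqv_refl[OF F])
  moreover have "prod_eq E F x y p \<Longrightarrow> prod_eq E F y x p" for x y p
    by (auto simp: prod_eq_def dest: eqv_sym[OF E] eqv_sym[OF F])
  moreover have "prod_eq E F x y p \<Longrightarrow> prod_eq E F y z p \<Longrightarrow> prod_eq E F x z p" for x y z p
    unfolding prod_eq_def fand_iff using eqv_trans[OF E] eqv_trans[OF F] by blast
  moreover have "reg (prod_eq E F x y)" for x y
    by (simp add: prod_eq_def eqv_reg[OF E] eqv_reg[OF F])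
  ultimately show ?thesis unfolding eqv_def by blast
qed

lemma reg_set_eq [simp]: "reg (set_eq E \<sigma> \<tau>)"
  by (rule eqv_reg) simp

lemma mem_cong:
  assumes "eqv E" "E x y p" "mem E x \<tau> p" shows "mem E y \<tau> p"
  using assms(3) unfolding mem_iff
proof (rule dns_mono)
  fix r assume r: "r \<le> p" "\<exists>(z, s)\<in>\<tau>. r \<le> s \<and> E x z r"
  have "E y x r" using eqv_sym[OF assms(1,2)] regD[OF eqv_reg[OF assms(1)]] r(1) by blast
  then show "\<exists>(z, s)\<in>\<tau>. r \<le> s \<and> E y z r" using r(2) eqv_trans[OF assms(1)] by blast
qed simp

text \<open>Membership also counts whatever is merely forced equal to a listed element, so
  comprehension is exact for a regular \<open>\<Phi>\<close> that respects \<open>E\<close>.\<close>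

lemma mem_compr:
  assumes "eqv E" "\<And>x. reg (\<Phi> x)" "\<And>x y p. E x y p \<Longrightarrow> \<Phi> y p \<Longrightarrow> \<Phi> x p"
  shows "mem E x (compr \<Phi>) = \<Phi> x"
proof (rule ext, rule iffI)
  fix p assume "mem E x (compr \<Phi>) p"
  then show "\<Phi> x p" unfolding mem_iff
    by (rule reg_bind[OF assms(2)]) (auto simp: compr_def intro: assms(3) regD[OF assms(2)])
next
  fix p assume "\<Phi> x p"
  then show "mem E x (compr \<Phi>) p" unfolding mem_iff
    by (intro dns_now) (auto simp: compr_def intro: eqv_refl[OF assms(1)] regD[OF assms(2)])
qed

lemma mem_geq_compr [simp]: "(\<And>x. reg (\<Phi> x)) \<Longrightarrow> mem geq x (compr \<Phi>) = \<Phi> x"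
  by (rule mem_compr) (auto simp: geq_iff)

section \<open>Arithmetic of real names\<close>

abbreviation upper :: "'p::preorder rname \<Rightarrow> rat \<Rightarrow> 'p fm" where
  "upper x b \<equiv> fnot (rmem b x)"

lemma reg_is_real [simp]: "reg (is_real x)"
  by (simp add: is_real_def)

lemma reg_rle [simp]: "reg (rle x y)" and reg_rlt [simp]: "reg (rlt x y)"
  by (simp_all add: rle_def rlt_def)

lemma is_real_iff: "is_real x p \<longleftrightarrow>
   dns p (\<lambda>r. \<exists>a. rmem a x r) \<and> dns p (\<lambda>r. \<exists>b. upper x b r) \<and>
   (\<forall>a b. \<forall>q\<le>p. rmem a x q \<longrightarrow> b < a \<longrightarrow> rmem b x q) \<and>
   (\<forall>a. \<forall>q\<le>p. rmem a x q \<longrightarrow> dns q (\<lambda>r. \<exists>b>a. rmem b x r))"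
  unfolding is_real_def by (auto simp: fimp_iff)

lemma real_down: "is_real x p \<Longrightarrow> rmem a x p \<Longrightarrow> b \<le> a \<Longrightarrow> rmem b x p"
proof -
  assume "is_real x p" and a: "rmem a x p" "b \<le> a"
  then have "\<forall>a b. \<forall>q\<le>p. rmem a x q \<longrightarrow> b < a \<longrightarrow> rmem b x q" unfolding is_real_iff by (elim conjE)
  then show ?thesis using a order.not_eq_order_implies_strict[of b a] by blast
qed

lemma real_less:
  assumes "is_real x p" "rmem a x p" "upper x b p" shows "a < b"
proof (rule ccontr)
  assume "\<not> a < b"
  then have "rmem b x p" using assms(1,2) real_down by (metis not_less)
  then show False using assms(3) by (auto dest: fnotD)
qed

lemma real_up: "is_real x p \<Longrightarrow> upper x a p \<Longrightarrow> a \<le> b \<Longrightarrow> upper x b p"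
  unfolding fnot_iff by (meson real_down regD reg_is_real)

text \<open>A lower and an upper rational are known densely. Walking up from the lower one in steps
  of \<open>\<epsilon>\<close> and deciding membership each time, the first step that leaves the cut
  gives \<open>a\<close>; by the Archimedean property finitely many steps suffice.\<close>

lemma real_approx:
  assumes "is_real x p" "0 < \<epsilon>"
  shows "dns p (\<lambda>r. \<exists>a. rmem a x r \<and> upper x (a + \<epsilon>) r)"
proof -
  have step: "dns r (\<lambda>r. \<exists>a. rmem a x r \<and> upper x (a + \<epsilon>) r)"
    if "r \<le> p" "rmem a x r" "upper x (a + of_nat k * \<epsilon>) r" for r a k
    using that
  proof (induction k arbitrary: r a)
    case 0
    then show ?case by (auto dest: fnotD)
  next
    case (Suc k)
    show ?case
    proof (rule dns_bind[OF decide[of r "rmem (a + \<epsilon>) x"]])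
      fix s assume s: "s \<le> r" "rmem (a + \<epsilon>) x s \<or> upper x (a + \<epsilon>) s"
      from s(2) show "dns s (\<lambda>r. \<exists>a. rmem a x r \<and> upper x (a + \<epsilon>) r)"
      proof
        assume a: "rmem (a + \<epsilon>) x s"
        have "upper x (a + \<epsilon> + of_nat k * \<epsilon>) s"
          using fnot_le[OF Suc.prems(3) s(1)] by (metis add.assoc mult.commute distrib_left mult.right_neutral of_nat_Suc)
        then show ?thesis using Suc.IH[of s "a + \<epsilon>"] a s(1) Suc.prems(1) order_trans by blast
      next
        assume a: "upper x (a + \<epsilon>) s"
        show ?thesis
          by (rule dns_now) (use a Suc.prems(2) s(1) in \<open>meson fnot_le order_trans regD reg_mem\<close>)
      qed
    qed
  qed
  have "dns p (\<lambda>r. \<exists>a. rmem a x r)" "dns p (\<lambda>r. \<exists>b. upper x b r)"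
    using assms by (auto simp: is_real_iff)
  note d = this
  show ?thesis
  proof (rule dns_bind[OF d(1)])
    fix r assume r: "r \<le> p" "\<exists>a. rmem a x r"
    then obtain a where a: "rmem a x r" by blast
    show "dns r (\<lambda>r. \<exists>a. rmem a x r \<and> upper x (a + \<epsilon>) r)"
    proof (rule dns_bind[OF dns_le[OF d(2) r(1)]])
      fix s assume s: "s \<le> r" "\<exists>b. upper x b s"
      then obtain b where b: "upper x b s" by blast
      obtain k :: nat where "(b - a) / \<epsilon> < of_nat k"
        using reals_Archimedean2 by blast
      then have "b \<le> a + of_nat k * \<epsilon>" using assms(2) by (simp add: field_simps)
      then have "upper x (a + of_nat k * \<epsilon>) s"
        using real_up[OF _ b] assms(1) s(1) r(1) by (meson order_trans regD reg_is_real)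
      then show "dns s (\<lambda>r. \<exists>a. rmem a x r \<and> upper x (a + \<epsilon>) r)"
        using step[of s a k] a s(1) r(1) by (meson order_trans regD reg_mem)
    qed
  qed
qed

lemma rmem_rof [simp]: "rmem q (rof c) p \<longleftrightarrow> q < c"
  unfolding rof_def by simp

lemma upper_rof [simp]: "upper (rof c) b p \<longleftrightarrow> c \<le> b"
  by (auto simp: fnot_iff not_less)

lemma is_real_rof [simp]: "is_real (rof c) p"
  by (auto simp: is_real_iff intro: exI[of _ "c - 1"] exI[of _ c] dest: dense)

lemma rmem_radd: "rmem q (radd x y) p \<longleftrightarrow> dns p (\<lambda>r. \<exists>a b. q = a + b \<and> rmem a x r \<and> rmem b y r)"
  unfolding radd_def
proof (simp, rule iffI)
  assume "dns p (\<lambda>r. \<exists>a. dns r (\<lambda>r. \<exists>b. q = a + b \<and> rmem a x r \<and> rmem b y r))"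
  then show "dns p (\<lambda>r. \<exists>a b. q = a + b \<and> rmem a x r \<and> rmem b y r)"
    by (rule dns_bind) (erule exE, erule dns_mono, auto)
next
  assume "dns p (\<lambda>r. \<exists>a b. q = a + b \<and> rmem a x r \<and> rmem b y r)"
  then show "dns p (\<lambda>r. \<exists>a. dns r (\<lambda>r. \<exists>b. q = a + b \<and> rmem a x r \<and> rmem b y r))"
  proof (rule dns_mono)
    fix r assume "\<exists>a b. q = a + b \<and> rmem a x r \<and> rmem b y r"
    then obtain a b where "q = a + b" "rmem a x r" "rmem b y r" by blast
    then show "\<exists>a. dns r (\<lambda>r. \<exists>b. q = a + b \<and> rmem a x r \<and> rmem b y r)"
      by (intro exI[of _ a] dns_now exI[of _ b]) (blast intro: regD[OF reg_mem])
  qed simp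
qed

lemma rmem_rscale_pos: "0 < c \<Longrightarrow> rmem q (rscale c x) p \<longleftrightarrow> rmem (q / c) x p"
  unfolding rscale_def by simp

lemma rmem_rscale_neg: "c < 0 \<Longrightarrow> rmem q (rscale c x) p \<longleftrightarrow> dns p (\<lambda>r. \<exists>t>q. upper x (t / c) r)"
  unfolding rscale_def by simp

lemma rmem_rabs: "rmem q (rabs x) p \<longleftrightarrow> dns p (\<lambda>r. rmem q x r \<or> rmem q (rscale (-1) x) r)"
  unfolding rabs_def by simp

lemma radd_lower: "rmem a x p \<Longrightarrow> rmem b y p \<Longrightarrow> rmem (a + b) (radd x y) p"
  unfolding rmem_radd by (rule dns_now) (blast intro: regD[OF reg_mem])

lemma radd_upper:
  assumes "is_real x p" "is_real y p" "upper x a p" "upper y b p"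
  shows "upper (radd x y) (a + b) p"
  unfolding fnot_iff rmem_radd
proof (intro allI impI notI)
  fix q assume q: "q \<le> p" "dns q (\<lambda>r. \<exists>a' b'. a + b = a' + b' \<and> rmem a' x r \<and> rmem b' y r)"
  then obtain r a' b' where r: "r \<le> q" "a + b = a' + b'" "rmem a' x r" "rmem b' y r"
    by (auto elim: dns_obtain)
  have "r \<le> p" using r q order_trans by blast
  then have "a' < a" "b' < b" using assms r real_less by (meson fnot_le regD reg_is_real)+
  then show False using r by linarith
qed

lemma is_real_radd:
  assumes "is_real x p" "is_real y p" shows "is_real (radd x y) p"
  unfolding is_real_iff
proof (intro conjI allI impI)
  have d: "dns p (\<lambda>r. \<exists>a. rmem a x r \<and> upper x (a + 1) r)" "dns p (\<lambda>r. \<exists>a. rmem a y r \<and> upper y (a + 1) r)"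
    using assms by (auto intro: real_approx)
  show "dns p (\<lambda>r. \<exists>a. rmem a (radd x y) r)"
    by (rule dns_bind[OF d(1)], rule dns_mono[OF d(2)]) (auto, meson radd_lower regD reg_mem)
  show "dns p (\<lambda>r. \<exists>a. upper (radd x y) a r)"
    by (rule dns_bind[OF d(1)], rule dns_mono[OF d(2)])
      (auto, meson radd_upper assms fnot_le order_trans regD reg_is_real)
next
  fix a b q assume q: "q \<le> p" "rmem a (radd x y) q" "b < a"
  show "rmem b (radd x y) q"
    using q(2) unfolding rmem_radd
  proof (rule dns_mono)
    fix r assume r: "r \<le> q" "\<exists>a' b'. a = a' + b' \<and> rmem a' x r \<and> rmem b' y r"
    then obtain a' b' where *: "a = a' + b'" "rmem a' x r" "rmem b' y r" by blast
    have "r \<le> p" using r q order_trans by blast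
    then have "rmem (a' - (a - b)) x r"
      using real_down[OF regD[OF reg_is_real assms(1)] *(2), of "a' - (a - b)"] q(3) by simp
    then show "\<exists>a' b'. b = a' + b' \<and> rmem a' x r \<and> rmem b' y r"
      using * by (intro exI[of _ "a' - (a - b)"] exI[of _ b']) auto
  qed simp
next
  fix a q assume q: "q \<le> p" "rmem a (radd x y) q"
  show "dns q (\<lambda>r. \<exists>b>a. rmem b (radd x y) r)"
    using q(2) unfolding rmem_radd[of a]
  proof (rule dns_bind)
    fix r assume r: "r \<le> q" "\<exists>a' b'. a = a' + b' \<and> rmem a' x r \<and> rmem b' y r"
    then obtain a' b' where *: "a = a' + b'" "rmem a' x r" "rmem b' y r" by blast
    have "r \<le> p" using r q order_trans by blast
    then have "dns r (\<lambda>r. \<exists>b>a'. rmem b x r)" using assms(1) * by (auto simp: is_real_iff)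
    then show "dns r (\<lambda>r. \<exists>b>a. rmem b (radd x y) r)"
    proof (rule dns_mono)
      fix s assume s: "s \<le> r" "\<exists>b>a'. rmem b x s"
      then obtain b where "b > a'" "rmem b x s" by blast
      then show "\<exists>b>a. rmem b (radd x y) s"
        using * radd_lower[OF _ regD[OF reg_mem *(3) s(1)], of b x] by (intro exI[of _ "b + b'"]) simp
    qed simp
  qed
qed

text \<open>Reflection turns upper bounds into lower ones; the strict \<open>a < c * b\<close> keeps
  the reflected cut open.\<close>

lemma rscale_lower_neg: "c < 0 \<Longrightarrow> upper x b p \<Longrightarrow> a < c * b \<Longrightarrow> rmem a (rscale c x) p"
  unfolding rmem_rscale_neg by (rule dns_now) (auto intro!: exI[of _ "c * b"] intro: fnot_le)

lemma rscale_upper_neg: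
  assumes "is_real x p" "c < 0" "rmem a x p" shows "upper (rscale c x) (c * a) p"
  unfolding fnot_iff[of "rmem (c * a) (rscale c x)"] rmem_rscale_neg[OF assms(2)]
proof (intro allI impI notI)
  fix q assume q: "q \<le> p" "dns q (\<lambda>r. \<exists>t>c * a. upper x (t / c) r)"
  then obtain r t where r: "r \<le> q" "t > c * a" "upper x (t / c) r" by (auto elim: dns_obtain)
  have "r \<le> p" using q r order_trans by blast
  then have "a < t / c" using assms r real_less by (meson regD reg_is_real reg_mem)
  then show False using r(2) assms(2) by (simp add: field_simps)
qed

lemma rscale_lower_pos: "0 < c \<Longrightarrow> rmem a x p \<Longrightarrow> rmem (c * a) (rscale c x) p"
  by (simp add: rmem_rscale_pos)

lemma rscale_upper_pos: "0 < c \<Longrightarrow> upper x a p \<Longrightarrow> upper (rscale c x) (c * a) p"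
  by (simp add: fnot_iff rmem_rscale_pos)

lemma is_real_rscale:
  assumes "is_real x p" shows "is_real (rscale c x) p"
proof -
  consider "c = 0" | "c > 0" | "c < 0" by linarith
  then show ?thesis
  proof cases
    case 1
    then show ?thesis by (simp add: rscale_def)
  next
    case 2
    show ?thesis unfolding is_real_iff
    proof (intro conjI allI impI)
      have d: "dns p (\<lambda>r. \<exists>a. rmem a x r)" "dns p (\<lambda>r. \<exists>a. upper x a r)"
        using assms by (auto simp: is_real_iff)
      show "dns p (\<lambda>r. \<exists>a. rmem a (rscale c x) r)"
        by (rule dns_mono[OF d(1)]) (use 2 in \<open>auto intro: rscale_lower_pos\<close>)
      show "dns p (\<lambda>r. \<exists>a. upper (rscale c x) a r)"
        by (rule dns_mono[OF d(2)]) (use 2 in \<open>auto intro: rscale_upper_pos\<close>)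
    next
      fix a b q assume "q \<le> p" "rmem a (rscale c x) q" "b < a"
      then show "rmem b (rscale c x) q" using 2 regD[OF reg_is_real assms]
        by (auto simp: rmem_rscale_pos elim!: real_down[rotated] intro: divide_right_mono)
    next
      fix a q assume q: "q \<le> p" "rmem a (rscale c x) q"
      then have "dns q (\<lambda>r. \<exists>b>a / c. rmem b x r)" using assms 2 by (auto simp: is_real_iff rmem_rscale_pos)
      then show "dns q (\<lambda>r. \<exists>b>a. rmem b (rscale c x) r)"
      proof (rule dns_mono)
        fix r assume "\<exists>b>a / c. rmem b x r"
        then obtain b where "b > a / c" "rmem b x r" by blast
        then show "\<exists>b>a. rmem b (rscale c x) r"
          using 2 by (intro exI[of _ "c * b"]) (auto simp: rmem_rscale_pos field_simps)
      qed simp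
    qed
  next
    case 3
    show ?thesis unfolding is_real_iff
    proof (intro conjI allI impI)
      have d: "dns p (\<lambda>r. \<exists>a. rmem a x r)" "dns p (\<lambda>r. \<exists>a. upper x a r)"
        using assms by (auto simp: is_real_iff)
      show "dns p (\<lambda>r. \<exists>a. rmem a (rscale c x) r)"
      proof (rule dns_mono[OF d(2)])
        fix r assume "\<exists>a. upper x a r"
        then obtain a where "upper x a r" by blast
        then show "\<exists>a. rmem a (rscale c x) r"
          using rscale_lower_neg[OF 3, of a x r "c * a - 1"] by auto
      qed simp
      show "dns p (\<lambda>r. \<exists>a. upper (rscale c x) a r)"
        by (rule dns_mono[OF d(1)]) (use 3 rscale_upper_neg regD[OF reg_is_real assms] in blast)+
    next
      fix a b q assume "q \<le> p" "rmem a (rscale c x) q" "b < a"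
      then show "rmem b (rscale c x) q" using 3
        by (auto simp: rmem_rscale_neg elim!: dns_mono) (meson less_trans)
    next
      fix a q assume q: "q \<le> p" "rmem a (rscale c x) q"
      then have "dns q (\<lambda>r. \<exists>t>a. upper x (t / c) r)" using 3 by (simp add: rmem_rscale_neg)
      then show "dns q (\<lambda>r. \<exists>b>a. rmem b (rscale c x) r)"
      proof (rule dns_mono)
        fix r assume "\<exists>t>a. upper x (t / c) r"
        then obtain t where t: "t > a" "upper x (t / c) r" by blast
        then obtain b where "a < b" "b < t" using dense by blast
        then show "\<exists>b>a. rmem b (rscale c x) r"
          using t 3 by (intro exI[of _ b]) (auto intro: rscale_lower_neg)
      qed simp
    qed
  qed
qed

lemma is_real_rdiff: "is_real x p \<Longrightarrow> is_real y p \<Longrightarrow> is_real (rdiff x y) p"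
  by (simp add: rdiff_def is_real_radd is_real_rscale)

lemma is_real_rsum: "(\<And>i. i < n \<Longrightarrow> is_real (s i) p) \<Longrightarrow> is_real (rsum s n) p"
  by (induction n) (auto intro: is_real_radd)

subsection \<open>Congruence\<close>

lemma req_iff: "req x y p \<longleftrightarrow> (\<forall>a. \<forall>q\<le>p. rmem a x q \<longleftrightarrow> rmem a y q)"
  by (rule set_eq_iff')

lemma req_refl [simp]: "req x x p"
  and req_sym: "req x y p \<Longrightarrow> req y x p"
  and req_trans: "req x y p \<Longrightarrow> req y z p \<Longrightarrow> req x z p"
  by (simp_all add: req_iff)

lemma req_le: "req x y p \<Longrightarrow> q \<le> p \<Longrightarrow> req x y q"
  by (rule regD[OF reg_set_eq])

lemma dns_cong: "(\<And>r. r \<le> p \<Longrightarrow> Q r = R r) \<Longrightarrow> dns p Q = dns p R"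
  by (auto elim!: dns_mono)

lemma upper_cong: "req x y p \<Longrightarrow> upper x b p = upper y b p"
  by (auto simp: fnot_iff req_iff)

lemma is_real_cong: "req x y p \<Longrightarrow> is_real x p \<Longrightarrow> is_real y p"
proof -
  assume e: "req x y p"
  have 1: "\<And>a q. q \<le> p \<Longrightarrow> rmem a x q = rmem a y q" using e by (auto simp: req_iff)
  have 2: "\<And>a q. q \<le> p \<Longrightarrow> upper x a q = upper y a q" using upper_cong req_le e by blast
  have 3: "\<And>a q. q \<le> p \<Longrightarrow> dns q (\<lambda>r. \<exists>b>a. rmem b x r) = dns q (\<lambda>r. \<exists>b>a. rmem b y r)"
    by (rule dns_cong) (use 1 order_trans in blast)
  have 4: "dns p (\<lambda>r. \<exists>a. rmem a x r) = dns p (\<lambda>r. \<exists>a. rmem a y r)"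
    by (rule dns_cong) (use 1 in blast)
  have 5: "dns p (\<lambda>r. \<exists>a. upper x a r) = dns p (\<lambda>r. \<exists>a. upper y a r)"
    by (rule dns_cong) (use 2 in blast)
  assume "is_real x p"
  then show "is_real y p" unfolding is_real_iff using 1 3 4 5 by simp
qed

lemma radd_cong: "req x x' p \<Longrightarrow> req y y' p \<Longrightarrow> req (radd x y) (radd x' y') p"
  unfolding req_iff rmem_radd
  by (intro allI impI dns_cong) (metis order_trans)

lemma rscale_cong: "req x x' p \<Longrightarrow> req (rscale c x) (rscale c x') p"
proof -
  assume e: "req x x' p"
  consider "c = 0" | "c > 0" | "c < 0" by linarith
  then show ?thesis
  proof cases
    case 1
    then show ?thesis by (simp add: rscale_def)
  next
    case 2
    then show ?thesis using e by (simp add: req_iff rmem_rscale_pos)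
  next
    case 3
    have "rmem a (rscale c x) q = rmem a (rscale c x') q" if "q \<le> p" for a q
      unfolding rmem_rscale_neg[OF 3]
      by (rule dns_cong) (use that upper_cong[OF req_le[OF e]] order_trans in blast)
    then show ?thesis by (simp add: req_iff)
  qed
qed

lemma rdiff_cong: "req x x' p \<Longrightarrow> req y y' p \<Longrightarrow> req (rdiff x y) (rdiff x' y') p"
  by (simp add: rdiff_def radd_cong rscale_cong)

lemma rabs_cong: "req x x' p \<Longrightarrow> req (rabs x) (rabs x') p"
proof -
  assume e: "req x x' p"
  then have "req (rscale (-1) x) (rscale (-1) x') p" by (rule rscale_cong)
  with e show ?thesis unfolding req_iff rmem_rabs
    by (intro allI impI dns_cong) (metis order_trans)
qed

lemma rlt_iff: "rlt x y p \<longleftrightarrow> dns p (\<lambda>r. \<exists>q. rmem q y r \<and> upper x q r)"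
  by (simp add: rlt_def)

lemma rle_iff: "rle x y p \<longleftrightarrow> (\<forall>a. \<forall>q\<le>p. rmem a x q \<longrightarrow> rmem a y q)"
  by (simp add: rle_def fimp_iff)

lemma rlt_cong:
  assumes "req x x' p" "rlt x y p" shows "rlt x' y p"
  using assms(2) unfolding rlt_iff
  by (rule dns_mono) (use upper_cong[OF req_le[OF assms(1)]] in auto)

lemma rle_rlt: "rle x (rof a) p \<Longrightarrow> a < b \<Longrightarrow> rlt x (rof b) p"
  unfolding rlt_iff rle_iff by (rule dns_now) (auto simp: fnot_iff intro: exI[of _ a] order_trans)

abbreviation rclose :: "'p::preorder rname \<Rightarrow> 'p rname \<Rightarrow> rat \<Rightarrow> 'p fm" where
  "rclose x y \<epsilon> \<equiv> rlt (rabs (rdiff x y)) (rof \<epsilon>)"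

lemma rclose_cong:
  "req x x' p \<Longrightarrow> req y y' p \<Longrightarrow> rclose x y \<epsilon> p \<Longrightarrow> rclose x' y' \<epsilon> p"
  by (erule rlt_cong[rotated]) (intro rabs_cong rdiff_cong)

subsection \<open>Rational values\<close>

abbreviation isq :: "'p::preorder \<Rightarrow> 'p rname \<Rightarrow> rat \<Rightarrow> bool" where
  "isq p x c \<equiv> req x (rof c) p"

lemma isq_radd: assumes "isq p x a" "isq p y b" shows "isq p (radd x y) (a + b)"
proof -
  have "rmem q (radd (rof a) (rof b)) r \<longleftrightarrow> q < a + b" for q and r :: 'a
  proof
    assume "rmem q (radd (rof a) (rof b)) r"
    then show "q < a + b" by (auto simp: rmem_radd elim!: dns_obtain)
  next
    assume "q < a + b"
    then have "q = (a - (a + b - q) / 2) + (b - (a + b - q) / 2) \<and>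
        a - (a + b - q) / 2 < a \<and> b - (a + b - q) / 2 < b"
      by (auto simp: field_simps)
    then show "rmem q (radd (rof a) (rof b)) r"
      unfolding rmem_radd rmem_rof by (intro dns_now) blast
  qed
  then have "isq p (radd (rof a) (rof b)) (a + b)" by (simp add: req_iff)
  then show ?thesis using radd_cong[OF assms] req_trans by blast
qed

lemma isq_rscale: assumes "isq p x a" shows "isq p (rscale c x) (c * a)"
proof -
  consider "c = 0" | "c > 0" | "c < 0" by linarith
  then have "isq p (rscale c (rof a)) (c * a)"
  proof cases
    case 1
    then show ?thesis by (simp add: rscale_def)
  next
    case 2
    then show ?thesis by (simp add: req_iff rmem_rscale_pos field_simps)
  next
    case 3
    have "(\<exists>t>q. a \<le> t / c) \<longleftrightarrow> q < c * a" for q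
    proof
      assume "\<exists>t>q. a \<le> t / c" then show "q < c * a" using 3 by (auto simp: field_simps)
    next
      assume "q < c * a" then show "\<exists>t>q. a \<le> t / c" using 3 by (intro exI[of _ "c * a"]) auto
    qed
    then show ?thesis using 3 by (simp add: req_iff rmem_rscale_neg)
  qed
  then show ?thesis using rscale_cong[OF assms] req_trans by blast
qed

lemma isq_rdiff: "isq p x a \<Longrightarrow> isq p y b \<Longrightarrow> isq p (rdiff x y) (a - b)"
  using isq_radd[OF _ isq_rscale[of y b p "-1"], of x a] by (simp add: rdiff_def)

lemma isq_rabs: assumes "isq p x a" shows "isq p (rabs x) \<bar>a\<bar>"
proof -
  have "isq p (rscale (-1) x) (- a)" using isq_rscale[OF assms, of "-1"] by simp
  then have "rmem q (rabs x) r \<longleftrightarrow> dns r (\<lambda>r. q < a \<or> q < - a)" if "r \<le> p" for q r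
    using assms that unfolding rmem_rabs req_iff rmem_rof
    by (intro dns_cong) (metis order_trans)
  then show ?thesis by (auto simp: req_iff abs_if)
qed

lemma isq_rsum: "(\<And>i. i < n \<Longrightarrow> isq p (s i) (c i)) \<Longrightarrow> isq p (rsum s n) (\<Sum>i<n. c i)"
proof (induction n)
  case (Suc n)
  then show ?case by (auto intro: isq_radd)
qed simp

lemma isq_is_real: "isq p x c \<Longrightarrow> is_real x p"
  using is_real_cong[OF req_sym] by fastforce

lemma isq_rle: "isq p x a \<Longrightarrow> a \<le> b \<Longrightarrow> rle x (rof b) p"
  by (auto simp: req_iff rle_iff)

lemma isq_rlt: "isq p x a \<Longrightarrow> a < b \<Longrightarrow> rlt x (rof b) p"
  by (rule rle_rlt[OF isq_rle]) auto

lemma isq_rclose: "isq p x a \<Longrightarrow> isq p y b \<Longrightarrow> \<bar>a - b\<bar> < \<epsilon> \<Longrightarrow> rclose x y \<epsilon> p"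
  by (intro isq_rlt[OF isq_rabs[OF isq_rdiff]])

subsection \<open>Rational approximation\<close>

text \<open>
  The extra precision required of the bounds \<open>a\<close> and \<open>b\<close> absorbs the strictness of the lower cuts,
  so that errors simply add up under the operations.
\<close>

definition near :: "'p::preorder \<Rightarrow> 'p rname \<Rightarrow> rat \<Rightarrow> rat \<Rightarrow> bool" where
  "near p x c \<epsilon> \<longleftrightarrow> is_real x p \<and> (\<exists>a b. c - \<epsilon> < a \<and> b < c + \<epsilon> \<and> rmem a x p \<and> upper x b p)"

lemma near_le: "near p x c \<epsilon> \<Longrightarrow> q \<le> p \<Longrightarrow> near q x c \<epsilon>"
  unfolding near_def by (meson regD reg_is_real reg_mem fnot_le)

lemma near_weaken:
  assumes "near p x c \<epsilon>" "\<bar>c - c'\<bar> + \<epsilon> \<le> \<epsilon>'" shows "near p x c' \<epsilon>'"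
proof -
  obtain a b where ab: "is_real x p" "c - \<epsilon> < a" "b < c + \<epsilon>" "rmem a x p" "upper x b p"
    using assms(1) unfolding near_def by blast
  have "c' - \<epsilon>' < a \<and> b < c' + \<epsilon>'" using ab(2,3) assms(2) by linarith
  then show ?thesis unfolding near_def using ab by blast
qed

lemma near_cong: "req x y p \<Longrightarrow> near p x c \<epsilon> \<Longrightarrow> near p y c \<epsilon>"
  unfolding near_def using is_real_cong upper_cong set_eq_memD by metis

lemma isq_near: assumes "isq p x c" "0 < \<epsilon>" shows "near p x c \<epsilon>"
proof -
  have "near p (rof c) c \<epsilon>" unfolding near_def using assms(2)
    by (intro conjI exI[of _ "c - \<epsilon> / 2"] exI[of _ c]) auto
  then show ?thesis by (rule near_cong[OF req_sym[OF assms(1)]])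
qed

lemma real_near:
  assumes "is_real x p" "0 < \<epsilon>" shows "dns p (\<lambda>r. \<exists>c. near r x c \<epsilon>)"
proof -
  have "dns p (\<lambda>r. \<exists>a. rmem a x r \<and> upper x (a + \<epsilon> / 2) r)"
    using assms by (intro real_approx) auto
  then show ?thesis
  proof (rule dns_mono)
    fix r assume r: "r \<le> p" "\<exists>a. rmem a x r \<and> upper x (a + \<epsilon> / 2) r"
    then obtain a where "rmem a x r" "upper x (a + \<epsilon> / 2) r" by blast
    then show "\<exists>c. near r x c \<epsilon>" unfolding near_def using assms(2) regD[OF reg_is_real assms(1) r(1)]
      by (intro exI[of _ a] conjI exI[of _ "a + \<epsilon> / 2"]) auto
  qed simp
qed

lemma near_radd: "near p x a \<delta> \<Longrightarrow> near p y b \<epsilon> \<Longrightarrow> near p (radd x y) (a + b) (\<delta> + \<epsilon>)"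
  unfolding near_def
proof (elim conjE exE, intro conjI is_real_radd, assumption+)
  fix a' b' a'' b''
  assume *: "is_real x p" "is_real y p" "a - \<delta> < a'" "b' < a + \<delta>" "rmem a' x p" "upper x b' p"
    "b - \<epsilon> < a''" "b'' < b + \<epsilon>" "rmem a'' y p" "upper y b'' p"
  show "\<exists>aa ba. a + b - (\<delta> + \<epsilon>) < aa \<and> ba < a + b + (\<delta> + \<epsilon>) \<and> rmem aa (radd x y) p \<and> upper (radd x y) ba p"
    by (rule exI[of _ "a' + a''"], rule exI[of _ "b' + b''"])
      (use * in \<open>auto intro: radd_lower radd_upper\<close>)
qed

lemma near_rscale_pos:
  assumes "near p x a \<epsilon>" "0 < c" shows "near p (rscale c x) (c * a) (c * \<epsilon>)"
proof -
  obtain a' b' where *: "is_real x p" "a - \<epsilon> < a'" "b' < a + \<epsilon>" "rmem a' x p" "upper x b' p"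
    using assms(1) unfolding near_def by blast
  have "c * a - c * \<epsilon> < c * a' \<and> c * b' < c * a + c * \<epsilon>"
    using * assms(2) by (metis mult_less_cancel_left_pos right_diff_distrib distrib_left)
  moreover have "rmem (c * a') (rscale c x) p" "upper (rscale c x) (c * b') p"
    using * assms(2) rscale_lower_pos rscale_upper_pos by blast+
  ultimately show ?thesis unfolding near_def using is_real_rscale[OF *(1)] by blast
qed

lemma near_rneg:
  assumes "near p x a \<epsilon>" shows "near p (rscale (-1) x) (- a) \<epsilon>"
proof -
  obtain a' b' where *: "is_real x p" "a - \<epsilon> < a'" "b' < a + \<epsilon>" "rmem a' x p" "upper x b' p"
    using assms unfolding near_def by blast
  then have "- a - \<epsilon> < - b'" by simp
  then obtain t where t: "- a - \<epsilon> < t" "t < - b'" using dense by blast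
  have "rmem t (rscale (-1) x) p" "upper (rscale (-1) x) (- a') p"
    using * t rscale_lower_neg[of "-1" b' x p t] rscale_upper_neg[of x p "-1" a'] by auto
  then show ?thesis unfolding near_def using is_real_rscale[OF *(1)] * t
    by (intro conjI exI[of _ t] exI[of _ "- a'"]) auto
qed

lemma near_rdiff: "near p x a \<delta> \<Longrightarrow> near p y b \<epsilon> \<Longrightarrow> near p (rdiff x y) (a - b) (\<delta> + \<epsilon>)"
  using near_radd[OF _ near_rneg] unfolding rdiff_def by fastforce

lemma near_rsum:
  assumes "\<And>i. i < n \<Longrightarrow> near p (s i) (c i) \<epsilon>" "0 < \<eta>"
  shows "near p (rsum s n) (\<Sum>i<n. c i) (of_nat n * \<epsilon> + \<eta>)"
  using assms(1)
proof (induction n)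
  case 0
  then show ?case using assms(2) by (simp add: isq_near)
next
  case (Suc n)
  then have "near p (radd (rsum s n) (s n)) ((\<Sum>i<n. c i) + c n) ((of_nat n * \<epsilon> + \<eta>) + \<epsilon>)"
    by (intro near_radd) auto
  then show ?case by (simp add: algebra_simps)
qed

lemma near_rclose:
  assumes x: "near p x c \<delta>" and y: "near p y c' \<delta>'" and "\<bar>c - c'\<bar> + \<delta> + \<delta>' \<le> \<epsilon>"
  shows "rclose x y \<epsilon> p"
proof -
  have d: "near p (rdiff x y) (c - c') (\<delta> + \<delta>')" using x y by (rule near_rdiff)
  have n: "near p (rscale (-1) (rdiff x y)) (- (c - c')) (\<delta> + \<delta>')" using d by (rule near_rneg)
  obtain b where b: "is_real (rdiff x y) p" "b < (c - c') + (\<delta> + \<delta>')" "upper (rdiff x y) b p"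
    using d unfolding near_def by blast
  obtain b' where b': "is_real (rscale (-1) (rdiff x y)) p" "b' < - (c - c') + (\<delta> + \<delta>')"
      "upper (rscale (-1) (rdiff x y)) b' p"
    using n unfolding near_def by blast
  \<comment> \<open>\<open>b\<close> bounds x - y and \<open>b'\<close> bounds y - x, so the maximum
    bounds the absolute value.\<close>
  let ?m = "max b b'"
  have m: "?m < \<epsilon>" using b(2) b'(2) assms(3) by (auto simp: abs_if split: if_splits)
  have "upper (rdiff x y) ?m p" "upper (rscale (-1) (rdiff x y)) ?m p"
    using b b' by (auto intro: real_up)
  then have "upper (rabs (rdiff x y)) ?m p"
    unfolding fnot_iff rmem_rabs by (auto elim!: dns_obtain dest: order_trans)
  then show ?thesis unfolding rlt_iff using m by (intro dns_now exI[of _ ?m]) (auto intro: fnot_le)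
qed

text \<open>The strict inequality in \<open>rlt\<close> supplies, at a stronger condition, a
  rational \<open>q < \<epsilon>\<close> bounding the distance; the gap between \<open>q\<close> and
  \<open>\<epsilon>\<close> pays for rational approximations of both reals.\<close>

lemma rclose_near:
  assumes "is_real x p" "is_real y p" "rclose x y \<epsilon> p" "0 < \<eta>"
  shows "dns p (\<lambda>r. \<exists>c c'. near r x c \<eta> \<and> near r y c' \<eta> \<and> \<bar>c - c'\<bar> < \<epsilon>)"
  using assms(3) unfolding rlt_iff
proof (rule dns_bind)
  fix r assume r: "r \<le> p" "\<exists>q. rmem q (rof \<epsilon>) r \<and> upper (rabs (rdiff x y)) q r"
  then obtain q where q: "q < \<epsilon>" "upper (rabs (rdiff x y)) q r" by auto
  \<comment> \<open>A third of the gap, so that two errors of this size still stay below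
    \<open>\<epsilon>\<close>.\<close>
  define \<delta> where "\<delta> = min \<eta> ((\<epsilon> - q) / 3)"
  have \<delta>: "0 < \<delta>" "\<delta> \<le> \<eta>" "q + 2 * \<delta> < \<epsilon>" using q assms(4) by (auto simp: \<delta>_def min_def field_simps)
  have rx: "is_real x r" "is_real y r" using assms r(1) by (meson regD reg_is_real)+
  have dx: "dns r (\<lambda>s. \<exists>c. near s x c \<delta>)" and dy: "dns r (\<lambda>s. \<exists>c. near s y c \<delta>)"
    using real_near rx \<delta>(1) by blast+
  show "dns r (\<lambda>r. \<exists>c c'. near r x c \<eta> \<and> near r y c' \<eta> \<and> \<bar>c - c'\<bar> < \<epsilon>)"
    using dx
  proof (rule dns_bind)
    fix s assume s: "s \<le> r" "\<exists>c. near s x c \<delta>"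
    then obtain c where c: "near s x c \<delta>" by blast
    show "dns s (\<lambda>r. \<exists>c c'. near r x c \<eta> \<and> near r y c' \<eta> \<and> \<bar>c - c'\<bar> < \<epsilon>)"
      using dns_le[OF dy s(1)]
    proof (rule dns_mono)
      fix t assume t: "t \<le> s" "\<exists>c. near t y c \<delta>"
      then obtain c' where c': "near t y c' \<delta>" by blast
      have c: "near t x c \<delta>" using c t near_le by blast
      have "t \<le> r" using s t order_trans by blast
      then have qt: "upper (rabs (rdiff x y)) q t" using q fnot_le by blast
      have le: "z \<le> q + 2 * \<delta>" if nr: "near t w z (\<delta> + \<delta>)" and imp: "\<And>u. u \<le> t \<Longrightarrow> rmem q w u \<Longrightarrow> rmem q (rabs (rdiff x y)) u" for w z
      proof -
        obtain a where a: "is_real w t" "z - (\<delta> + \<delta>) < a" "rmem a w t"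
          using nr unfolding near_def by blast
        have "upper w q t" using imp qt by (meson fnot_iff)
        then have "a < q" using a real_less by blast
        then show ?thesis using a by linarith
      qed
      have 1: "near t (rdiff x y) (c - c') (\<delta> + \<delta>)" using c c' by (rule near_rdiff)
      have "c - c' \<le> q + 2 * \<delta>"
        by (rule le[OF 1]) (auto simp: rmem_rabs intro: dns_now regD[OF reg_mem])
      moreover have "- (c - c') \<le> q + 2 * \<delta>"
        by (rule le[OF near_rneg[OF 1]]) (auto simp: rmem_rabs intro: dns_now regD[OF reg_mem])
      ultimately have "\<bar>c - c'\<bar> < \<epsilon>" using \<delta>(3) by linarith
      moreover have "near t x c \<eta>" "near t y c' \<eta>" using c c' \<delta>(2) by (auto intro: near_weaken)
      ultimately show "\<exists>c c'. near t x c \<eta> \<and> near t y c' \<eta> \<and> \<bar>c - c'\<bar> < \<epsilon>" by blast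
    qed simp
  qed
qed

lemma near_unique: "near p x c \<delta> \<Longrightarrow> near p x c' \<delta>' \<Longrightarrow> \<bar>c - c'\<bar> < \<delta> + \<delta>'"
proof -
  assume "near p x c \<delta>" "near p x c' \<delta>'"
  then obtain a b a' b' where *: "is_real x p" "c - \<delta> < a" "b < c + \<delta>" "rmem a x p" "upper x b p"
     "c' - \<delta>' < a'" "b' < c' + \<delta>'" "rmem a' x p" "upper x b' p" unfolding near_def by blast
  then have "a < b'" "a' < b" using real_less by blast+
  then show ?thesis using * by linarith
qed

section \<open>Functions, points and Borel sets of the extension\<close>

lemma reg_is_fun [simp]: "eqv E \<Longrightarrow> (\<And>x. reg (D x)) \<Longrightarrow> reg (is_fun E D f)"
  by (simp add: is_fun_def)

lemma is_fun_iff: "is_fun E D f p \<longleftrightarrow>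
   (\<forall>x y. \<forall>q\<le>p. mem (prod_eq E req) (x, y) f q \<longrightarrow> D x q \<and> is_real y q) \<and>
   (\<forall>x. \<forall>q\<le>p. D x q \<longrightarrow> dns q (\<lambda>r. \<exists>y. mem (prod_eq E req) (x, y) f r)) \<and>
   (\<forall>x y z. \<forall>q\<le>p. mem (prod_eq E req) (x, y) f q \<longrightarrow> mem (prod_eq E req) (x, z) f q \<longrightarrow> req y z q)"
  unfolding is_fun_def by (simp add: fimp_iff) blast

lemma rmem_app: "rmem a (app E f x) q \<longleftrightarrow>
   dns q (\<lambda>r. \<exists>y. mem (prod_eq E req) (x, y) f r \<and> rmem a y r)"
  unfolding app_def by simp

lemma app_req:
  assumes "is_fun E D f p" "mem (prod_eq E req) (x, y) f p" shows "req (app E f x) y p"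
  unfolding req_iff
proof (intro allI impI iffI)
  fix a q assume q: "q \<le> p" "rmem a (app E f x) q"
  show "rmem a y q"
  proof (rule reg_bind[OF reg_mem q(2)[unfolded rmem_app]])
    fix r assume r: "r \<le> q" "\<exists>z. mem (prod_eq E req) (x, z) f r \<and> rmem a z r"
    then obtain z where z: "mem (prod_eq E req) (x, z) f r" "rmem a z r" by blast
    have "r \<le> p" using r q order_trans by blast
    moreover have "\<forall>x y z. \<forall>q\<le>p. mem (prod_eq E req) (x, y) f q \<longrightarrow> mem (prod_eq E req) (x, z) f q \<longrightarrow> req y z q"
      using assms(1) unfolding is_fun_iff by (elim conjE)
    ultimately have "req z y r" using z(1) regD[OF reg_mem assms(2)] by blast
    then show "rmem a y r" using z(2) by (rule set_eq_memD)
  qed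
next
  fix a q assume q: "q \<le> p" "rmem a y q"
  then show "rmem a (app E f x) q" unfolding rmem_app
    by (intro dns_now exI[of _ y]) (meson assms(2) order_trans regD reg_mem)
qed

lemma app_real:
  assumes "is_fun E D f p" "D x p" shows "is_real (app E f x) p"
proof -
  have "\<forall>x. \<forall>q\<le>p. D x q \<longrightarrow> dns q (\<lambda>r. \<exists>y. mem (prod_eq E req) (x, y) f r)"
    using assms(1) unfolding is_fun_iff by (elim conjE)
  then have "dns p (\<lambda>r. \<exists>y. mem (prod_eq E req) (x, y) f r)" using assms(2) by blast
  then show ?thesis
  proof (rule reg_bind[OF reg_is_real])
    fix r assume r: "r \<le> p" "\<exists>y. mem (prod_eq E req) (x, y) f r"
    then obtain y where y: "mem (prod_eq E req) (x, y) f r" by blast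
    have f: "is_fun E D f r"
      using assms(1) unfolding is_fun_iff by (auto dest: order_trans[OF _ r(1)])
    have "\<forall>x y. \<forall>q\<le>r. mem (prod_eq E req) (x, y) f q \<longrightarrow> D x q \<and> is_real y q"
      using f unfolding is_fun_iff by (elim conjE)
    then have "is_real y r" using y by blast
    then show "is_real (app E f x) r" using is_real_cong[OF req_sym[OF app_req[OF f y]]] by blast
  qed
qed

lemma app_cong:
  assumes "eqv E" "E x x' p" shows "req (app E f x) (app E f x') p"
proof -
  have "rmem a (app E f z) q \<Longrightarrow> rmem a (app E f z') q" if "q \<le> p" "E z z' p" for a q z z'
    unfolding rmem_app
  proof (erule dns_mono)
    fix r assume r: "r \<le> q" "\<exists>y. mem (prod_eq E req) (z, y) f r \<and> rmem a y r"
    then obtain y where y: "mem (prod_eq E req) (z, y) f r" "rmem a y r" by blast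
    have "E z z' r" using that r(1) regD[OF eqv_reg[OF assms(1)]] order_trans by blast
    then have "prod_eq E req (z, y) (z', y) r" by (simp add: prod_eq_def)
    then have "mem (prod_eq E req) (z', y) f r"
      by (rule mem_cong[OF eqv_prod_eq[OF assms(1) eqv_set_eq] _ y(1)])
    then show "\<exists>y. mem (prod_eq E req) (z', y) f r \<and> rmem a y r" using y by blast
  qed simp
  from this[of _ x x'] this[of _ x' x] show ?thesis
    unfolding req_iff using assms(2) eqv_sym[OF assms] by blast
qed

text \<open>The graph lists every name that is forced equal to \<open>g x\<close>, not only
  \<open>g x\<close> itself, so it is closed under equality of values and \<open>mem_fname\<close>
  holds exactly.\<close>

definition fname :: "('x \<Rightarrow> 'p::preorder fm) \<Rightarrow> ('x \<Rightarrow> 'p rname) \<Rightarrow> ('x \<times> 'p rname, 'p) name" where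
  "fname D g = compr (\<lambda>z. fand (D (fst z)) (req (snd z) (g (fst z))))"

lemma mem_fname:
  assumes "eqv E" "\<And>x. reg (D x)" "\<And>x y p. E x y p \<Longrightarrow> D y p \<Longrightarrow> D x p"
    "\<And>x y p. E x y p \<Longrightarrow> req (g x) (g y) p"
  shows "mem (prod_eq E req) (x, y) (fname D g) = fand (D x) (req y (g x))"
  unfolding fname_def
proof (subst mem_compr)
  fix a b p assume *: "prod_eq E req a b p" "fand (D (fst b)) (req (snd b) (g (fst b))) p"
  then have "E (fst a) (fst b) p" "req (snd a) (snd b) p" by (auto simp: prod_eq_def)
  then show "fand (D (fst a)) (req (snd a) (g (fst a))) p"
    using *(2) assms(3) req_trans[OF req_trans, OF _ _ req_sym[OF assms(4)]] unfolding fand_iff by blast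
qed (use assms in auto)

lemma is_fun_fname:
  assumes E: "eqv E" "\<And>x. reg (D x)" "\<And>x y p. E x y p \<Longrightarrow> D y p \<Longrightarrow> D x p"
    "\<And>x y p. E x y p \<Longrightarrow> req (g x) (g y) p"
    and real: "\<And>x q. q \<le> p \<Longrightarrow> D x q \<Longrightarrow> is_real (g x) q"
  shows "is_fun E D (fname D g) p"
proof -
  have m: "mem (prod_eq E req) (x, y) (fname D g) = fand (D x) (req y (g x))" for x y
    by (rule mem_fname) (fact E)+
  show ?thesis unfolding is_fun_iff m fand_iff
  proof (intro conjI allI impI)
    fix x y q assume "q \<le> p" "D x q \<and> req y (g x) q"
    then show "D x q" "is_real y q" using real is_real_cong[OF req_sym] by blast+
  next
    fix x q assume "q \<le> p" "D x q"
    then show "dns q (\<lambda>r. \<exists>y. D x r \<and> req y (g x) r)"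
      by (intro dns_now exI[of _ "g x"]) (auto intro: regD[OF E(2)])
  qed (auto intro: req_trans req_sym)
qed

lemma app_fname:
  assumes E: "eqv E" "\<And>x. reg (D x)" "\<And>x y p. E x y p \<Longrightarrow> D y p \<Longrightarrow> D x p"
    "\<And>x y p. E x y p \<Longrightarrow> req (g x) (g y) p"
    and D: "D x p"
  shows "req (app E (fname D g) x) (g x) p"
proof -
  have m: "mem (prod_eq E req) (x, y) (fname D g) = fand (D x) (req y (g x))" for x y
    by (rule mem_fname) (fact E)+
  show ?thesis unfolding req_iff[of "app E (fname D g) x"] rmem_app m fand_iff
  proof (intro allI impI iffI)
    fix a q assume "q \<le> p" "dns q (\<lambda>r. \<exists>y. (D x r \<and> req y (g x) r) \<and> rmem a y r)"
    then show "rmem a (g x) q" by (elim reg_bind[OF reg_mem]) (blast dest: set_eq_memD)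
  next
    fix a q assume q: "q \<le> p" "rmem a (g x) q"
    then have "D x q" using D regD E(2) by blast
    then show "dns q (\<lambda>r. \<exists>y. (D x r \<and> req y (g x) r) \<and> rmem a y r)"
      using q by (intro dns_now exI[of _ "g x"]) (auto intro: regD[OF E(2)] regD[OF reg_mem])
  qed
qed

lemma reg_converges [simp]: "reg (converges s l)"
  by (simp add: converges_def)

lemma convergesI:
  assumes "\<And>\<epsilon>. 0 < \<epsilon> \<Longrightarrow> dns p (\<lambda>r. \<exists>N. \<forall>n\<ge>N. rclose (s n) l \<epsilon> r)"
  shows "converges s l p"
  unfolding converges_def fall_iff fimp_iff fex_iff ground_iff
proof (intro allI impI)
  fix \<epsilon> :: rat and q assume "q \<le> p" "0 < \<epsilon>"
  then show "dns q (\<lambda>r. \<exists>N. \<forall>n. \<forall>q\<le>r. N \<le> n \<longrightarrow> rclose (s n) l \<epsilon> q)"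
    by (intro dns_mono[OF assms]) (auto intro: regD[OF reg_rlt])
qed

lemma convergesD:
  assumes "converges s l p" "0 < \<epsilon>"
  shows "dns p (\<lambda>r. \<exists>N. \<forall>n\<ge>N. rclose (s n) l \<epsilon> r)"
proof -
  have "dns p (\<lambda>r. \<exists>N. \<forall>n. \<forall>q\<le>r. N \<le> n \<longrightarrow> rclose (s n) l \<epsilon> q)"
    using assms unfolding converges_def fall_iff fimp_iff fex_iff ground_iff by blast
  then show ?thesis by (rule dns_mono) auto
qed

lemma converges_cong:
  assumes "\<And>n. req (s n) (s' n) p" "req l l' p" "converges s l p" shows "converges s' l' p"
proof (rule convergesI)
  fix \<epsilon> :: rat assume "0 < \<epsilon>"
  with assms(3) have "dns p (\<lambda>r. \<exists>N. \<forall>n\<ge>N. rclose (s n) l \<epsilon> r)" by (rule convergesD)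
  then show "dns p (\<lambda>r. \<exists>N. \<forall>n\<ge>N. rclose (s' n) l' \<epsilon> r)"
    by (rule dns_mono) (auto intro: rclose_cong[OF req_le[OF assms(1)] req_le[OF assms(2)]])
qed

subsection \<open>Points\<close>

lemma reg_stone [simp]: "reg (stone u)"
  by (simp add: stone_def)

lemma stone_iff: "stone u p \<longleftrightarrow> mem geq top u p \<and> fnot (mem geq bot u) p \<and>
    (\<forall>a b. \<forall>q\<le>p. mem geq a u q \<longrightarrow> a \<le> b \<longrightarrow> mem geq b u q) \<and>
    (\<forall>a b. \<forall>q\<le>p. mem geq a u q \<longrightarrow> mem geq b u q \<longrightarrow> mem geq (inf a b) u q) \<and>
    (\<forall>a. dns p (\<lambda>r. mem geq a u r \<or> mem geq (- a) u r))"
  unfolding stone_def by (simp add: fimp_iff) blast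

lemma stone_up: "stone u p \<Longrightarrow> mem geq a u p \<Longrightarrow> a \<le> b \<Longrightarrow> mem geq b u p"
  and stone_inf: "stone u p \<Longrightarrow> mem geq a u p \<Longrightarrow> mem geq b u p \<Longrightarrow> mem geq (inf a b) u p"
  and stone_top: "stone u p \<Longrightarrow> mem geq top u p"
  and stone_bot: "stone u p \<Longrightarrow> \<not> mem geq bot u p"
  and stone_decide: "stone u p \<Longrightarrow> dns p (\<lambda>r. mem geq a u r \<or> mem geq (- a) u r)"
proof -
  assume "stone u p"
  note * = this[unfolded stone_iff]
  show "mem geq top u p" using * by (elim conjE)
  show "dns p (\<lambda>r. mem geq a u r \<or> mem geq (- a) u r)" using * by (elim conjE allE)
  have "fnot (mem geq bot u) p" using * by (elim conjE)
  then show "\<not> mem geq bot u p" by (auto dest: fnotD)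
  have "\<forall>a b. \<forall>q\<le>p. mem geq a u q \<longrightarrow> a \<le> b \<longrightarrow> mem geq b u q" using * by (elim conjE)
  then show "mem geq a u p \<Longrightarrow> a \<le> b \<Longrightarrow> mem geq b u p" by blast
  have "\<forall>a b. \<forall>q\<le>p. mem geq a u q \<longrightarrow> mem geq b u q \<longrightarrow> mem geq (inf a b) u q" using * by (elim conjE)
  then show "mem geq a u p \<Longrightarrow> mem geq b u p \<Longrightarrow> mem geq (inf a b) u p" by blast
qed

lemma stone_disj: "stone u p \<Longrightarrow> mem geq a u p \<Longrightarrow> inf a b = bot \<Longrightarrow> \<not> mem geq b u p"
  using stone_inf stone_bot by metis

lemma stone_not_mem: "stone u p \<Longrightarrow> mem geq a u p \<Longrightarrow> inf a b = bot \<Longrightarrow> fnot (mem geq b u) p"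
  unfolding fnot_iff
  by (intro allI impI) (erule stone_disj[OF regD[OF reg_stone] regD[OF reg_mem], rotated 4], assumption+)

lemma stone_compl:
  assumes "stone u p" shows "fnot (mem geq a u) p \<longleftrightarrow> mem geq (- a) u p"
proof
  assume n: "fnot (mem geq a u) p"
  show "mem geq (- a) u p"
    by (rule reg_bind[OF reg_mem stone_decide[OF assms, of a]]) (use n in \<open>auto simp: fnot_iff\<close>)
next
  assume "mem geq (- a) u p"
  then show "fnot (mem geq a u) p" using assms by (auto intro: stone_not_mem)
qed

lemma stone_cong:
  assumes "set_eq geq u v p" "stone v p" shows "stone u p"
proof -
  have 1: "mem geq a u q = mem geq a v q" if "q \<le> p" for a q
    by (rule set_eqD[OF assms(1) that])
  have 2: "dns p (\<lambda>r. mem geq a u r \<or> mem geq (- a) u r) = dns p (\<lambda>r. mem geq a v r \<or> mem geq (- a) v r)" for a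
    by (rule dns_cong) (simp add: 1)
  have 3: "fnot (mem geq bot u) p = fnot (mem geq bot v) p" by (auto simp: fnot_iff 1)
  show ?thesis using assms(2) unfolding stone_iff 2 3 by (simp add: 1)
qed

lemma pmem_cong: "set_eq geq u v p \<Longrightarrow> pmem v B p \<Longrightarrow> pmem u B p"
  by (rule mem_cong[OF eqv_set_eq eqv_sym[OF eqv_set_eq]])

lemma pmem_compr:
  assumes "\<And>u. reg (\<Phi> u)" "\<And>u v p. set_eq geq u v p \<Longrightarrow> \<Phi> v p \<Longrightarrow> \<Phi> u p"
  shows "pmem u (compr \<Phi>) = \<Phi> u"
  by (rule mem_compr) (use assms in auto)

lemma pmem_stone_space [simp]: "pmem u stone_space = stone u"
  unfolding stone_space_def by (rule pmem_compr) (auto intro: stone_cong)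

lemma pmem_clopen [simp]: "pmem u (clopen a) = fand (stone u) (mem geq a u)"
  unfolding clopen_def by (rule pmem_compr) (auto intro: stone_cong simp: set_eqD)

lemma pmem_pcompl [simp]: "pmem u (pcompl B) = fand (stone u) (fnot (pmem u B))"
  unfolding pcompl_def
proof (rule pmem_compr)
  fix u v p assume *: "set_eq geq u v p" "fand (stone v) (fnot (pmem v B)) p"
  have "set_eq geq v u q" if "q \<le> p" for q
    using eqv_sym[OF eqv_set_eq regD[OF reg_set_eq *(1) that]] .
  then have "fnot (pmem u B) p" using *(2) pmem_cong unfolding fand_iff fnot_iff by blast
  then show "fand (stone u) (fnot (pmem u B)) p" using * stone_cong by auto
qed simp

lemma pmem_pnth: "pmem u (pnth S n) = mem (prod_eq geq (set_eq geq)) (n, u) S"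
  unfolding pnth_def
proof (rule pmem_compr)
  fix u v p assume u: "set_eq geq u v p" and v: "mem (prod_eq geq (set_eq geq)) (n, v) S p"
  have "prod_eq geq (set_eq geq) (n, v) (n, u) p"
    using eqv_sym[OF eqv_set_eq u] by (simp add: prod_eq_def geq_refl)
  then show "mem (prod_eq geq (set_eq geq)) (n, u) S p"
    by (rule mem_cong[OF eqv_prod_eq[OF eqv_geq eqv_set_eq] _ v])
qed simp

lemma pmem_pUnion: "pmem u (pUnion S) p \<longleftrightarrow> dns p (\<lambda>r. \<exists>n. pmem u (pnth S n) r)"
proof -
  have "pmem u (pUnion S) = fex (\<lambda>n. pmem u (pnth S n))" unfolding pUnion_def
    by (rule pmem_compr) (auto elim!: dns_mono dest: regD[OF reg_set_eq] intro: pmem_cong)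
  then show ?thesis by simp
qed

definition pseq :: "(nat \<Rightarrow> ('a, 'p) point \<Rightarrow> 'p::preorder fm) \<Rightarrow> ('a, 'p) pseq" where
  "pseq \<Phi> = compr (\<lambda>z. \<Phi> (fst z) (snd z))"

lemma pmem_pnth_pseq:
  assumes "\<And>n u. reg (\<Phi> n u)" "\<And>n u v p. set_eq geq u v p \<Longrightarrow> \<Phi> n v p \<Longrightarrow> \<Phi> n u p"
  shows "pmem u (pnth (pseq \<Phi>) n) = \<Phi> n u"
  unfolding pmem_pnth pseq_def
  by (subst mem_compr) (use assms in \<open>auto simp: prod_eq_def geq_iff\<close>)

lemma pset_eqI: "(\<And>u q. q \<le> p \<Longrightarrow> pmem u B q \<longleftrightarrow> pmem u C q) \<Longrightarrow> pset_eq B C p"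
  by (simp add: set_eq_iff')

subsection \<open>Borel sets\<close>

lemma reg_psub [simp]: "reg (psub B C)" and reg_pdisj [simp]: "reg (pdisj B C)"
  by (simp_all add: psub_def pdisj_def)

lemma reg_is_open [simp]: "reg (is_open B)"
  by (simp add: is_open_def)

lemma reg_is_closed [simp]: "reg (is_closed B)"
  by (simp add: is_closed_def)

lemma reg_is_sigma_algebra [simp]: "reg (is_sigma_algebra S)"
  by (simp add: is_sigma_algebra_def)

lemma reg_is_borel [simp]: "reg (is_borel B)"
  by (simp add: is_borel_def)

lemma psub_iff: "psub B C p \<longleftrightarrow> (\<forall>u. \<forall>q\<le>p. pmem u B q \<longrightarrow> pmem u C q)"
  by (simp add: psub_def fimp_iff)

lemma pdisj_iff: "pdisj B C p \<longleftrightarrow> (\<forall>u. \<forall>q\<le>p. \<not> (pmem u B q \<and> pmem u C q))"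
  by (simp add: pdisj_def fnot_iff)

lemma is_open_iff: "is_open B p \<longleftrightarrow> psub B stone_space p \<and>
   (\<forall>u. \<forall>q\<le>p. pmem u B q \<longrightarrow> dns q (\<lambda>r. \<exists>a. mem geq a u r \<and> psub (clopen a) B r))"
  by (simp add: is_open_def fimp_iff)

lemma is_borel_cong: "pset_eq B C p \<Longrightarrow> is_borel B p \<Longrightarrow> is_borel C p"
  unfolding is_borel_def fall_iff fimp_iff
  by (meson eqv_set_eq mem_cong regD reg_set_eq)

lemma is_open_borel: "is_open B p \<Longrightarrow> is_borel B p"
  unfolding is_borel_def fall_iff fimp_iff fand_iff
  by (meson order_refl regD reg_is_open)

lemma is_open_clopen: "is_open (clopen a) p"
  unfolding is_open_iff psub_iff by (auto intro!: dns_now exI[of _ a] intro: regD[OF reg_mem])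

lemma is_borel_clopen: "is_borel (clopen a) p"
  by (intro is_open_borel is_open_clopen)

lemma is_borel_iff: "is_borel B p \<longleftrightarrow>
   (\<forall>\<S>. \<forall>q\<le>p. is_sigma_algebra \<S> q \<longrightarrow> (\<^bold>\<forall>C. is_open C \<^bold>\<longrightarrow> mem pset_eq C \<S>) q \<longrightarrow> mem pset_eq B \<S> q)"
  unfolding is_borel_def fall_iff fimp_iff fand_iff by blast

lemma is_borel_pUnion:
  fixes S :: "('a::boolean_algebra, 'p::preorder) pseq"
  assumes "\<And>n. is_borel (pnth S n) p" shows "is_borel (pUnion S) p"
  unfolding is_borel_iff
proof (intro allI impI)
  fix \<S> :: "(('a, 'p) pset, 'p) name" and q
  assume *: "q \<le> p" "is_sigma_algebra \<S> q" "(\<^bold>\<forall>C. is_open C \<^bold>\<longrightarrow> mem pset_eq C \<S>) q"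
  then have "\<forall>n. mem pset_eq (pnth S n) \<S> q" using assms unfolding is_borel_iff by blast
  moreover have "\<forall>S. \<forall>r\<le>q. (\<forall>n. mem pset_eq (pnth S n) \<S> r) \<longrightarrow> mem pset_eq (pUnion S) \<S> r"
    using *(2) unfolding is_sigma_algebra_def fall_iff fimp_iff fand_iff by (elim conjE)
  ultimately show "mem pset_eq (pUnion S) \<S> q" by blast
qed

section \<open>Decided truth values\<close>

text \<open>Meaningful only where \<open>\<phi>\<close> is decided: the value is 0 also at
  conditions that leave \<open>\<phi>\<close> open. Hence the companion predicate
  \<open>dec\<close>.\<close>

definition tv :: "'p::preorder fm \<Rightarrow> 'p \<Rightarrow> rat" where
  "tv \<phi> p = (if \<phi> p then 1 else 0)"

definition dec :: "'p::preorder fm \<Rightarrow> 'p \<Rightarrow> bool" where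
  "dec \<phi> p \<longleftrightarrow> \<phi> p \<or> fnot \<phi> p"

lemma dec_le: "reg \<phi> \<Longrightarrow> dec \<phi> p \<Longrightarrow> q \<le> p \<Longrightarrow> dec \<phi> q"
  unfolding dec_def using regD fnot_le by blast

lemma tv_le: "reg \<phi> \<Longrightarrow> dec \<phi> p \<Longrightarrow> q \<le> p \<Longrightarrow> tv \<phi> q = tv \<phi> p"
  unfolding dec_def tv_def by (auto simp: fnot_iff dest: regD)

lemma dns_dec: "dns p (dec \<phi>)"
  unfolding dec_def[abs_def] by (rule decide)

lemma dns_dec_finite:
  assumes "finite F" "\<And>i. i \<in> F \<Longrightarrow> reg (\<phi> i)"
  shows "dns p (\<lambda>r. \<forall>i\<in>F. dec (\<phi> i) r)"
  using assms by (intro dns_ball_finite) (auto intro: dns_dec dec_le)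

text \<open>The lower cut of 0, enlarged to that of 1 if \<open>\<phi>\<close> holds. This names a
  value of a Dirac measure without deciding \<open>\<phi>\<close>.\<close>

definition ind :: "'p::preorder fm \<Rightarrow> 'p rname" where
  "ind \<phi> = compr (\<lambda>a. f_or (ground (a < 0)) (fand \<phi> (ground (a < 1))))"

lemma isq_ind:
  assumes "reg \<phi>" "dec \<phi> p" shows "isq p (ind \<phi>) (tv \<phi> p)"
proof -
  have "rmem a (ind \<phi>) q \<longleftrightarrow> dns q (\<lambda>r. a < tv \<phi> p)" if q: "q \<le> p" for a q
  proof -
    have "rmem a (ind \<phi>) q \<longleftrightarrow> dns q (\<lambda>r. a < 0 \<or> \<phi> r \<and> a < 1)"
      unfolding ind_def by simp
    also have "\<dots> \<longleftrightarrow> dns q (\<lambda>r. a < tv \<phi> p)"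
    proof (rule dns_cong)
      fix r assume "r \<le> q"
      then have "r \<le> p" using q order_trans by blast
      then have "\<phi> r \<longleftrightarrow> \<phi> p" using assms unfolding dec_def fnot_iff using regD[OF assms(1)] order_refl by blast
      then show "(a < 0 \<or> \<phi> r \<and> a < 1) = (a < tv \<phi> p)" by (auto simp: tv_def)
    qed
    finally show ?thesis .
  qed
  then show ?thesis by (simp add: req_iff)
qed

text \<open>With \<open>\<phi> i\<close> and \<open>\<psi> i\<close> saying that \<open>v i\<close>
  and \<open>v' i\<close> belong to a set, this is the value there of \<open>k\<close> times a sum
  of differences of Dirac measures. The name makes sense at every condition; \<open>k * dval\<close>
  is its rational value where all memberships are decided.\<close>

definition dsum :: "rat \<Rightarrow> nat \<Rightarrow> (nat \<Rightarrow> 'p::preorder fm) \<Rightarrow> (nat \<Rightarrow> 'p fm) \<Rightarrow> 'p rname" where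
  "dsum k N \<phi> \<psi> = rsum (\<lambda>i. rscale k (rdiff (ind (\<phi> i)) (ind (\<psi> i)))) N"

definition dval :: "nat \<Rightarrow> (nat \<Rightarrow> 'p::preorder fm) \<Rightarrow> (nat \<Rightarrow> 'p fm) \<Rightarrow> 'p \<Rightarrow> rat" where
  "dval N \<phi> \<psi> p = (\<Sum>i<N. tv (\<phi> i) p - tv (\<psi> i) p)"

definition decs :: "nat \<Rightarrow> (nat \<Rightarrow> 'p::preorder fm) \<Rightarrow> (nat \<Rightarrow> 'p fm) \<Rightarrow> 'p \<Rightarrow> bool" where
  "decs N \<phi> \<psi> p \<longleftrightarrow> (\<forall>i<N. dec (\<phi> i) p \<and> dec (\<psi> i) p)"

lemma isq_dsum:
  assumes "\<And>i. reg (\<phi> i)" "\<And>i. reg (\<psi> i)" "decs N \<phi> \<psi> p"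
  shows "isq p (dsum k N \<phi> \<psi>) (k * dval N \<phi> \<psi> p)"
  unfolding dsum_def dval_def sum_distrib_left
  by (intro isq_rsum isq_rscale isq_rdiff isq_ind) (use assms in \<open>auto simp: decs_def\<close>)

lemma decs_le:
  "(\<And>i. reg (\<phi> i)) \<Longrightarrow> (\<And>i. reg (\<psi> i)) \<Longrightarrow> decs N \<phi> \<psi> p \<Longrightarrow> q \<le> p \<Longrightarrow> decs N \<phi> \<psi> q"
  unfolding decs_def using dec_le by blast

lemma dval_le:
  "(\<And>i. reg (\<phi> i)) \<Longrightarrow> (\<And>i. reg (\<psi> i)) \<Longrightarrow> decs N \<phi> \<psi> p \<Longrightarrow> q \<le> p \<Longrightarrow> dval N \<phi> \<psi> q = dval N \<phi> \<psi> p"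
  unfolding dval_def decs_def by (intro sum.cong arg_cong2[where f = "(-)"] tv_le) auto

lemma dns_decs:
  assumes "\<And>i. reg (\<phi> i)" "\<And>i. reg (\<psi> i)" shows "dns p (decs N \<phi> \<psi>)"
proof -
  have "dns p (\<lambda>r. \<forall>i\<in>{..<N}. dec (\<phi> i) r \<and> dec (\<psi> i) r)"
  proof (rule dns_ball_finite)
    fix i show "dns p (\<lambda>r. dec (\<phi> i) r \<and> dec (\<psi> i) r)"
      by (rule dns_bind[OF dns_dec[of p "\<phi> i"]], rule dns_mono[OF dns_dec[of p "\<psi> i"]])
        (use assms dec_le[OF assms(1)] in auto)
  qed (use dec_le[OF assms(1)] dec_le[OF assms(2)] in auto)
  then show ?thesis by (rule dns_mono) (auto simp: decs_def)
qed

lemma is_real_dsum: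
  assumes "\<And>i. reg (\<phi> i)" "\<And>i. reg (\<psi> i)" shows "is_real (dsum k N \<phi> \<psi>) p"
  by (rule reg_bind[OF reg_is_real dns_decs[of \<phi> \<psi> p N]]) (use assms in \<open>auto intro: isq_is_real isq_dsum\<close>)

lemma dsum_cong:
  assumes "\<And>i. reg (\<phi> i)" "\<And>i. reg (\<psi> i)" "\<And>i. reg (\<phi>' i)" "\<And>i. reg (\<psi>' i)"
    "\<And>i q. i < N \<Longrightarrow> q \<le> p \<Longrightarrow> \<phi> i q = \<phi>' i q" "\<And>i q. i < N \<Longrightarrow> q \<le> p \<Longrightarrow> \<psi> i q = \<psi>' i q"
  shows "req (dsum k N \<phi> \<psi>) (dsum k N \<phi>' \<psi>') p"
proof (rule reg_bind[OF reg_set_eq dns_decs[of \<phi> \<psi> p N]])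
  fix r assume r: "r \<le> p" "decs N \<phi> \<psi> r"
  have "dval N \<phi> \<psi> r = dval N \<phi>' \<psi>' r" unfolding dval_def tv_def
    by (intro sum.cong) (use r assms(5,6) in auto)
  moreover have "decs N \<phi>' \<psi>' r" using r(2) unfolding decs_def dec_def fnot_iff
    using assms(5,6) r(1) order_trans by (metis order_refl)
  ultimately show "req (dsum k N \<phi> \<psi>) (dsum k N \<phi>' \<psi>') r"
    using isq_dsum[of \<phi> \<psi> N r k] isq_dsum[of \<phi>' \<psi>' N r k] assms r by (metis req_sym req_trans)
qed (use assms in auto)

section \<open>Ultrafilters in generic extensions\<close>

text \<open>
  A prime ideal theorem for names: \<open>null p a\<close> means that \<open>p\<close> forces \<open>a\<close> into an ideal, and
  \<open>H p a\<close> that \<open>p\<close> forces \<open>a\<close> into an ultrafilter disjoint from it. Maximality yields density: if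
  no extension of \<open>p\<close> can put \<open>a\<close> into the ultrafilter, then some \<open>s\<close> below \<open>p\<close> makes \<open>inf b a\<close>
  null for an element \<open>b\<close> of the filter at \<open>s\<close>, and then \<open>- a\<close> can be added at \<open>s\<close>. For the poset
  of finite binary strings this builds the ultrafilter that a Cohen real determines, for the
  given forcing notion it proves that the Stone space is compact in V[G].
\<close>

lemma generic_ultrafilter:
  fixes le :: "'c \<Rightarrow> 'c \<Rightarrow> bool" and null :: "'c \<Rightarrow> 'a::boolean_algebra \<Rightarrow> bool"
  assumes le_refl: "\<And>p. le p p" and le_trans: "\<And>p q r. le p q \<Longrightarrow> le q r \<Longrightarrow> le p r"
    and null_le: "\<And>p q a. null p a \<Longrightarrow> le q p \<Longrightarrow> null q a"
    and null_down: "\<And>p a b. null p a \<Longrightarrow> b \<le> a \<Longrightarrow> null p b"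
    and null_sup: "\<And>p a b. null p a \<Longrightarrow> null p b \<Longrightarrow> null p (sup a b)"
    and null_bot: "\<And>p. null p bot" and null_top: "\<And>p. \<not> null p top"
  obtains H where "\<And>p q a. H p a \<Longrightarrow> le q p \<Longrightarrow> H q a" "\<And>p. H p top" "\<And>p. \<not> H p bot"
    "\<And>p a b. H p a \<Longrightarrow> a \<le> b \<Longrightarrow> H p b" "\<And>p a b. H p a \<Longrightarrow> H p b \<Longrightarrow> H p (inf a b)"
    "\<And>p a. H p a \<Longrightarrow> \<not> null p a" "\<And>p a. \<exists>q. le q p \<and> (H q a \<or> H q (- a))"
proof -
  \<comment> \<open>Density is not part of \<open>good\<close>; it is derived from
    maximality.\<close>
  define good where "good H \<longleftrightarrow> (\<forall>p q a. (p, a) \<in> H \<longrightarrow> le q p \<longrightarrow> (q, a) \<in> H) \<and> (\<forall>p. (p, top) \<in> H) \<and>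
     (\<forall>p a b. (p, a) \<in> H \<longrightarrow> a \<le> b \<longrightarrow> (p, b) \<in> H) \<and>
     (\<forall>p a b. (p, a) \<in> H \<longrightarrow> (p, b) \<in> H \<longrightarrow> (p, inf a b) \<in> H) \<and>
     (\<forall>p a. (p, a) \<in> H \<longrightarrow> \<not> null p a)" for H :: "('c \<times> 'a) set"
  have goodD: "\<forall>p q a. (p, a) \<in> H \<longrightarrow> le q p \<longrightarrow> (q, a) \<in> H" "\<forall>p. (p, top) \<in> H"
     "\<forall>p a b. (p, a) \<in> H \<longrightarrow> a \<le> b \<longrightarrow> (p, b) \<in> H"
     "\<forall>p a b. (p, a) \<in> H \<longrightarrow> (p, b) \<in> H \<longrightarrow> (p, inf a b) \<in> H"
     "\<forall>p a. (p, a) \<in> H \<longrightarrow> \<not> null p a" if "good H" for H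
    using that[unfolded good_def] by - (elim conjE, assumption)+
  have "\<exists>M\<in>{H. good H}. \<forall>X\<in>{H. good H}. M \<subseteq> X \<longrightarrow> X = M"
  proof (rule subset_Zorn_nonempty)
    have "good {(p, a). a = top}" unfolding good_def using null_top by (simp add: top_unique)
    then show "{H. good H} \<noteq> {}" by blast
  next
    fix C assume C: "C \<noteq> {}" "subset.chain {H. good H} C"
    then have g: "\<And>H. H \<in> C \<Longrightarrow> good H" by (auto simp: subset.chain_def)
    have ch: "H \<subseteq> H' \<or> H' \<subseteq> H" if "H \<in> C" "H' \<in> C" for H H'
      using C(2) that by (auto simp: subset.chain_def)
    have "good (\<Union>C)" unfolding good_def
    proof (intro conjI allI impI)
      fix p q a assume "(p, a) \<in> \<Union>C" "le q p"
      then show "(q, a) \<in> \<Union>C" using goodD(1)[OF g] by blast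
    next
      fix p show "(p, top) \<in> \<Union>C" using C(1) goodD(2)[OF g] by blast
    next
      fix p a b assume "(p, a) \<in> \<Union>C" "a \<le> b"
      then show "(p, b) \<in> \<Union>C" using goodD(3)[OF g] by blast
    next
      fix p a b assume "(p, a) \<in> \<Union>C" "(p, b) \<in> \<Union>C"
      then obtain H H' where h: "H \<in> C" "H' \<in> C" "(p, a) \<in> H" "(p, b) \<in> H'" by blast
      then obtain H'' where "H'' \<in> C" "(p, a) \<in> H''" "(p, b) \<in> H''" using ch[OF h(1,2)] by blast
      then show "(p, inf a b) \<in> \<Union>C" using goodD(4)[OF g] by blast
    next
      fix p a assume "(p, a) \<in> \<Union>C"
      then show "\<not> null p a" using goodD(5)[OF g] by blast
    qed
    then show "\<Union>C \<in> {H. good H}" by blast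
  qed
  then obtain M where gM: "good M" and max: "\<And>X. good X \<Longrightarrow> M \<subseteq> X \<Longrightarrow> X = M" by blast
  have M: "\<And>p q a. (p, a) \<in> M \<Longrightarrow> le q p \<Longrightarrow> (q, a) \<in> M" "\<And>p. (p, top) \<in> M"
     "\<And>p a b. (p, a) \<in> M \<Longrightarrow> a \<le> b \<Longrightarrow> (p, b) \<in> M"
     "\<And>p a b. (p, a) \<in> M \<Longrightarrow> (p, b) \<in> M \<Longrightarrow> (p, inf a b) \<in> M"
     "\<And>p a. (p, a) \<in> M \<Longrightarrow> \<not> null p a"
    using goodD(1)[OF gM] goodD(2)[OF gM] goodD(3)[OF gM] goodD(4)[OF gM] goodD(5)[OF gM] by - blast+
  have add: "(t, a) \<in> M" if *: "\<And>s b. le s t \<Longrightarrow> (s, b) \<in> M \<Longrightarrow> \<not> null s (inf b a)" for t a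
  proof -
    \<comment> \<open>Adjoin \<open>a\<close> at all conditions below \<open>t\<close>, together
      with the filter generated there. The assumption on \<open>t\<close> says exactly that no null
      element arises, and maximality of \<open>M\<close> then forces \<open>X = M\<close>.\<close>
    define X where "X = M \<union> {(s, c). le s t \<and> (\<exists>b. (s, b) \<in> M \<and> inf b a \<le> c)}"
    have XM: "(s, c) \<in> X \<longleftrightarrow> (\<exists>b. (s, b) \<in> M \<and> inf b a \<le> c)" if "le s t" for s c
      using that M(3) unfolding X_def by (auto intro: le_infI1)
    have XN: "(s, c) \<in> X \<longleftrightarrow> (s, c) \<in> M" if "\<not> le s t" for s c
      using that unfolding X_def by auto
    have "good X" unfolding good_def
    proof (intro conjI allI impI)
      fix p q c assume h: "(p, c) \<in> X" "le q p"
      show "(q, c) \<in> X"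
      proof (cases "le p t")
        case True
        then have "le q t" using h le_trans by blast
        then show ?thesis using h True XM M(1) by blast
      next
        case False
        then show ?thesis using h XN M(1) X_def by blast
      qed
    next
      fix p show "(p, top) \<in> X" using M(2) X_def by blast
    next
      fix p c d assume "(p, c) \<in> X" "c \<le> d"
      then show "(p, d) \<in> X" using XM[of p] XN[of p] M(3)[of p] order_trans[of _ c d] by (cases "le p t") blast+
    next
      fix p c d assume h: "(p, c) \<in> X" "(p, d) \<in> X"
      show "(p, inf c d) \<in> X"
      proof (cases "le p t")
        case True
        then obtain b b' where b: "(p, b) \<in> M" "inf b a \<le> c" "(p, b') \<in> M" "inf b' a \<le> d"
          using h XM by blast
        have "inf (inf b b') a \<le> inf c d" using b(2,4) order_trans[OF inf_mono[OF inf_le1 order_refl] b(2)] order_trans[OF inf_mono[OF inf_le2 order_refl] b(4)]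
          by (intro inf_greatest)
        then show ?thesis using XM[OF True] M(4)[OF b(1,3)] by blast
      qed (use h XN M(4) in blast)
    next
      fix p c assume h: "(p, c) \<in> X"
      show "\<not> null p c"
      proof (cases "le p t")
        case True
        then show ?thesis using h XM * null_down by blast
      qed (use h XN M(5) in blast)
    qed
    then have "X = M" using max X_def by blast
    moreover have "(t, a) \<in> X" using XM[OF le_refl] M(2) by (metis inf_top_left order_refl)
    ultimately show ?thesis by simp
  qed
  have dec: "\<exists>q. le q p \<and> ((q, a) \<in> M \<or> (q, - a) \<in> M)" for p a
  proof (cases "\<forall>s b. le s p \<longrightarrow> (s, b) \<in> M \<longrightarrow> \<not> null s (inf b a)")
    case True
    then show ?thesis using add le_refl by blast
  next
    case False
    then obtain s b where s: "le s p" "(s, b) \<in> M" "null s (inf b a)" by blast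
    have "(s, - a) \<in> M"
    proof (rule add)
      fix t b' assume t: "le t s" "(t, b') \<in> M"
      \<comment> \<open>Splitting along \<open>a\<close>: the first part is null by the choice of
        \<open>b\<close>, so if the second were null too, the filter element \<open>inf b b'\<close>
        would be null.\<close>
      have "inf b b' \<le> sup (inf b a) (inf b' (- a))"
      proof -
        have "inf b b' = sup (inf (inf b b') a) (inf (inf b b') (- a))"
          by (simp flip: inf_sup_distrib1)
        also have "\<dots> \<le> sup (inf b a) (inf b' (- a))"
          by (intro sup_mono inf_mono inf_le1 inf_le2 order_refl)
        finally show ?thesis .
      qed
      moreover have "(t, inf b b') \<in> M" using M t s by blast
      ultimately have "\<not> null t (sup (inf b a) (inf b' (- a)))" using M(5) null_down by blast
      then show "\<not> null t (inf b' (- a))" using null_sup null_le s(3) t(1) by blast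
    qed
    then show ?thesis using s(1) by blast
  qed
  show ?thesis
  proof (rule that[of "\<lambda>p a. (p, a) \<in> M"])
    show "(p, bot) \<notin> M" for p using M(5) null_bot by blast
  qed (fact M dec)+
qed

text \<open>The trivial forcing \<open>unit\<close> turns the version for names into the ordinary
  prime ideal theorem. The ideal consists of the elements disjoint from \<open>a\<close>; it
  contains \<open>- a\<close>, so the ultrafilter contains \<open>a\<close>.\<close>

lemma ultrafilter_exists:
  fixes a :: "'a::boolean_algebra"
  assumes "a \<noteq> bot"
  obtains X where "a \<in> X" "top \<in> X" "bot \<notin> X" "\<And>b c. b \<in> X \<Longrightarrow> b \<le> c \<Longrightarrow> c \<in> X"
    "\<And>b c. b \<in> X \<Longrightarrow> c \<in> X \<Longrightarrow> inf b c \<in> X" "\<And>b. b \<in> X \<or> - b \<in> X"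
proof -
  have "\<exists>H. H top \<and> \<not> H bot \<and> (\<forall>b c. H b \<longrightarrow> b \<le> c \<longrightarrow> H c) \<and> (\<forall>b c. H b \<longrightarrow> H c \<longrightarrow> H (inf b c)) \<and>
      (\<forall>b. H b \<longrightarrow> inf b a \<noteq> bot) \<and> (\<forall>b. H b \<or> H (- b))"
  proof (rule generic_ultrafilter[of "\<lambda>_ _ :: unit. True" "\<lambda>_ b. inf b a = bot"])
    show "\<not> inf top a = bot" using assms by simp
    show "inf c a = bot" if "inf b a = bot" "c \<le> b" for b c
      using that by (metis bot_unique inf_mono order_refl)
    show "inf (sup b c) a = bot" if "inf b a = bot" "inf c a = bot" for b c
      using that by (simp add: inf_sup_distrib2)
    fix H :: "unit \<Rightarrow> 'a \<Rightarrow> bool"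
    assume *: "\<And>p. H p top" "\<And>p. \<not> H p bot" "\<And>p a b. H p a \<Longrightarrow> a \<le> b \<Longrightarrow> H p b"
      "\<And>p a b. H p a \<Longrightarrow> H p b \<Longrightarrow> H p (inf a b)" "\<And>p b. H p b \<Longrightarrow> inf b a \<noteq> bot"
      "\<And>p a. \<exists>q. True \<and> (H q a \<or> H q (- a))"
    have d: "H () b \<or> H () (- b)" for b using *(6)[of b] by simp
    show ?thesis
    proof (intro exI[of _ "H ()"] conjI allI impI)
      show "H () c" if "H () b" "b \<le> c" for b c using that by (rule *(3))
      show "H () (inf b c)" if "H () b" "H () c" for b c using that by (rule *(4))
    qed (fact * d | erule *(5))+
  qed simp_all
  then obtain H where *: "H top" "\<not> H bot" "\<forall>b c. H b \<longrightarrow> b \<le> c \<longrightarrow> H c"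
    "\<forall>b c. H b \<longrightarrow> H c \<longrightarrow> H (inf b c)" "\<forall>b. H b \<longrightarrow> inf b a \<noteq> bot" "\<forall>b. H b \<or> H (- b)"
    by (elim exE conjE) (rule that)
  note H = *(1,2) *(3-6)[rule_format]
  have "H a" using H(6)[of a] H(5)[of "- a"] by auto
  then show ?thesis by (intro that[of "{b. H b}"]) (use H in auto)
qed

primrec supn :: "(nat \<Rightarrow> 'a::boolean_algebra) \<Rightarrow> nat \<Rightarrow> 'a" where
  "supn A 0 = bot"
| "supn A (Suc n) = sup (supn A n) (A n)"

lemma supn_cong: "(\<And>i. i < n \<Longrightarrow> A i = B i) \<Longrightarrow> supn A n = supn B n"
  by (induction n) auto

lemma supn_append: "supn (\<lambda>j. if j < m then A j else B (j - m)) (m + n) = sup (supn A m) (supn B n)"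
proof (induction n)
  case 0
  have "supn (\<lambda>j. if j < m then A j else B (j - m)) m = supn A m" by (rule supn_cong) simp
  then show ?case by simp
qed (simp add: sup_assoc)

lemma supn_upper: "i < n \<Longrightarrow> A i \<le> supn A n"
  by (induction n) (auto simp: less_Suc_eq le_supI1)

lemma stone_compl_supn:
  assumes "stone u p"
  shows "mem geq (- supn A n) u p \<longleftrightarrow> (\<forall>i<n. mem geq (- A i) u p)"
proof (induction n)
  case 0
  then show ?case using stone_top[OF assms] by simp
next
  case (Suc n)
  have "mem geq (inf (- supn A n) (- A n)) u p \<longleftrightarrow> mem geq (- supn A n) u p \<and> mem geq (- A n) u p"
    using stone_inf[OF assms] stone_up[OF assms] by (metis inf_le1 inf_le2)
  then show ?case using Suc by (auto simp: less_Suc_eq)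
qed

definition disjointed_elt :: "(nat \<Rightarrow> 'a::boolean_algebra) \<Rightarrow> nat \<Rightarrow> 'a" where
  "disjointed_elt A j = inf (A j) (- supn A j)"

text \<open>As the join of the cover is \<open>top\<close>, some \<open>A j\<close> belongs to
  \<open>u\<close>. All of them being decided at \<open>p\<close>, the least such index
  \<open>J\<close> is known there, and it selects the unique piece of the disjoint
  refinement.\<close>

lemma stone_partition:
  assumes st: "stone u p" and top: "supn A m = top"
    and dec: "\<And>j. j < m \<Longrightarrow> dec (mem geq (A j) u) p"
  obtains J where "J < m" "mem geq (A J) u p" "\<And>j. j < m \<Longrightarrow> mem geq (disjointed_elt A j) u p \<longleftrightarrow> j = J"
    "\<And>j. j < m \<Longrightarrow> dec (mem geq (disjointed_elt A j) u) p"
proof -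
  have "\<exists>j<m. mem geq (A j) u p"
  proof (rule ccontr)
    assume "\<not> ?thesis"
    then have "\<forall>j<m. mem geq (- A j) u p" using dec stone_compl[OF st] unfolding dec_def by blast
    then have "mem geq (- supn A m) u p" using stone_compl_supn[OF st] by blast
    then show False using top stone_bot[OF st] by simp
  qed
  then obtain J where J: "J < m" "mem geq (A J) u p" and min: "\<And>j. j < J \<Longrightarrow> \<not> mem geq (A j) u p"
    using exists_least_iff[of "\<lambda>j. j < m \<and> mem geq (A j) u p"] by (metis less_trans)
  have "\<forall>j<J. mem geq (- A j) u p"
    using min dec J(1) stone_compl[OF st] unfolding dec_def by (meson less_trans)
  then have mJ: "mem geq (disjointed_elt A J) u p"
    unfolding disjointed_elt_def using J(2) stone_inf[OF st] stone_compl_supn[OF st] by blast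
  have disj: "inf (disjointed_elt A i) (disjointed_elt A j) = bot" if "i < j" for i j
  proof -
    have "inf (disjointed_elt A i) (disjointed_elt A j) \<le> inf (supn A j) (- supn A j)"
      unfolding disjointed_elt_def using supn_upper[OF that, of A]
      by (meson inf_le1 inf_le2 inf_mono le_infI1 order_trans)
    then show ?thesis by (simp add: bot_unique)
  qed
  have n: "fnot (mem geq (disjointed_elt A j) u) p" if "j \<noteq> J" for j
    using stone_not_mem[OF st mJ] disj[of j J] disj[of J j] that by (metis inf_commute linorder_neqE_nat)
  show ?thesis
  proof (rule that[OF J])
    fix j
    show "mem geq (disjointed_elt A j) u p \<longleftrightarrow> j = J" using n mJ fnotD by blast
    show "dec (mem geq (disjointed_elt A j) u) p" using n mJ unfolding dec_def by (cases "j = J") auto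
  qed
qed

section \<open>Differences of point measures\<close>

lemma rclose_isq:
  assumes "isq p x C" "is_real y p" "rclose x y \<epsilon> p" "0 < \<eta>"
  shows "dns p (\<lambda>r. near r y C (\<epsilon> + \<eta>))"
proof -
  have "dns p (\<lambda>r. \<exists>c c'. near r x c (\<eta> / 3) \<and> near r y c' (\<eta> / 3) \<and> \<bar>c - c'\<bar> < \<epsilon>)"
    using assms by (intro rclose_near isq_is_real[OF assms(1)]) auto
  then show ?thesis
  proof (rule dns_mono)
    fix r assume r: "r \<le> p" "\<exists>c c'. near r x c (\<eta> / 3) \<and> near r y c' (\<eta> / 3) \<and> \<bar>c - c'\<bar> < \<epsilon>"
    then obtain c c' where c: "near r x c (\<eta> / 3)" "near r y c' (\<eta> / 3)" "\<bar>c - c'\<bar> < \<epsilon>" by blast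
    have "near r x C (\<eta> / 3)" using isq_near[OF req_le[OF assms(1) r(1)]] assms(4) by simp
    then have "\<bar>C - c\<bar> < \<eta> / 3 + \<eta> / 3" using near_unique c(1) by blast
    then have "\<bar>c' - C\<bar> + \<eta> / 3 \<le> \<epsilon> + \<eta>" using c(3) assms(4) by (simp add: abs_le_iff abs_if split: if_splits)
    then show "near r y C (\<epsilon> + \<eta>)" by (rule near_weaken[OF c(2)])
  qed simp
qed

text \<open>Symmetry is obtained through rational approximations, at the price of an arbitrarily
  small loss.\<close>

lemma rclose_sym:
  assumes "is_real x p" "is_real y p" "rclose x y \<epsilon> p" "\<epsilon> < \<epsilon>'"
  shows "rclose y x \<epsilon>' p"
proof -
  define \<eta> where "\<eta> = (\<epsilon>' - \<epsilon>) / 2"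
  have "dns p (\<lambda>r. \<exists>c c'. near r x c \<eta> \<and> near r y c' \<eta> \<and> \<bar>c - c'\<bar> < \<epsilon>)"
    using assms by (intro rclose_near) (auto simp: \<eta>_def)
  then show ?thesis
  proof (rule reg_bind[OF reg_rlt])
    fix r assume "\<exists>c c'. near r x c \<eta> \<and> near r y c' \<eta> \<and> \<bar>c - c'\<bar> < \<epsilon>"
    then obtain c c' where c: "near r x c \<eta>" "near r y c' \<eta>" "\<bar>c - c'\<bar> < \<epsilon>" by blast
    then have "\<bar>c' - c\<bar> + \<eta> + \<eta> \<le> \<epsilon>'" by (simp add: \<eta>_def abs_minus_commute field_simps)
    then show "rclose y x \<epsilon>' r" by (rule near_rclose[OF c(2,1)])
  qed
qed

lemma rclose_isq':
  assumes "isq p x C" "is_real y p" "rclose y x \<epsilon> p" "0 < \<eta>"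
  shows "dns p (\<lambda>r. near r y C (\<epsilon> + \<eta>))"
proof -
  have "rclose x y (\<epsilon> + \<eta> / 2) p"
    using rclose_sym[OF assms(2) isq_is_real[OF assms(1)] assms(3)] assms(4) by simp
  then have "dns p (\<lambda>r. near r y C (\<epsilon> + \<eta> / 2 + \<eta> / 2))"
    using assms by (intro rclose_isq[OF assms(1,2)]) auto
  moreover have "\<epsilon> + \<eta> / 2 + \<eta> / 2 = \<epsilon> + \<eta>" by simp
  ultimately show ?thesis by metis
qed

text \<open>
  The continuous function that refutes the Nikodym property takes the value \<open>wt i\<close> on the \<open>i\<close>-th
  clopen set; \<open>wt\<close> tends to 0, yet its average over \<open>i < 8 ^ n\<close> is at least \<open>1 / 2 ^ n\<close>, which
  makes up for a total mass of \<open>2 ^ n\<close>.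
\<close>

definition expo :: "nat \<Rightarrow> nat" where
  "expo i = (LEAST n. i < 8 ^ n)"

definition wt :: "nat \<Rightarrow> rat" where
  "wt i = 1 / 2 ^ expo i"

lemma expo_less: "i < 8 ^ expo i"
proof -
  have "i < 8 ^ i" by (induction i) auto
  then show ?thesis unfolding expo_def by (rule LeastI)
qed

lemma wt_pos: "0 < wt i"
  by (simp add: wt_def)

lemma wt_ge: "i < 8 ^ n \<Longrightarrow> 1 / 2 ^ n \<le> wt i"
  unfolding wt_def expo_def by (intro divide_left_mono power_increasing Least_le) auto

lemma wt_small:
  assumes "0 < \<delta>" obtains K where "\<And>i. K \<le> i \<Longrightarrow> wt i < \<delta>"
proof -
  obtain n :: nat where "1 / \<delta> < of_nat n" using reals_Archimedean2 by blast
  also have "(of_nat n :: rat) < of_nat (2 ^ n)" by (subst of_nat_less_iff) (rule less_exp)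
  finally have n: "(1 / 2) ^ n < \<delta>" using assms by (simp add: field_simps power_one_over)
  show ?thesis
  proof (rule that[of "8 ^ n"])
    fix i :: nat assume "8 ^ n \<le> i"
    then have "8 ^ n < (8::nat) ^ expo i" using expo_less[of i] by (rule le_less_trans)
    then have "n \<le> expo i" by simp
    then have "wt i \<le> (1 / 2) ^ n" unfolding wt_def by (simp add: power_one_over divide_left_mono power_increasing)
    then show "wt i < \<delta>" using n by simp
  qed
qed

text \<open>Each of the 8 ^ n terms is at least 1 / 2 ^ n times 1 / 4 ^ n, and 8 = 2 * 4.\<close>

lemma sum_wt: "1 \<le> (\<Sum>i<8 ^ n. wt i * (1 / 4 ^ n))"
proof -
  have "(\<Sum>i<(8::nat) ^ n. (1 / 2 ^ n) * (1 / 4 ^ n)) \<le> (\<Sum>i<8 ^ n. wt i * (1 / 4 ^ n))"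
    by (intro sum_mono mult_right_mono wt_ge) auto
  moreover have "(\<Sum>i<(8::nat) ^ n. (1 / 2 ^ n) * (1 / 4 ^ n) :: rat) = 1"
    by (simp flip: power_mult_distrib)
  ultimately show ?thesis by simp
qed

abbreviation inpt :: "(nat \<Rightarrow> ('a, 'p::preorder) point) \<Rightarrow> 'a \<Rightarrow> nat \<Rightarrow> 'p fm" where
  "inpt v a \<equiv> \<lambda>i. mem geq a (v i)"

abbreviation inset :: "(nat \<Rightarrow> ('a, 'p::preorder) point) \<Rightarrow> ('a, 'p) pset \<Rightarrow> nat \<Rightarrow> 'p fm" where
  "inset v B \<equiv> \<lambda>i. pmem (v i) B"

text \<open>
  \<open>dd i a\<close> says that the \<open>i\<close>-th element of a disjoint sequence, which need not belong to V, is \<open>a\<close>.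
  The last assumption is that \<open>(\<Sum>i<8 ^ n. \<delta>\<^bsub>v i\<^esub> - \<delta>\<^bsub>v' i\<^esub>) / 4 ^ n\<close> is pointwise null.
\<close>

locale point_pairs =
  fixes p0 :: "'p::preorder" and v v' :: "nat \<Rightarrow> ('a::boolean_algebra, 'p) point"
    and dd :: "nat \<Rightarrow> 'a \<Rightarrow> 'p fm"
  assumes st: "\<And>i. stone (v i) p0" and st': "\<And>i. stone (v' i) p0"
    and dd_reg: "\<And>i a. reg (dd i a)"
    and dd_ex: "\<And>i. dns p0 (\<lambda>r. \<exists>a. dd i a r)"
    and dd_uniq: "\<And>i a b r. r \<le> p0 \<Longrightarrow> dd i a r \<Longrightarrow> dd i b r \<Longrightarrow> a = b"
    and dd_disj: "\<And>i j a b r. r \<le> p0 \<Longrightarrow> i \<noteq> j \<Longrightarrow> dd i a r \<Longrightarrow> dd j b r \<Longrightarrow> inf a b = bot"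
    and dd_v: "\<And>i a r. r \<le> p0 \<Longrightarrow> dd i a r \<Longrightarrow> mem geq a (v i) r"
    and dd_v': "\<And>i j a r. r \<le> p0 \<Longrightarrow> dd i a r \<Longrightarrow> \<not> mem geq a (v' j) r"
    and small: "\<And>a \<epsilon>. 0 < \<epsilon> \<Longrightarrow> dns p0 (\<lambda>r. \<exists>N. \<forall>n\<ge>N. \<forall>s\<le>r. decs (8 ^ n) (inpt v a) (inpt v' a) s \<longrightarrow>
        \<bar>dval (8 ^ n) (inpt v a) (inpt v' a) s\<bar> < \<epsilon> * 4 ^ n)"
begin

lemma st_le: "r \<le> p0 \<Longrightarrow> stone (v i) r" and st'_le: "r \<le> p0 \<Longrightarrow> stone (v' i) r"
  using regD[OF reg_stone st] regD[OF reg_stone st'] by blast+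

text \<open>The factor is kept general: 1 / 4 ^ n serves against the Nikodym property, 1 / 8 ^ n
  against the Grothendieck property.\<close>

definition mus :: "(nat \<Rightarrow> rat) \<Rightarrow> ('a, 'p) mseq" where
  "mus k = fname (\<lambda>_. ground True) (\<lambda>x. dsum (k (fst x)) (8 ^ fst x) (inpt v (snd x)) (inpt v' (snd x)))"

lemma mus_val: "req (mval (mus k) n a) (dsum (k n) (8 ^ n) (inpt v a) (inpt v' a)) p"
proof -
  have "req (mval (mus k) n a) (dsum (k (fst (n, a))) (8 ^ fst (n, a)) (inpt v (snd (n, a))) (inpt v' (snd (n, a)))) p"
    unfolding mus_def by (rule app_fname) (auto simp: geq_iff)
  then show ?thesis by simp
qed

lemma mus_isq:
  assumes "decs (8 ^ n) (inpt v a) (inpt v' a) r"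
  shows "isq r (mval (mus k) n a) (k n * dval (8 ^ n) (inpt v a) (inpt v' a) r)"
  using mus_val isq_dsum[OF reg_mem reg_mem assms] req_trans by blast

lemma dval_bound: "\<bar>dval N \<phi> \<psi> r\<bar> \<le> of_nat N"
proof -
  have "\<bar>dval N \<phi> \<psi> r\<bar> \<le> (\<Sum>i<N. \<bar>tv (\<phi> i) r - tv (\<psi> i) r\<bar>)" unfolding dval_def by (rule sum_abs)
  also have "\<dots> \<le> (\<Sum>i<N. 1)" by (rule sum_mono) (simp add: tv_def)
  finally show ?thesis by simp
qed

lemma tv_sup:
  assumes "stone u r" "inf a b = bot" "dec (mem geq a u) r" "dec (mem geq b u) r"
  shows "dec (mem geq (sup a b) u) r" "tv (mem geq (sup a b) u) r = tv (mem geq a u) r + tv (mem geq b u) r"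
proof -
  consider (a) "mem geq a u r" | (b) "mem geq b u r" | (n) "fnot (mem geq a u) r" "fnot (mem geq b u) r"
    using assms(3,4) unfolding dec_def by blast
  then have "dec (mem geq (sup a b) u) r \<and> tv (mem geq (sup a b) u) r = tv (mem geq a u) r + tv (mem geq b u) r"
  proof cases
    case a
    then have "mem geq (sup a b) u r" "\<not> mem geq b u r"
      using stone_up[OF assms(1)] stone_disj[OF assms(1)] assms(2) sup_ge1 by blast+
    then show ?thesis using a by (simp add: dec_def tv_def)
  next
    case b
    then have "mem geq (sup a b) u r" "\<not> mem geq a u r"
      using stone_up[OF assms(1)] stone_disj[OF assms(1)] assms(2) sup_ge2 by blast+
    then show ?thesis using b by (simp add: dec_def tv_def)
  next
    case n
    then have "mem geq (inf (- a) (- b)) u r" using stone_compl[OF assms(1)] stone_inf[OF assms(1)] by blast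
    then have "fnot (mem geq (sup a b) u) r" using stone_compl[OF assms(1), of "sup a b"] by simp
    then show ?thesis using n fnotD by (auto simp: dec_def tv_def)
  qed
  then show "dec (mem geq (sup a b) u) r" "tv (mem geq (sup a b) u) r = tv (mem geq a u) r + tv (mem geq b u) r"
    by blast+
qed

text \<open>Additivity is that of Dirac measures, \<open>tv_sup\<close>, checked where all
  memberships of the finitely many points are decided. The norm bound counts one unit per pair of
  points for each of the two sets.\<close>

lemma is_measure_mus:
  assumes "p \<le> p0" shows "is_measure (mval (mus k) n) p"
  unfolding is_measure_def fand_iff fall_iff fimp_iff fex_iff ground_iff
proof (intro conjI allI impI)
  fix a b :: 'a and q assume q: "q \<le> p" "inf a b = bot"
  show "req (mval (mus k) n (sup a b)) (radd (mval (mus k) n a) (mval (mus k) n b)) q"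
  proof (rule reg_bind[OF reg_set_eq dns_decs[of "inpt v a" "inpt v' a" q "8 ^ n"]])
    fix r assume r: "r \<le> q" "decs (8 ^ n) (inpt v a) (inpt v' a) r"
    show "req (mval (mus k) n (sup a b)) (radd (mval (mus k) n a) (mval (mus k) n b)) r"
    proof (rule reg_bind[OF reg_set_eq dns_decs[of "inpt v b" "inpt v' b" r "8 ^ n"]])
      fix s assume s: "s \<le> r" "decs (8 ^ n) (inpt v b) (inpt v' b) s"
      have s0: "s \<le> p0" using s r q assms order_trans by metis
      have a: "decs (8 ^ n) (inpt v a) (inpt v' a) s" using decs_le[OF _ _ r(2) s(1)] by simp
      have "decs (8 ^ n) (inpt v (sup a b)) (inpt v' (sup a b)) s"
        using a s(2) tv_sup(1)[OF _ q(2)] st_le[OF s0] st'_le[OF s0] unfolding decs_def by blast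
      then have "isq s (mval (mus k) n (sup a b)) (k n * dval (8 ^ n) (inpt v (sup a b)) (inpt v' (sup a b)) s)"
        by (rule mus_isq)
      moreover have "dval (8 ^ n) (inpt v (sup a b)) (inpt v' (sup a b)) s =
          dval (8 ^ n) (inpt v a) (inpt v' a) s + dval (8 ^ n) (inpt v b) (inpt v' b) s"
        unfolding dval_def sum.distrib[symmetric]
      proof (rule sum.cong)
        fix i assume "i \<in> {..<(8::nat) ^ n}"
        then have "tv (mem geq (sup a b) (v i)) s = tv (mem geq a (v i)) s + tv (mem geq b (v i)) s"
          "tv (mem geq (sup a b) (v' i)) s = tv (mem geq a (v' i)) s + tv (mem geq b (v' i)) s"
          using tv_sup(2)[OF _ q(2)] a s(2) st_le[OF s0] st'_le[OF s0] unfolding decs_def by blast+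
        then show "tv (mem geq (sup a b) (v i)) s - tv (mem geq (sup a b) (v' i)) s =
           tv (mem geq a (v i)) s - tv (mem geq a (v' i)) s + (tv (mem geq b (v i)) s - tv (mem geq b (v' i)) s)"
          by simp
      qed simp
      moreover have "isq s (radd (mval (mus k) n a) (mval (mus k) n b))
          (k n * dval (8 ^ n) (inpt v a) (inpt v' a) s + k n * dval (8 ^ n) (inpt v b) (inpt v' b) s)"
        by (intro isq_radd mus_isq a s(2))
      ultimately show "req (mval (mus k) n (sup a b)) (radd (mval (mus k) n a) (mval (mus k) n b)) s"
        unfolding distrib_left[symmetric] using req_trans[OF _ req_sym] by simp
    qed simp_all
  qed simp_all
next
  let ?c = "2 * (\<bar>k n\<bar> * of_nat (8 ^ n))"
  have "rle (radd (rabs (mval (mus k) n a)) (rabs (mval (mus k) n b))) (rof ?c) q" for a b q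
  proof (rule reg_bind[OF reg_rle dns_decs[of "inpt v a" "inpt v' a" q "8 ^ n"]])
    fix r assume r: "r \<le> q" "decs (8 ^ n) (inpt v a) (inpt v' a) r"
    show "rle (radd (rabs (mval (mus k) n a)) (rabs (mval (mus k) n b))) (rof ?c) r"
    proof (rule reg_bind[OF reg_rle dns_decs[of "inpt v b" "inpt v' b" r "8 ^ n"]])
      fix s assume s: "s \<le> r" "decs (8 ^ n) (inpt v b) (inpt v' b) s"
      have a: "decs (8 ^ n) (inpt v a) (inpt v' a) s" using decs_le[OF _ _ r(2) s(1)] by simp
      have *: "\<bar>k n * dval (8 ^ n) (inpt v c) (inpt v' c) s\<bar> \<le> \<bar>k n\<bar> * of_nat (8 ^ n)" for c
        unfolding abs_mult by (intro mult_left_mono dval_bound) simp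
      show "rle (radd (rabs (mval (mus k) n a)) (rabs (mval (mus k) n b))) (rof ?c) s"
        by (rule isq_rle[OF isq_radd[OF isq_rabs[OF mus_isq[OF a]] isq_rabs[OF mus_isq[OF s(2)]]]])
          (use *[of a] *[of b] in linarith)
    qed simp_all
  qed simp_all
  then show "dns p (\<lambda>r. \<exists>c. \<forall>a b. \<forall>q\<le>r. inf a b = bot \<longrightarrow>
       rle (radd (rabs (mval (mus k) n a)) (rabs (mval (mus k) n b))) (rof c) q)"
    by (intro dns_now exI[of _ ?c]) blast
qed

lemma is_mseq_mus: "p \<le> p0 \<Longrightarrow> is_mseq (mus k) p"
  unfolding is_mseq_def fand_iff fall_iff
proof (intro conjI allI is_measure_mus)
  show "is_fun geq (\<lambda>x. ground True) (mus k) p"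
    unfolding mus_def by (rule is_fun_fname) (auto simp: geq_iff intro: is_real_dsum)
qed

lemma pointwise_null_mus:
  assumes "p \<le> p0" and k: "\<And>n. \<bar>k n\<bar> \<le> 1 / 4 ^ n" shows "pointwise_null (mus k) p"
  unfolding pointwise_null_def fall_iff
proof (intro allI convergesI)
  fix a and \<epsilon> :: rat assume "0 < \<epsilon>"
  from dns_le[OF small[OF this, of a] assms(1)]
  show "dns p (\<lambda>r. \<exists>N. \<forall>n\<ge>N. rclose (mval (mus k) n a) (rof 0) \<epsilon> r)"
  proof (rule dns_mono)
    fix r assume "\<exists>N. \<forall>n\<ge>N. \<forall>s\<le>r. decs (8 ^ n) (inpt v a) (inpt v' a) s \<longrightarrow>
        \<bar>dval (8 ^ n) (inpt v a) (inpt v' a) s\<bar> < \<epsilon> * 4 ^ n"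
    then obtain N where *: "\<forall>n\<ge>N. \<forall>s\<le>r. decs (8 ^ n) (inpt v a) (inpt v' a) s \<longrightarrow>
        \<bar>dval (8 ^ n) (inpt v a) (inpt v' a) s\<bar> < \<epsilon> * 4 ^ n" by blast
    show "\<exists>N. \<forall>n\<ge>N. rclose (mval (mus k) n a) (rof 0) \<epsilon> r"
    proof (intro exI allI impI)
      fix n assume n: "N \<le> n"
      show "rclose (mval (mus k) n a) (rof 0) \<epsilon> r"
      proof (rule reg_bind[OF reg_rlt dns_decs[of "inpt v a" "inpt v' a" r "8 ^ n"]])
        fix s assume s: "s \<le> r" "decs (8 ^ n) (inpt v a) (inpt v' a) s"
        then have "\<bar>dval (8 ^ n) (inpt v a) (inpt v' a) s\<bar> < \<epsilon> * 4 ^ n" using * n by blast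
        then have "1 / 4 ^ n * \<bar>dval (8 ^ n) (inpt v a) (inpt v' a) s\<bar> < \<epsilon>" by (simp add: field_simps)
        moreover have "\<bar>k n\<bar> * \<bar>dval (8 ^ n) (inpt v a) (inpt v' a) s\<bar> \<le> 1 / 4 ^ n * \<bar>dval (8 ^ n) (inpt v a) (inpt v' a) s\<bar>"
          by (intro mult_right_mono k) simp
        ultimately have "\<bar>k n * dval (8 ^ n) (inpt v a) (inpt v' a) s - 0\<bar> < \<epsilon>" by (simp add: abs_mult)
        then show "rclose (mval (mus k) n a) (rof 0) \<epsilon> s"
          by (rule isq_rclose[OF mus_isq[OF s(2)] req_refl])
      qed simp_all
    qed
  qed simp
qed

text \<open>The whole disjoint sequence need not lie in V, but a finite initial segment is a finite
  list of ground elements and is therefore decided densely.\<close>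

lemma dd_prefix:
  assumes "p \<le> p0" shows "dns p (\<lambda>r. \<exists>D. \<forall>i<K. dd i (D i) r)"
proof -
  have "dns p (\<lambda>r. \<forall>i\<in>{..<K}. \<exists>a. dd i a r)"
    by (rule dns_ball_finite) (auto intro: dns_le[OF dd_ex assms] regD[OF dd_reg])
  then show ?thesis
  proof (rule dns_mono)
    fix r assume "\<forall>i\<in>{..<K}. \<exists>a. dd i a r"
    from bchoice[OF this] show "\<exists>D. \<forall>i<K. dd i (D i) r" by auto
  qed simp
qed

text \<open>\<open>a\<close> contains \<open>v i\<close> and no \<open>v' j\<close>. It contains no
  other \<open>v j\<close> either, because \<open>v j\<close> lies in the \<open>j\<close>-th
  element, which is disjoint from \<open>a\<close>. So a measure has at most one of its point masses
  in \<open>a\<close>.\<close>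

lemma dd_dval:
  assumes "r \<le> p0" "dd i a r"
  shows "decs N (inpt v a) (inpt v' a) r" "dval N (inpt v a) (inpt v' a) r = (if i < N then 1 else 0)"
proof -
  have n': "fnot (mem geq a (v' j)) r" for j
    unfolding fnot_iff using dd_v'[OF order_trans[OF _ assms(1)] regD[OF dd_reg assms(2)]] by blast
  have n: "fnot (mem geq a (v j)) r" if "j \<noteq> i" for j
    unfolding fnot_iff
  proof (intro allI impI notI)
    fix q assume q: "q \<le> r" "mem geq a (v j) q"
    have "dns q (\<lambda>r. \<exists>b. dd j b r)" using dd_ex dns_le order_trans[OF q(1) assms(1)] by blast
    then obtain s b where s: "s \<le> q" "dd j b s" by (auto elim: dns_obtain)
    have s0: "s \<le> p0" "s \<le> r" using s q assms order_trans by metis+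
    have "inf a b = bot" using dd_disj[OF s0(1) _ regD[OF dd_reg assms(2) s0(2)] s(2)] that by blast
    then show False
      using stone_disj[OF st_le[OF s0(1)] regD[OF reg_mem q(2) s(1)]] dd_v[OF s0(1) s(2)] by blast
  qed
  show "decs N (inpt v a) (inpt v' a) r"
    unfolding decs_def dec_def using n n' dd_v[OF assms] by metis
  have "tv (mem geq a (v j)) r - tv (mem geq a (v' j)) r = (if j = i then 1 else 0)" for j
    using n[of j] n'[of j] dd_v[OF assms] fnotD unfolding tv_def by auto
  then show "dval N (inpt v a) (inpt v' a) r = (if i < N then 1 else 0)"
    unfolding dval_def by simp
qed

text \<open>Every Radon extension agrees with the measure on clopen sets, so the refutations can
  take an arbitrary \<open>\<nu>\<close> and evaluate it at the \<open>i\<close>-th disjoint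
  element, here under a name \<open>B\<close> that is only forced equal to a clopen set.\<close>

lemma radon_clopen:
  assumes "is_radon_seq (mus k) \<nu> r" "r \<le> p0" "dd i a r" "pset_eq B (clopen a) r"
  shows "isq r (rval \<nu> n B) (k n * (if i < 8 ^ n then 1 else 0))"
proof -
  have "req (rval \<nu> n (clopen a)) (mval (mus k) n a) r"
    using assms(1) unfolding is_radon_seq_def is_radon_extension_def fand_iff fall_iff by (elim conjE allE)
  moreover have "req (rval \<nu> n B) (rval \<nu> n (clopen a)) r"
    by (rule app_cong) (use assms(4) in \<open>auto simp: prod_eq_def geq_refl\<close>)
  moreover have "isq r (mval (mus k) n a) (k n * (if i < 8 ^ n then 1 else 0))"
    using mus_isq[OF dd_dval(1)[OF assms(2,3)], of k n] unfolding dd_dval(2)[OF assms(2,3)] .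
  ultimately show ?thesis by (blast intro: req_trans)
qed

end

text \<open>Both refutations end here: 1/4 + 1/4 < 1, and the slack 1/8 used twice for passing to
  rational approximations still leaves the total at 3/4.\<close>

lemma not_close_to_zero:
  assumes "isq p x C" "is_real y p" "rclose x y (1/4) p" "rclose y (rof 0) (1/4) p" "1 \<le> C"
  shows False
proof -
  have d1: "dns p (\<lambda>r. near r y C (1/4 + 1/8))" using assms by (intro rclose_isq) auto
  have d2: "dns p (\<lambda>r. near r y 0 (1/4 + 1/8))" using assms by (intro rclose_isq'[OF req_refl]) auto
  obtain r where r: "r \<le> p" "near r y C (1/4 + 1/8)" using d1 by (rule dns_obtain)
  obtain s where s: "s \<le> r" "near s y 0 (1/4 + 1/8)" using dns_le[OF d2 r(1)] by (rule dns_obtain)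
  from near_unique[OF near_le[OF r(2) s(1)] s(2)] show False using assms(5) by simp
qed

lemma fimpD: "fimp \<phi> \<psi> p \<Longrightarrow> q \<le> p \<Longrightarrow> \<phi> q \<Longrightarrow> \<psi> q"
  by (simp add: fimp_iff)

lemma fallD: "fall \<Phi> p \<Longrightarrow> \<Phi> x p"
  by simp

lemma reg_is_radon_seq [simp]: "reg (is_radon_seq \<mu> \<nu>)"
  by (simp add: is_radon_seq_def is_radon_extension_def del: fand_iff fall_iff fex_iff f_or_iff)

lemma fimp_ground: "reg \<phi> \<Longrightarrow> fimp (ground P) \<phi> p \<longleftrightarrow> (P \<longrightarrow> \<phi> p)"
  using regD by (auto simp: fimp_iff)

text \<open>The premise inside \<open>is_integral\<close>, isolated: a finite Borel partition with
  rational values that approximates \<open>f\<close> uniformly within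
  \<open>\<delta>\<close>.\<close>

definition simple_approx :: "(('a::boolean_algebra, 'p::preorder) point \<Rightarrow> 'p rname) \<Rightarrow>
    rat list \<Rightarrow> ('a, 'p) pseq \<Rightarrow> rat \<Rightarrow> 'p fm" where
  "simple_approx f c S \<delta> =
     ((\<^bold>\<forall>i. ground (i < length c) \<^bold>\<longrightarrow> is_borel (pnth S i)) \<^bold>\<and>
      (\<^bold>\<forall>i j. ground (i < j \<and> j < length c) \<^bold>\<longrightarrow> pdisj (pnth S i) (pnth S j)) \<^bold>\<and>
      (\<^bold>\<forall>u. stone u \<^bold>\<longrightarrow> (\<^bold>\<exists>i. ground (i < length c) \<^bold>\<and> pmem u (pnth S i))) \<^bold>\<and>
      (\<^bold>\<forall>i u. ground (i < length c) \<^bold>\<and> pmem u (pnth S i) \<^bold>\<longrightarrow>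
         rle (rabs (rdiff (f u) (rof (c ! i)))) (rof \<delta>)))"

lemma simple_approx_iff: "simple_approx f c S \<delta> q \<longleftrightarrow>
     (\<forall>i<length c. is_borel (pnth S i) q) \<and>
     (\<forall>i j. i < j \<and> j < length c \<longrightarrow> pdisj (pnth S i) (pnth S j) q) \<and>
     (\<forall>u. \<forall>s\<le>q. stone u s \<longrightarrow> dns s (\<lambda>t. \<exists>i<length c. pmem u (pnth S i) t)) \<and>
     (\<forall>i u. \<forall>s\<le>q. i < length c \<and> pmem u (pnth S i) s \<longrightarrow> rle (rabs (rdiff (f u) (rof (c ! i)))) (rof \<delta>) s)"
  unfolding simple_approx_def fand_iff fall_iff fimp_ground[OF reg_is_borel] fimp_ground[OF reg_pdisj]
  unfolding fimp_iff fand_iff fex_iff ground_iff by (rule refl)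

lemma is_integral_iff: "is_integral f w l p \<longleftrightarrow> is_real l p \<and> (\<forall>\<epsilon>>0. dns p (\<lambda>r. \<exists>\<delta>>0. \<forall>c S. \<forall>q\<le>r.
     simple_approx f c S \<delta> q \<longrightarrow> rclose (rsum (\<lambda>i. rscale (c ! i) (w (pnth S i))) (length c)) l \<epsilon> q))"
  unfolding is_integral_def simple_approx_def[symmetric] fand_iff fall_iff fimp_ground[OF reg_fex]
  unfolding fex_iff fand_iff fall_iff ground_iff fimp_iff by (rule refl)

section \<open>Refutation of weak* nullity and of weak nullity\<close>

context point_pairs
begin

text \<open>The value at \<open>u\<close> of the test function, which is \<open>wt i\<close> on the
  \<open>i\<close>-th disjoint element and 0 off their union. As a cut it is defined before it is
  decided which case applies to \<open>u\<close>.\<close>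

definition gval :: "('a, 'p) point \<Rightarrow> 'p rname" where
  "gval u = compr (\<lambda>q p. dns p (\<lambda>r. q < 0 \<or> (\<exists>i a. dd i a r \<and> mem geq a u r \<and> q < wt i)))"

lemma rmem_gval: "rmem q (gval u) p \<longleftrightarrow> dns p (\<lambda>r. q < 0 \<or> (\<exists>i a. dd i a r \<and> mem geq a u r \<and> q < wt i))"
  unfolding gval_def by simp

lemma gval_hit:
  assumes "p \<le> p0" "stone u p" "dd i a p" "mem geq a u p" shows "isq p (gval u) (wt i)"
  unfolding req_iff rmem_gval rmem_rof
proof (intro allI impI iffI)
  fix x q assume q: "q \<le> p" "dns q (\<lambda>r. x < 0 \<or> (\<exists>i a. dd i a r \<and> mem geq a u r \<and> x < wt i))"
  from q(2) obtain r where r: "r \<le> q" "x < 0 \<or> (\<exists>i a. dd i a r \<and> mem geq a u r \<and> x < wt i)"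
    by (rule dns_obtain)
  have rp: "r \<le> p" "r \<le> p0" using r(1) q(1) assms(1) order_trans by metis+
  from r(2) show "x < wt i"
  proof (elim disjE exE conjE)
    fix j b assume j: "dd j b r" "mem geq b u r" "x < wt j"
    have "j = i"
    proof (rule ccontr)
      assume "j \<noteq> i"
      then have "inf b a = bot" using dd_disj[OF rp(2) _ j(1) regD[OF dd_reg assms(3) rp(1)]] by blast
      then show False
        using stone_disj[OF regD[OF reg_stone assms(2) rp(1)] j(2)] regD[OF reg_mem assms(4) rp(1)] by blast
    qed
    then show ?thesis using j by simp
  qed (use wt_pos[of i] in linarith)
next
  fix x q assume q: "q \<le> p" "x < wt i"
  show "dns q (\<lambda>r. x < 0 \<or> (\<exists>i a. dd i a r \<and> mem geq a u r \<and> x < wt i))"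
  proof (rule dns_now)
    fix r assume "r \<le> q"
    then have "r \<le> p" using q(1) order_trans by blast
    then show "x < 0 \<or> (\<exists>i a. dd i a r \<and> mem geq a u r \<and> x < wt i)"
      using q(2) regD[OF dd_reg assms(3)] regD[OF reg_mem assms(4)] by blast
  qed
qed

lemma gval_miss:
  assumes "fnot (\<lambda>r. \<exists>i a. dd i a r \<and> mem geq a u r) p" shows "isq p (gval u) 0"
  unfolding req_iff rmem_gval rmem_rof
proof (intro allI impI)
  fix x q assume q: "q \<le> p"
  have "dns q (\<lambda>r. x < 0 \<or> (\<exists>i a. dd i a r \<and> mem geq a u r \<and> x < wt i)) = dns q (\<lambda>r. x < 0)"
    by (rule dns_cong) (use assms order_trans[OF _ q] in \<open>auto simp: fnot_iff\<close>)
  then show "dns q (\<lambda>r. x < 0 \<or> (\<exists>i a. dd i a r \<and> mem geq a u r \<and> x < wt i)) = (x < 0)" by simp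
qed

lemma gval_cong: "set_eq geq u w p \<Longrightarrow> req (gval u) (gval w) p"
  unfolding req_iff rmem_gval by (intro allI impI dns_cong) (metis order_trans set_eqD)

lemma gval_real:
  assumes "p \<le> p0" "stone u p" shows "is_real (gval u) p"
proof (rule reg_bind[OF reg_is_real decide[of p "\<lambda>r. \<exists>i a. dd i a r \<and> mem geq a u r"]], elim disjE exE conjE)
  fix r i a assume "r \<le> p" "dd i a r" "mem geq a u r"
  then show "is_real (gval u) r"
    using isq_is_real[OF gval_hit] regD[OF reg_stone assms(2)] order_trans[OF _ assms(1)] by blast
qed (rule isq_is_real[OF gval_miss])

definition fN :: "(('a, 'p) point \<times> 'p rname, 'p) name" where
  "fN = fname stone gval"

lemma app_fN: "stone u p \<Longrightarrow> req (app (set_eq geq) fN u) (gval u) p"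
  unfolding fN_def by (rule app_fname) (auto intro: stone_cong gval_cong)

text \<open>Outside the first \<open>K\<close> elements the value is 0 or some \<open>wt i\<close>
  with \<open>K \<le> i\<close>; a stronger condition decides which.\<close>

lemma gval_le:
  assumes "p \<le> p0" "stone u p" and K: "\<And>i. K \<le> i \<Longrightarrow> wt i < \<delta>" "0 < \<delta>"
    and D: "\<forall>i<K. dd i (D i) p" "mem geq (- supn D K) u p"
  shows "dns p (\<lambda>r. \<exists>c. 0 \<le> c \<and> c < \<delta> \<and> isq r (gval u) c)"
proof (rule dns_mono[OF decide[of p "\<lambda>r. \<exists>i a. dd i a r \<and> mem geq a u r"]], simp, elim disjE exE conjE)
  fix r i a assume r: "r \<le> p" "dd i a r" "mem geq a u r"
  have r0: "r \<le> p0" using r(1) assms(1) order_trans by blast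
  have su: "stone u r" using regD[OF reg_stone assms(2) r(1)] .
  have "K \<le> i"
  proof (rule ccontr)
    assume "\<not> K \<le> i"
    then have i: "i < K" by simp
    then have "dd i (D i) p" using D(1) by blast
    then have "a = D i" using dd_uniq[OF r0 r(2) regD[OF dd_reg _ r(1)]] by blast
    moreover have "mem geq (- D i) u p" using i D(2) stone_compl_supn[OF assms(2)] by blast
    then have "mem geq (- D i) u r" by (rule regD[OF reg_mem _ r(1)])
    ultimately show False using stone_disj[OF su r(3), of "- D i"] by simp
  qed
  then show "\<exists>c. 0 \<le> c \<and> c < \<delta> \<and> isq r (gval u) c"
    using K gval_hit[OF r0 su r(2,3)] wt_pos[of i] by (intro exI[of _ "wt i"]) auto
next
  fix r assume "fnot (\<lambda>r. \<exists>i a. dd i a r \<and> mem geq a u r) r"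
  from gval_miss[OF this] show "\<exists>c. 0 \<le> c \<and> c < \<delta> \<and> isq r (gval u) c"
    using K(2) by (intro exI[of _ 0]) auto
qed

text \<open>On each disjoint element the function is constant. At a point off the union, the
  complement of the first \<open>K\<close> elements is a neighbourhood on which only weights below
  \<open>\<epsilon>\<close> occur; here it matters that \<open>wt\<close> tends to 0.\<close>

lemma fN_continuous:
  assumes p: "p \<le> p0" shows "is_continuous fN p"
  unfolding is_continuous_def fand_iff fall_iff fimp_iff fex_iff ground_iff
proof (intro conjI allI impI)
  show "is_fun (set_eq geq) stone fN p"
    unfolding fN_def
    by (rule is_fun_fname) (auto intro: stone_cong gval_cong gval_real order_trans[OF _ p])
next
  fix u :: "('a, 'p) point" and \<epsilon> :: rat and q assume "q \<le> p" "stone u q \<and> 0 < \<epsilon>"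
  then have q: "q \<le> p0" "stone u q" "0 < \<epsilon>" using p order_trans by blast+
  let ?R = "\<lambda>r. \<exists>a. mem geq a u r \<and> (\<forall>w. \<forall>s\<le>r. stone w s \<and> mem geq a w s \<longrightarrow>
     rclose (app (set_eq geq) fN w) (app (set_eq geq) fN u) \<epsilon> s)"
  show "dns q ?R"
  proof (rule dns_bind[OF decide[of q "\<lambda>r. \<exists>i a. dd i a r \<and> mem geq a u r"]], elim disjE exE conjE)
    fix r i a assume r: "r \<le> q" "dd i a r" "mem geq a u r"
    have "rclose (app (set_eq geq) fN w) (app (set_eq geq) fN u) \<epsilon> s"
      if s: "s \<le> r" "stone w s" "mem geq a w s" for w s
    proof -
      have s0: "s \<le> p0" using s r q order_trans by metis
      have su: "stone u s" using regD[OF reg_stone q(2) order_trans[OF s(1) r(1)]] .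
      have da: "dd i a s" "mem geq a u s" using regD[OF dd_reg r(2) s(1)] regD[OF reg_mem r(3) s(1)] .
      show ?thesis
        using isq_rclose[OF req_trans[OF app_fN[OF s(2)] gval_hit[OF s0 s(2) da(1) s(3)]]
           req_trans[OF app_fN[OF su] gval_hit[OF s0 su da]]] q(3) by simp
    qed
    then have "?R s" if "s \<le> r" for s
      using regD[OF reg_mem r(3) that] order_trans[OF _ that] by blast
    then show "dns r ?R" by (rule dns_now)
  next
    fix r assume r: "r \<le> q" "fnot (\<lambda>r. \<exists>i a. dd i a r \<and> mem geq a u r) r"
    obtain K where K: "\<And>i. K \<le> i \<Longrightarrow> wt i < \<epsilon>" using wt_small q(3) by blast
    have r0: "r \<le> p0" using r q order_trans by metis
    show "dns r ?R"
    proof (rule dns_mono[OF dd_prefix[OF r0, of K]], simp, elim exE)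
      fix t D assume t: "t \<le> r" and D: "\<forall>i<K. dd i (D i) t"
      have t0: "t \<le> p0" using t r0 order_trans by metis
      have su: "stone u t" using regD[OF reg_stone q(2) order_trans[OF t r(1)]] .
      have "mem geq (- D i) u t" if "i < K" for i
      proof -
        have "fnot (mem geq (D i) u) t" unfolding fnot_iff
        proof (intro allI impI notI)
          fix s assume s: "s \<le> t" "mem geq (D i) u s"
          then show False using r(2) order_trans[OF s(1) t] regD[OF dd_reg _ s(1)] D that
            unfolding fnot_iff by blast
        qed
        then show ?thesis using stone_compl[OF su] by blast
      qed
      then have mu: "mem geq (- supn D K) u t" using stone_compl_supn[OF su] by blast
      moreover have "rclose (app (set_eq geq) fN w) (app (set_eq geq) fN u) \<epsilon> s"
        if s: "s \<le> t" "stone w s" "mem geq (- supn D K) w s" for w s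
      proof -
        have s0: "s \<le> p0" using s t0 order_trans by metis
        have su: "stone u s" using regD[OF reg_stone su s(1)] .
        have D': "\<forall>i<K. dd i (D i) s" using D regD[OF dd_reg _ s(1)] by blast
        have u0: "isq s (app (set_eq geq) fN u) 0"
          using req_trans[OF app_fN[OF su] gval_miss[OF fnot_le[OF r(2) order_trans[OF s(1) t]]]] .
        show ?thesis
        proof (rule reg_bind[OF reg_rlt gval_le[OF s0 s(2) K q(3) D' s(3)]], assumption, elim exE conjE)
          fix x c assume x: "x \<le> s" "0 \<le> c" "c < \<epsilon>" "isq x (gval w) c"
          have "isq x (app (set_eq geq) fN w) c"
            using req_trans[OF app_fN[OF regD[OF reg_stone s(2) x(1)]] x(4)] .
          then show "rclose (app (set_eq geq) fN w) (app (set_eq geq) fN u) \<epsilon> x"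
            using isq_rclose[OF _ req_le[OF u0 x(1)]] x by simp
        qed
      qed
      ultimately show "?R t" by blast
    qed
  qed
qed

text \<open>The first \<open>K\<close> disjoint elements and the remainder of the space form an
  explicit simple approximation of \<open>fN\<close>. For \<open>K \<ge> 8 ^ n\<close> it captures
  every positive point mass of the \<open>n\<close>-th measure, while the negative ones lie in the
  remainder, where the value is 0; the resulting sum is at least 1 by \<open>sum_wt\<close>.\<close>

lemma not_weak_star_null:
  assumes p: "p \<le> p0" shows "\<not> weak_star_null (mus (\<lambda>n. 1 / 4 ^ n)) p"
proof
  assume "weak_star_null (mus (\<lambda>n. 1 / 4 ^ n)) p"
  then obtain r \<nu> where r: "r \<le> p" and rad: "is_radon_seq (mus (\<lambda>n. 1 / 4 ^ n)) \<nu> r"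
    and cont: "(\<^bold>\<forall>f. is_continuous f \<^bold>\<longrightarrow>
           (\<^bold>\<exists>l. is_fun geq (\<lambda>x. ground True) l \<^bold>\<and>
              (\<^bold>\<forall>n. is_integral (app (set_eq geq) f) (rval \<nu> n) (app geq l n)) \<^bold>\<and>
              converges (app geq l) (rof 0))) r"
    unfolding weak_star_null_def fex_iff[of _ p] by (auto elim: dns_obtain)
  have r0: "r \<le> p0" using r p order_trans by blast
  have "(\<^bold>\<exists>l. is_fun geq (\<lambda>x. ground True) l \<^bold>\<and>
              (\<^bold>\<forall>n. is_integral (app (set_eq geq) fN) (rval \<nu> n) (app geq l n)) \<^bold>\<and>
              converges (app geq l) (rof 0)) r"
    by (rule fimpD[OF fallD[OF cont] order_refl fN_continuous[OF r0]])
  then obtain s l where s: "s \<le> r" and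
      int: "\<forall>n. is_integral (app (set_eq geq) fN) (rval \<nu> n) (app geq l n) s" and
      conv: "converges (app geq l) (rof 0) s"
    unfolding fex_iff fand_iff fall_iff by (elim dns_obtain exE conjE) (rule that)
  have "dns s (\<lambda>r. \<exists>N. \<forall>n\<ge>N. rclose (app geq l n) (rof 0) (1/4) r)" by (rule convergesD[OF conv]) simp
  then obtain t n where t: "t \<le> s" and "\<forall>m\<ge>n. rclose (app geq l m) (rof 0) (1/4) t"
    by (elim dns_obtain exE) (rule that)
  then have ln: "rclose (app geq l n) (rof 0) (1/4) t" by blast
  have "dns s (\<lambda>r. \<exists>\<delta>>0. \<forall>c S. \<forall>q\<le>r. simple_approx (app (set_eq geq) fN) c S \<delta> q \<longrightarrow>
        rclose (rsum (\<lambda>i. rscale (c ! i) (rval \<nu> n (pnth S i))) (length c)) (app geq l n) (1/4) q)"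
    using int[rule_format, of n] unfolding is_integral_iff by simp
  from dns_le[OF this t] obtain x \<delta> where x: "x \<le> t" and \<delta>: "0 < \<delta>" and
    app: "\<forall>c S. \<forall>q\<le>x. simple_approx (app (set_eq geq) fN) c S \<delta> q \<longrightarrow>
        rclose (rsum (\<lambda>i. rscale (c ! i) (rval \<nu> n (pnth S i))) (length c)) (app geq l n) (1/4) q"
    by (elim dns_obtain exE conjE) (rule that)
  have xs: "x \<le> s" using x t order_trans by blast
  have xr: "x \<le> r" using xs s order_trans by blast
  have x0: "x \<le> p0" using xr r0 order_trans by blast
  obtain K0 where K0: "\<And>i. K0 \<le> i \<Longrightarrow> wt i < \<delta>" using wt_small[OF \<delta>] by blast
  \<comment> \<open>Beyond \<open>K0\<close> all weights are below the tolerance, which makes 0 an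
    admissible value on the remainder; the bound 8 ^ n puts all positive point masses into listed
    pieces.\<close>
  define K where "K = max K0 (8 ^ n)"
  have K: "\<And>i. K \<le> i \<Longrightarrow> wt i < \<delta>" and K8: "8 ^ n \<le> K" using K0 by (auto simp: K_def)
  obtain y D where yx: "y \<le> x" and D: "\<forall>i<K. dd i (D i) y"
    using dd_prefix[OF x0, of K] by (auto elim: dns_obtain)
  have y0: "y \<le> p0" and yr: "y \<le> r" using yx x0 xr order_trans by blast+
  define A where "A i = (if i < K then D i else - supn D K)" for i
  define c where "c = map wt [0..<K] @ [0]"
  have len: "length c = Suc K" and c1: "\<And>i. i < K \<Longrightarrow> c ! i = wt i" and c2: "c ! K = 0"
    by (auto simp: c_def nth_append)
  define S :: "('a, 'p) pseq" where "S = pseq (\<lambda>i u. fand (stone u) (mem geq (A i) u))"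
  have pm: "pmem u (pnth S i) = fand (stone u) (mem geq (A i) u)" for u i
    unfolding S_def by (rule pmem_pnth_pseq) (auto intro: stone_cong simp: set_eqD)
  have pe: "pset_eq (pnth S i) (clopen (A i)) q" for i q
    by (rule pset_eqI) (simp add: pm)
  have "simple_approx (app (set_eq geq) fN) c S \<delta> y"
    unfolding simple_approx_iff len pm fand_iff
  proof (intro conjI allI impI)
    fix i show "is_borel (pnth S i) y"
      by (rule is_borel_cong[OF eqv_sym[OF eqv_set_eq pe] is_borel_clopen])
  next
    fix i j assume ij: "i < j \<and> j < Suc K"
    have "inf (A i) (A j) = bot"
    proof (cases "j < K")
      case True
      then show ?thesis using ij dd_disj[OF y0, of i j "D i" "D j"] D by (simp add: A_def)
    next
      case False
      then have "A j = - supn D K" "A i = D i" using ij by (auto simp: A_def)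
      then show ?thesis using ij False supn_upper[of i K D] by (simp add: inf_shunt)
    qed
    then show "pdisj (pnth S i) (pnth S j) y" unfolding pdisj_iff pm fand_iff
      using stone_disj by blast
  next
    fix u :: "('a, 'p) point" and q assume q: "q \<le> y" "stone u q"
    have "dns q (\<lambda>r. \<forall>i\<in>{..<K}. dec (mem geq (D i) u) r)" by (rule dns_dec_finite) auto
    then show "dns q (\<lambda>t. \<exists>i<Suc K. stone u t \<and> mem geq (A i) u t)"
    proof (rule dns_mono)
      fix t assume t: "t \<le> q" "\<forall>i\<in>{..<K}. dec (mem geq (D i) u) t"
      have su: "stone u t" using regD[OF reg_stone q(2) t(1)] .
      show "\<exists>i<Suc K. stone u t \<and> mem geq (A i) u t"
      proof (cases "\<exists>i<K. mem geq (D i) u t")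
        case True
        then show ?thesis using su by (auto simp: A_def intro: less_SucI)
      next
        case False
        then have "\<forall>i<K. mem geq (- D i) u t" using t(2) stone_compl[OF su] unfolding dec_def by blast
        then have "mem geq (A K) u t" unfolding A_def using stone_compl_supn[OF su] by simp
        then show ?thesis using su by blast
      qed
    qed simp
  next
    fix i :: nat and u :: "('a, 'p) point" and q assume q: "q \<le> y" "i < Suc K \<and> stone u q \<and> mem geq (A i) u q"
    have q0: "q \<le> p0" using q(1) y0 order_trans by blast
    have Dq: "\<forall>i<K. dd i (D i) q" using D regD[OF dd_reg _ q(1)] by blast
    show "rle (rabs (rdiff (app (set_eq geq) fN u) (rof (c ! i)))) (rof \<delta>) q"
    proof (cases "i < K")
      case True
      then have "isq q (gval u) (wt i)" using gval_hit[OF q0, of u i "D i"] q(2) Dq by (simp add: A_def)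
      then have "isq q (app (set_eq geq) fN u) (wt i)" using req_trans app_fN q(2) by blast
      from isq_rle[OF isq_rabs[OF isq_rdiff[OF this req_refl, of "c ! i"]], of \<delta>]
      show ?thesis using c1[OF True] \<delta> by simp
    next
      case False
      then have i: "i = K" using q(2) by simp
      then have m: "mem geq (- supn D K) u q" and su: "stone u q" using q(2) by (auto simp: A_def)
      show ?thesis
      proof (rule reg_bind[OF reg_rle gval_le[OF q0 su K \<delta> Dq m]], assumption, elim exE conjE)
        fix z b assume z: "z \<le> q" "0 \<le> b" "b < \<delta>" "isq z (gval u) b"
        have "isq z (app (set_eq geq) fN u) b"
          using req_trans[OF app_fN[OF regD[OF reg_stone su z(1)]] z(4)] .
        from isq_rle[OF isq_rabs[OF isq_rdiff[OF this req_refl, of "c ! i"]], of \<delta>]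
        show "rle (rabs (rdiff (app (set_eq geq) fN u) (rof (c ! i)))) (rof \<delta>) z"
          using i c2 z by simp
      qed
    qed
  qed
  from app[rule_format, OF yx this]
  have close: "rclose (rsum (\<lambda>i. rscale (c ! i) (rval \<nu> n (pnth S i))) (Suc K)) (app geq l n) (1/4) y"
    unfolding len .
  have rad': "is_radon_seq (mus (\<lambda>n. 1 / 4 ^ n)) \<nu> y" by (rule regD[OF reg_is_radon_seq rad yr])
  define C where "C i = (if i < K then wt i * (1 / 4 ^ n * (if i < 8 ^ n then 1 else 0)) else 0)" for i
  have "isq y (rscale (c ! i) (rval \<nu> n (pnth S i))) (C i)" if "i < Suc K" for i
  proof (cases "i < K")
    case True
    have "pset_eq (pnth S i) (clopen (D i)) y" using pe[of i y] True by (simp add: A_def)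
    then have "isq y (rval \<nu> n (pnth S i)) (1 / 4 ^ n * (if i < 8 ^ n then 1 else 0))"
      using radon_clopen[OF rad' y0] D True by blast
    from isq_rscale[OF this, of "wt i"] show ?thesis unfolding C_def c1[OF True] using True by simp
  next
    case False
    then have "i = K" using that by simp
    \<comment> \<open>The coefficient 0 of the remainder annihilates its measure.\<close>
    then show ?thesis using c2 by (simp add: C_def rscale_def)
  qed
  then have sumq: "isq y (rsum (\<lambda>i. rscale (c ! i) (rval \<nu> n (pnth S i))) (Suc K)) (\<Sum>i<Suc K. C i)"
    by (rule isq_rsum)
  have "(\<Sum>i<Suc K. C i) = (\<Sum>i<8 ^ n. C i)"
    by (rule sum.mono_neutral_right) (use K8 in \<open>auto simp: C_def\<close>)
  also have "\<dots> = (\<Sum>i<8 ^ n. wt i * (1 / 4 ^ n))"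
    by (rule sum.cong) (use K8 in \<open>auto simp: C_def\<close>)
  finally have "1 \<le> (\<Sum>i<Suc K. C i)" using sum_wt[of n] by simp
  moreover have "is_real (app geq l n) y"
    using int[rule_format, of n] regD[OF reg_is_real _ order_trans[OF yx xs]] unfolding is_integral_iff by blast
  moreover have "rclose (app geq l n) (rof 0) (1/4) y"
    using regD[OF reg_rlt ln order_trans[OF yx x]] .
  ultimately show False using not_close_to_zero[OF sumq _ close] by blast
qed

text \<open>The union of the disjoint elements is a Borel set of V[G]. By countable additivity its
  measure is the limit of partial sums, and these equal 1 from 8 ^ n on: the points
  \<open>v i\<close> contribute 1 / 8 ^ n each, and no \<open>v' j\<close> lies in any of the
  elements.\<close>

lemma not_weakly_null:
  assumes p: "p \<le> p0" shows "\<not> weakly_null (mus (\<lambda>n. 1 / 8 ^ n)) p"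
proof
  assume "weakly_null (mus (\<lambda>n. 1 / 8 ^ n)) p"
  then obtain r \<nu> where r: "r \<le> p" and rad: "is_radon_seq (mus (\<lambda>n. 1 / 8 ^ n)) \<nu> r"
    and conv: "(\<^bold>\<forall>B. is_borel B \<^bold>\<longrightarrow> converges (\<lambda>n. rval \<nu> n B) (rof 0)) r"
    unfolding weakly_null_def fex_iff[of _ p] by (auto elim: dns_obtain)
  have r0: "r \<le> p0" using r p order_trans by blast
  define S where "S = pseq (\<lambda>i u. fand (stone u) (fex (\<lambda>a. fand (dd i a) (mem geq a u))))"
  have pm: "pmem u (pnth S i) = fand (stone u) (fex (\<lambda>a. fand (dd i a) (mem geq a u)))" for u i
    unfolding S_def
    by (rule pmem_pnth_pseq) (auto intro: stone_cong elim!: dns_mono dest: set_eqD)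
  \<comment> \<open>\<open>pnth S i\<close> names the \<open>i\<close>-th element before it is
    known; it becomes a clopen set of a ground element only at conditions that decide it.\<close>
  have pe: "pset_eq (pnth S i) (clopen a) q" if q: "q \<le> p0" "dd i a q" for i a q
  proof (rule pset_eqI)
    fix u s assume s: "s \<le> q"
    have "dns s (\<lambda>r. \<exists>b. dd i b r \<and> mem geq b u r) \<longleftrightarrow> mem geq a u s"
    proof
      assume "dns s (\<lambda>r. \<exists>b. dd i b r \<and> mem geq b u r)"
      then show "mem geq a u s"
      proof (rule reg_bind[OF reg_mem], elim exE conjE)
        fix r b assume rr: "r \<le> s" "dd i b r" "mem geq b u r"
        have "r \<le> q" using rr s order_trans by blast
        then have "a = b" using dd_uniq[OF order_trans[OF _ q(1)] regD[OF dd_reg q(2)] rr(2)] by blast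
        then show "mem geq a u r" using rr by simp
      qed
    next
      assume m: "mem geq a u s"
      have "dd i a r \<and> mem geq a u r" if "r \<le> s" for r
        using regD[OF dd_reg q(2) order_trans[OF that s]] regD[OF reg_mem m that] by blast
      then show "dns s (\<lambda>r. \<exists>b. dd i b r \<and> mem geq b u r)" by (intro dns_now) blast
    qed
    then show "pmem u (pnth S i) s = pmem u (clopen a) s" by (simp add: pm)
  qed
  have bor: "is_borel (pnth S i) r" for i
  proof (rule reg_bind[OF reg_is_borel dns_le[OF dd_ex r0, of i]], elim exE)
    fix s a assume s: "s \<le> r" "dd i a s"
    show "is_borel (pnth S i) s"
      by (rule is_borel_cong[OF eqv_sym[OF eqv_set_eq pe[OF order_trans[OF s(1) r0] s(2)]] is_borel_clopen])
  qed
  have disj: "pdisj (pnth S i) (pnth S j) r" if "i \<noteq> j" for i j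
    unfolding pdisj_iff
  proof (intro allI impI notI, elim conjE)
    fix u q assume q: "q \<le> r" and 1: "pmem u (pnth S i) q" and 2: "pmem u (pnth S j) q"
    obtain s a where s: "s \<le> q" "dd i a s" "mem geq a u s" using 1 unfolding pm by (auto elim: dns_obtain)
    have "dns q (\<lambda>r. \<exists>a. dd j a r \<and> mem geq a u r)" using 2 unfolding pm by simp
    from dns_le[OF this s(1)] obtain t b where t: "t \<le> s" "dd j b t" "mem geq b u t"
      by (auto elim: dns_obtain)
    have tq: "t \<le> q" using t s order_trans by blast
    then have t0: "t \<le> p0" using q r0 order_trans by metis
    have "inf a b = bot" using dd_disj[OF t0 that regD[OF dd_reg s(2) t(1)] t(2)] .
    moreover have "stone u q" using 1 unfolding pm by simp
    then have "stone u t" by (rule regD[OF reg_stone _ tq])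
    ultimately show False using stone_disj[OF _ regD[OF reg_mem s(3) t(1)]] t(3) by blast
  qed
  have borU: "is_borel (pUnion S) r" by (rule is_borel_pUnion) (rule bor)
  have "converges (\<lambda>n. rval \<nu> n (pUnion S)) (rof 0) r"
    by (rule fimpD[OF fallD[OF conv] order_refl borU])
  then have "dns r (\<lambda>r. \<exists>N. \<forall>n\<ge>N. rclose (rval \<nu> n (pUnion S)) (rof 0) (1/4) r)"
    by (rule convergesD) simp
  then obtain s n where s: "s \<le> r" and "\<forall>m\<ge>n. rclose (rval \<nu> m (pUnion S)) (rof 0) (1/4) s"
    by (elim dns_obtain exE) (rule that)
  then have n: "rclose (rval \<nu> n (pUnion S)) (rof 0) (1/4) s" by blast
  have "is_radon_extension (mval (mus (\<lambda>n. 1 / 8 ^ n)) n) (rval \<nu> n) r"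
    using rad unfolding is_radon_seq_def by simp
  then have "((\<^bold>\<forall>n. is_borel (pnth S n)) \<^bold>\<and>
             (\<^bold>\<forall>i j. ground (i \<noteq> j) \<^bold>\<longrightarrow> pdisj (pnth S i) (pnth S j))
          \<^bold>\<longrightarrow> converges (rsum (\<lambda>m. rval \<nu> n (pnth S m))) (rval \<nu> n (pUnion S))) r"
    unfolding is_radon_extension_def fand_iff[of _ _ r] fall_iff[of _ r] by blast
  then have "converges (rsum (\<lambda>m. rval \<nu> n (pnth S m))) (rval \<nu> n (pUnion S)) r"
    unfolding fimp_iff[of _ _ r] using bor disj
    by (simp add: fimp_ground)
  then have "dns r (\<lambda>t. \<exists>M. \<forall>m\<ge>M. rclose (rsum (\<lambda>m. rval \<nu> n (pnth S m)) m) (rval \<nu> n (pUnion S)) (1/4) t)"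
    by (rule convergesD) simp
  from dns_le[OF this s] obtain t M where t: "t \<le> s" and
    M: "\<forall>m\<ge>M. rclose (rsum (\<lambda>m. rval \<nu> n (pnth S m)) m) (rval \<nu> n (pUnion S)) (1/4) t"
    by (elim dns_obtain exE) (rule that)
  have t0: "t \<le> p0" using t s r0 order_trans by metis
  \<comment> \<open>Late enough both for the partial sum to be near its limit and for all point
    masses to be counted.\<close>
  define K where "K = max M (8 ^ n)"
  obtain y D where y: "y \<le> t" and D: "\<forall>i<K. dd i (D i) y"
    using dd_prefix[OF t0, of K] by (auto elim: dns_obtain)
  have y0: "y \<le> p0" and ys: "y \<le> s" using y t t0 order_trans by blast+
  have yr: "y \<le> r" using ys s order_trans by blast
  have rad': "is_radon_seq (mus (\<lambda>n. 1 / 8 ^ n)) \<nu> y" by (rule regD[OF reg_is_radon_seq rad yr])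
  have "isq y (rval \<nu> n (pnth S i)) (1 / 8 ^ n * (if i < 8 ^ n then 1 else 0))" if "i < K" for i
    using radon_clopen[OF rad' y0 _ pe[OF y0]] D that by blast
  then have sumq: "isq y (rsum (\<lambda>m. rval \<nu> n (pnth S m)) K) (\<Sum>i<K. 1 / 8 ^ n * (if i < 8 ^ n then 1 else 0))"
    by (rule isq_rsum)
  have "(\<Sum>i<K. 1 / 8 ^ n * (if i < 8 ^ n then 1 else 0)) = (\<Sum>i<(8::nat) ^ n. 1 / 8 ^ n * (if i < 8 ^ n then 1 else 0) :: rat)"
    by (rule sum.mono_neutral_right) (auto simp: K_def)
  also have "\<dots> = 1" by simp
  finally have one: "1 \<le> (\<Sum>i<K. 1 / 8 ^ n * (if i < 8 ^ n then 1 else 0) :: rat)" by simp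
  have "is_real (rval \<nu> n (pUnion S)) r"
    using rad borU unfolding is_radon_seq_def fand_iff
    by (intro app_real[where D = "\<lambda>x. is_borel (snd x)"]) simp_all
  moreover have "rclose (rsum (\<lambda>m. rval \<nu> n (pnth S m)) K) (rval \<nu> n (pUnion S)) (1/4) y"
    by (rule regD[OF reg_rlt _ y]) (use M in \<open>simp add: K_def\<close>)
  ultimately show False
    using not_close_to_zero[OF sumq regD[OF reg_is_real _ yr] _ regD[OF reg_rlt n ys] one] by blast
qed

end

section \<open>Compactness of the Stone space in the extension\<close>

lemma is_continuousD:
  assumes "is_continuous f p" "q \<le> p" "stone u q" "0 < \<epsilon>"
  shows "dns q (\<lambda>r. \<exists>a. mem geq a u r \<and> (\<forall>w. \<forall>s\<le>r. stone w s \<and> mem geq a w s \<longrightarrow>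
     rclose (app (set_eq geq) f w) (app (set_eq geq) f u) \<epsilon> s))"
  using assms unfolding is_continuous_def fand_iff fall_iff fimp_iff fex_iff ground_iff
  by (elim conjE) blast

text \<open>Otherwise, below some \<open>q\<close>, no condition admits a finite cover of the space
  by elements on which \<open>F\<close> is nearly constant. The elements covered by finitely many
  such elements form ideals, and a named ultrafilter avoiding them is a point \<open>u\<close> of
  V[G]. Continuity at \<open>u\<close> gives an element of \<open>u\<close> on which
  \<open>F\<close> is nearly constant, a contradiction.\<close>

lemma compact_cover:
  fixes f :: "(('a::boolean_algebra, 'p::preorder) point \<times> 'p rname, 'p) name"
  assumes nontriv: "(bot :: 'a) \<noteq> top" and cont: "is_continuous f p" and \<epsilon>: "0 < \<epsilon>"
  shows "dns p (\<lambda>r. \<exists>m A c. supn A m = top \<and> (\<forall>j<m. \<forall>u. \<forall>s\<le>r. stone u s \<longrightarrow> mem geq (A j) u s \<longrightarrow>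
     rclose (app (set_eq geq) f u) (rof (c j)) \<epsilon> s))"
proof (rule ccontr)
  define F where "F = app (set_eq geq) f"
  define sm where "sm r a c \<longleftrightarrow> (\<forall>u. \<forall>s\<le>r. stone u s \<longrightarrow> mem geq a u s \<longrightarrow> rclose (F u) (rof c) \<epsilon> s)" for r a c
  have sm_le: "sm r a c \<Longrightarrow> s \<le> r \<Longrightarrow> sm s a c" for r s a c
    unfolding sm_def using order_trans by blast
  assume "\<not> ?thesis"
  then obtain q where q: "q \<le> p" and no: "\<And>r m A c. r \<le> q \<Longrightarrow> supn A m = top \<Longrightarrow> \<not> (\<forall>j<m. sm r (A j) (c j))"
    unfolding dns_def sm_def F_def by blast
  \<comment> \<open>The ideal is trivial at conditions not below \<open>q\<close>, where nothing is
    known about covers; the disjunct \<open>a = bot\<close> makes \<open>bot\<close> null there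
    too.\<close>
  define null where "null r a \<longleftrightarrow> a = bot \<or> r \<le> q \<and> (\<exists>m A c. (\<forall>j<m. sm r (A j) (c j)) \<and> a \<le> supn A m)" for r a
  obtain H where H: "\<And>p q a. H p a \<Longrightarrow> q \<le> p \<Longrightarrow> H q a" "\<And>p. H p top" "\<And>p. \<not> H p bot"
    "\<And>p a b. H p a \<Longrightarrow> a \<le> b \<Longrightarrow> H p b" "\<And>p a b. H p a \<Longrightarrow> H p b \<Longrightarrow> H p (inf a b)"
    "\<And>p a. H p a \<Longrightarrow> \<not> null p a" "\<And>p a. \<exists>q. q \<le> p \<and> (H q a \<or> H q (- a))"
  proof (rule generic_ultrafilter[of "(\<le>) :: 'p \<Rightarrow> 'p \<Rightarrow> bool" null])
    show "p \<le> p" for p :: 'p by (rule order_refl)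
    show "x \<le> y \<Longrightarrow> y \<le> z \<Longrightarrow> x \<le> z" for x y z :: 'p by (rule order_trans)
    show "null y a" if "null x a" "y \<le> x" for x y a
    proof -
      have "sm y b c" if "sm x b c" for b c using sm_le[OF that \<open>y \<le> x\<close>] .
      then show ?thesis using that(1) order_trans[OF that(2), of q] unfolding null_def by blast
    qed
    show "null x b" if "null x a" "b \<le> a" for x a b
      using that(1) bot_unique[of b] that(2) order_trans[OF that(2)] unfolding null_def by blast
    show "null p bot" for p unfolding null_def by simp
    show "\<not> null p top" for p unfolding null_def using nontriv no by (metis top_unique)
    show "null p (sup a b)" if ab: "null p a" "null p b" for p a b
    proof (cases "a = bot \<or> b = bot")
      case True
      then show ?thesis using ab by auto
    next
      case False
      then obtain m A c m' A' c' where *: "p \<le> q" "\<forall>j<m. sm p (A j) (c j)" "a \<le> supn A m"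
        "\<forall>j<m'. sm p (A' j) (c' j)" "b \<le> supn A' m'" using ab unfolding null_def by blast
      have "\<forall>j<m + m'. sm p (if j < m then A j else A' (j - m)) (if j < m then c j else c' (j - m))"
        using *(2,4) by auto
      moreover have "sup a b \<le> supn (\<lambda>j. if j < m then A j else A' (j - m)) (m + m')"
        unfolding supn_append using *(3,5) by (rule sup_mono)
      ultimately have "\<exists>m A c. (\<forall>j<m. sm p (A j) (c j)) \<and> sup a b \<le> supn A m"
        by (intro exI[of _ "m + m'"] exI[of _ "\<lambda>j. if j < m then A j else A' (j - m)"]
            exI[of _ "\<lambda>j. if j < m then c j else c' (j - m)"] conjI)
      then show ?thesis unfolding null_def using *(1) by blast
    qed
  qed (rule that)
  define u where "u = compr (\<lambda>a p. dns p (\<lambda>r. H r a))"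
  have mu: "mem geq a u p \<longleftrightarrow> dns p (\<lambda>r. H r a)" for a p unfolding u_def by simp
  have "stone u q"
    unfolding stone_iff mu fnot_iff
  proof (intro conjI allI impI)
    show "dns q (\<lambda>r. H r top)" using H(2) by (intro dns_now)
    show "\<not> dns r (\<lambda>r. H r bot)" for r using H(3) by (auto elim: dns_obtain)
    show "dns r (\<lambda>r. H r b)" if "dns r (\<lambda>r. H r a)" "a \<le> b" for r a b
      by (rule dns_mono[OF that(1) order_refl]) (rule H(4)[OF _ that(2)])
    show "dns r (\<lambda>r. H r (inf a b))" if ab: "dns r (\<lambda>r. H r a)" "dns r (\<lambda>r. H r b)" for r a b
    proof (rule dns_bind[OF ab(1)])
      fix s assume s: "s \<le> r" "H s a"
      show "dns s (\<lambda>r. H r (inf a b))"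
        by (rule dns_mono[OF ab(2) s(1)]) (rule H(5)[OF H(1)[OF s(2)]])
    qed
    show "dns q (\<lambda>r. dns r (\<lambda>r. H r a) \<or> dns r (\<lambda>r. H r (- a)))" for a
      unfolding dns_def[of q]
    proof (intro allI impI)
      fix r obtain s where s: "s \<le> r" "H s a \<or> H s (- a)" using H(7) by blast
      have "dns s (\<lambda>r. H r b)" if "H s b" for b using H(1)[OF that] by (rule dns_now)
      then show "\<exists>s\<le>r. dns s (\<lambda>r. H r a) \<or> dns s (\<lambda>r. H r (- a))" using s by blast
    qed
  qed
  have fn: "is_fun (set_eq geq) stone f p" using cont unfolding is_continuous_def by simp
  then have fn: "is_fun (set_eq geq) stone f q" using q by (rule regD[rotated]) simp
  have real: "is_real (F w) s" if "s \<le> q" "stone w s" for w s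
  proof -
    have "is_fun (set_eq geq) stone f s" by (rule regD[OF reg_is_fun[OF eqv_set_eq reg_stone] fn that(1)])
    then show ?thesis unfolding F_def using that(2) by (rule app_real)
  qed
  have "dns q (\<lambda>r. \<exists>a. mem geq a u r \<and> (\<forall>w. \<forall>s\<le>r. stone w s \<and> mem geq a w s \<longrightarrow> rclose (F w) (F u) (\<epsilon> / 2) s))"
    unfolding F_def by (rule is_continuousD[OF cont q \<open>stone u q\<close>]) (use \<epsilon> in simp)
  then obtain r a where r: "r \<le> q" and ra: "mem geq a u r" and
    cl: "\<forall>w. \<forall>s\<le>r. stone w s \<and> mem geq a w s \<longrightarrow> rclose (F w) (F u) (\<epsilon> / 2) s"
    by (elim dns_obtain exE conjE) (rule that)
  have ru: "stone u r" using regD[OF reg_stone \<open>stone u q\<close> r] .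
  obtain s c where s: "s \<le> r" and c: "near s (F u) c (\<epsilon> / 4)"
    using real_near[OF real[OF r ru], of "\<epsilon> / 4"] \<epsilon> by (auto elim: dns_obtain)
  have "sm s a c" unfolding sm_def
  proof (intro allI impI)
    fix w t assume t: "t \<le> s" "stone w t" "mem geq a w t"
    have tr: "t \<le> r" using t s order_trans by blast
    have tq: "t \<le> q" using tr r order_trans by blast
    \<comment> \<open>Error budget: \<open>\<epsilon>\<close>/2 from continuity,
      \<open>\<epsilon>\<close>/4 from the approximation \<open>c\<close>, and three times
      \<open>\<epsilon>\<close>/16 from the finer approximations; 15/16 in all.\<close>
    have "dns t (\<lambda>x. \<exists>c1 c2. near x (F w) c1 (\<epsilon> / 16) \<and> near x (F u) c2 (\<epsilon> / 16) \<and> \<bar>c1 - c2\<bar> < \<epsilon> / 2)"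
      using real[OF tq t(2)] real[OF tq regD[OF reg_stone ru tr]] cl t tr \<epsilon> by (intro rclose_near) auto
    then show "rclose (F w) (rof c) \<epsilon> t"
    proof (rule reg_bind[OF reg_rlt], elim exE conjE)
      fix x c1 c2 assume x: "x \<le> t" "near x (F w) c1 (\<epsilon> / 16)" "near x (F u) c2 (\<epsilon> / 16)" "\<bar>c1 - c2\<bar> < \<epsilon> / 2"
      have "near x (F u) c (\<epsilon> / 4)" using near_le[OF c order_trans[OF x(1) t(1)]] .
      then have "\<bar>c2 - c\<bar> < \<epsilon> / 16 + \<epsilon> / 4" using near_unique x(3) by blast
      then have "\<bar>c1 - c\<bar> + \<epsilon> / 16 + \<epsilon> / 16 \<le> \<epsilon>" using x(4) by linarith
      moreover have "near x (rof c) c (\<epsilon> / 16)" by (rule isq_near[OF req_refl]) (use \<epsilon> in simp)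
      ultimately show "rclose (F w) (rof c) \<epsilon> x" using near_rclose[OF x(2)] by blast
    qed
  qed
  have "dns r (\<lambda>r. H r a)" using ra mu by blast
  from dns_le[OF this s] obtain t where t: "t \<le> s" "H t a" by (rule dns_obtain)
  have "t \<le> q" using t s r order_trans by metis
  moreover have "sm t a c" using sm_le[OF \<open>sm s a c\<close> t(1)] .
  moreover have "a \<le> supn (\<lambda>_. a) 1" by simp
  ultimately have "null t a" unfolding null_def by (intro disjI2 conjI exI[of _ 1] exI[of _ "\<lambda>_. a"] exI[of _ "\<lambda>_. c"]) auto
  then show False using H(6)[OF t(2)] by blast
qed

text \<open>For a point known either to lie in one of the first \<open>M\<close> sets or to miss the
  union, countable additivity of its Dirac measure is a finite sum with at most one nonzero
  term.\<close>

lemma tv_pUnion: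
  assumes disj: "\<And>i j. i \<noteq> j \<Longrightarrow> pdisj (pnth S i) (pnth S j) r"
    and u: "(\<exists>m<M. pmem u (pnth S m) r) \<or> fnot (pmem u (pUnion S)) r" and "M \<le> K"
  shows "dec (pmem u (pnth S m)) r" "dec (pmem u (pUnion S)) r"
    "(\<Sum>m<K. tv (pmem u (pnth S m)) r) = tv (pmem u (pUnion S)) r"
proof -
  have sub: "pmem u (pUnion S) q" if "pmem u (pnth S m) q" for m q
    unfolding pmem_pUnion using regD[OF reg_mem that] by (intro dns_now) blast
  have "(\<forall>m. dec (pmem u (pnth S m)) r) \<and> dec (pmem u (pUnion S)) r \<and>
    (\<Sum>m<K. tv (pmem u (pnth S m)) r) = tv (pmem u (pUnion S)) r"
    using u
  proof (elim disjE exE conjE)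
    fix m assume m: "m < M" "pmem u (pnth S m) r"
    have n: "fnot (pmem u (pnth S j)) r" if "j \<noteq> m" for j
      using disj[OF that] regD[OF reg_mem m(2)] unfolding pdisj_iff fnot_iff by blast
    have "tv (pmem u (pnth S j)) r = (if j = m then 1 else 0)" for j
      using n[of j] m(2) fnotD unfolding tv_def by auto
    moreover have "dec (pmem u (pnth S j)) r" for j using n[of j] m(2) unfolding dec_def by (cases "j = m") auto
    ultimately show ?thesis using sub[OF m(2)] m(1) assms(3) by (simp add: dec_def tv_def)
  next
    assume n: "fnot (pmem u (pUnion S)) r"
    then have "fnot (pmem u (pnth S m)) r" for m using sub unfolding fnot_iff by blast
    then have "\<not> pmem u (pnth S m) r" "dec (pmem u (pnth S m)) r" for m
      unfolding dec_def by (auto simp: fnot_iff)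
    then show ?thesis using n fnotD by (auto simp: dec_def tv_def)
  qed
  then show "dec (pmem u (pnth S m)) r" "dec (pmem u (pUnion S)) r"
    "(\<Sum>m<K. tv (pmem u (pnth S m)) r) = tv (pmem u (pUnion S)) r" by blast+
qed

text \<open>Names forced to differ have, at a stronger condition, a ground element that is forced
  into one and not into the other. Deciding it for the latter point, the element or its complement
  separates the two.\<close>

lemma stone_separate:
  assumes "stone u q" "stone w q" "fnot (set_eq geq u w) q"
  shows "dns q (\<lambda>r. \<exists>a. mem geq a u r \<and> mem geq (- a) w r)"
  unfolding dns_def
proof (intro allI impI)
  fix r assume r: "r \<le> q"
  have st: "stone u s" "stone w s" if "s \<le> r" for s
    using regD[OF reg_stone assms(1)] regD[OF reg_stone assms(2)] order_trans[OF that r] by blast+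
  have "\<not> set_eq geq u w r" using assms(3) r unfolding fnot_iff by blast
  then obtain a s where s: "s \<le> r" "mem geq a u s \<noteq> mem geq a w s" unfolding set_eq_iff' by blast
  have *: "\<exists>t\<le>s. mem geq (- a) y t" if "stone y s" "\<not> mem geq a y s" for y
  proof (rule ccontr)
    assume n: "\<not> ?thesis"
    have "mem geq a y s" by (rule reg_bind[OF reg_mem stone_decide[OF that(1), of a]]) (use n in blast)
    then show False using that by blast
  qed
  show "\<exists>s\<le>r. \<exists>a. mem geq a u s \<and> mem geq (- a) w s"
  proof (cases "mem geq a u s")
    case True
    then obtain t where t: "t \<le> s" "mem geq (- a) w t" using s * st by blast
    then have "mem geq a u t" "t \<le> r" using regD[OF reg_mem True] order_trans[OF _ s(1)] by blast+
    then show ?thesis using t by blast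
  next
    case False
    then obtain t where t: "t \<le> s" "mem geq (- a) u t" using s * st by blast
    moreover have "mem geq a w s" using False s by blast
    ultimately have "mem geq (- (- a)) w t" "t \<le> r" using regD[OF reg_mem] order_trans[OF _ s(1)] by auto
    then show ?thesis using t by blast
  qed
qed

section \<open>The Radon extensions of the measures\<close>

context point_pairs
begin

text \<open>The same combination of Dirac measures, evaluated at Borel sets of V[G]. It will witness
  the existential quantifier over Radon sequences in \<open>weak_star_null\<close>.\<close>

definition nus :: "(nat \<Rightarrow> rat) \<Rightarrow> ('a, 'p) rseq" where
  "nus k = fname (\<lambda>x. is_borel (snd x)) (\<lambda>x. dsum (k (fst x)) (8 ^ fst x) (inset v (snd x)) (inset v' (snd x)))"

lemma nus_cong:
  assumes "prod_eq geq pset_eq x y p"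
  shows "req (dsum (k (fst x)) (8 ^ fst x) (inset v (snd x)) (inset v' (snd x)))
    (dsum (k (fst y)) (8 ^ fst y) (inset v (snd y)) (inset v' (snd y))) p"
proof -
  have "fst x = fst y" "pset_eq (snd x) (snd y) p" using assms by (auto simp: prod_eq_def geq_def)
  then show ?thesis by (auto intro!: dsum_cong simp: set_eqD)
qed

lemma borel_snd_cong: "prod_eq geq pset_eq x y p \<Longrightarrow> is_borel (snd y) p \<Longrightarrow> is_borel (snd x) p"
  unfolding prod_eq_def fand_iff using is_borel_cong eqv_sym[OF eqv_set_eq] by blast

lemma nus_val:
  assumes "is_borel B p"
  shows "req (rval (nus k) n B) (dsum (k n) (8 ^ n) (inset v B) (inset v' B)) p"
proof -
  have "req (rval (nus k) n B) (dsum (k (fst (n, B))) (8 ^ fst (n, B)) (inset v (snd (n, B))) (inset v' (snd (n, B)))) p"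
    unfolding nus_def by (rule app_fname) (use assms nus_cong borel_snd_cong in auto)
  then show ?thesis by simp
qed

lemma nus_isq:
  assumes "is_borel B r" "decs (8 ^ n) (inset v B) (inset v' B) r"
  shows "isq r (rval (nus k) n B) (k n * dval (8 ^ n) (inset v B) (inset v' B) r)"
  using nus_val[OF assms(1)] isq_dsum[OF reg_mem reg_mem assms(2)] req_trans by blast

lemma nus_fun: "is_fun (prod_eq geq pset_eq) (\<lambda>x. is_borel (snd x)) (nus k) p"
  unfolding nus_def by (rule is_fun_fname) (auto intro: is_real_dsum nus_cong borel_snd_cong)

text \<open>Each of the finitely many points enters the disjoint sets at some index or never. Past a
  common index the partial sums are constant and equal to the value at the union.\<close>

lemma nus_sigma_additive:
  assumes bor: "\<And>m. is_borel (pnth S m) p" and disj: "\<And>i j. i \<noteq> j \<Longrightarrow> pdisj (pnth S i) (pnth S j) p"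
  shows "converges (rsum (\<lambda>m. rval (nus k) n (pnth S m))) (rval (nus k) n (pUnion S)) p"
proof (rule convergesI)
  fix \<epsilon> :: rat assume \<epsilon>: "0 < \<epsilon>"
  define Q where "Q u M r \<longleftrightarrow> (\<exists>m<M. pmem u (pnth S m) r) \<or> fnot (pmem u (pUnion S)) r" for u and M :: nat and r
  have Q_le: "Q u M r \<Longrightarrow> s \<le> r \<Longrightarrow> M \<le> M' \<Longrightarrow> Q u M' s" for u M M' r s
    unfolding Q_def using regD[OF reg_mem] fnot_le by (meson less_le_trans)
  have Q_dns: "dns q (\<lambda>r. \<exists>M. Q u M r)" for u q
  proof (rule dns_bind[OF decide[of q "pmem u (pUnion S)"]], elim disjE)
    fix r assume "pmem u (pUnion S) r"
    then show "dns r (\<lambda>r. \<exists>M. Q u M r)" unfolding pmem_pUnion Q_def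
      by (rule dns_mono) auto
  next
    fix r assume "fnot (pmem u (pUnion S)) r"
    then show "dns r (\<lambda>r. \<exists>M. Q u M r)" unfolding Q_def by (intro dns_now) (auto intro: fnot_le)
  qed
  have "dns p (\<lambda>r. \<forall>i\<in>{..<8 ^ n}. \<exists>M. Q (v i) M r \<and> Q (v' i) M r)"
  proof (rule dns_ball_finite)
    fix i
    show "dns p (\<lambda>r. \<exists>M. Q (v i) M r \<and> Q (v' i) M r)"
    proof (rule dns_bind[OF Q_dns[of p "v i"]], elim exE)
      fix r M assume M: "Q (v i) M r"
      show "dns r (\<lambda>r. \<exists>M. Q (v i) M r \<and> Q (v' i) M r)"
      proof (rule dns_mono[OF Q_dns[of r "v' i"] order_refl], elim exE)
        fix s M' assume "s \<le> r" "Q (v' i) M' s"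
        then have "Q (v i) (max M M') s" "Q (v' i) (max M M') s"
          using Q_le[OF M] Q_le[of "v' i" M' s s] by auto
        then show "\<exists>M. Q (v i) M s \<and> Q (v' i) M s" by blast
      qed
    qed
  next
    fix i q r assume "\<exists>M. Q (v i) M q \<and> Q (v' i) M q" "r \<le> q"
    then show "\<exists>M. Q (v i) M r \<and> Q (v' i) M r" using Q_le by blast
  qed simp
  then show "dns p (\<lambda>r. \<exists>N. \<forall>K\<ge>N. rclose (rsum (\<lambda>m. rval (nus k) n (pnth S m)) K) (rval (nus k) n (pUnion S)) \<epsilon> r)"
  proof (rule dns_mono)
    fix r assume r: "r \<le> p" "\<forall>i\<in>{..<8 ^ n}. \<exists>M. Q (v i) M r \<and> Q (v' i) M r"
    from bchoice[OF r(2)] obtain g where g: "\<And>i. i < 8 ^ n \<Longrightarrow> Q (v i) (g i) r \<and> Q (v' i) (g i) r" by auto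
    define N where "N = (\<Sum>i<8 ^ n. g i)"
    have N: "Q (v i) N r" "Q (v' i) N r" if "i < 8 ^ n" for i
    proof -
      have "g i \<le> N" unfolding N_def using that by (intro member_le_sum) auto
      then show "Q (v i) N r" "Q (v' i) N r" using g[OF that] Q_le[OF _ order_refl] by blast+
    qed
    have d: "pdisj (pnth S i) (pnth S j) r" if "i \<noteq> j" for i j using regD[OF reg_pdisj disj[OF that] r(1)] .
    have b: "is_borel (pnth S m) r" for m using regD[OF reg_is_borel bor r(1)] .
    have "rclose (rsum (\<lambda>m. rval (nus k) n (pnth S m)) K) (rval (nus k) n (pUnion S)) \<epsilon> r" if K: "N \<le> K" for K
    proof -
      note tp = tv_pUnion[of S r, OF d _ K]
      have dec: "decs (8 ^ n) (inset v (pnth S m)) (inset v' (pnth S m)) r" for m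
        unfolding decs_def using tp(1) N unfolding Q_def by blast
      have decU: "decs (8 ^ n) (inset v (pUnion S)) (inset v' (pUnion S)) r"
        unfolding decs_def using tp(2) N unfolding Q_def by blast
      have "isq r (rsum (\<lambda>m. rval (nus k) n (pnth S m)) K)
          (\<Sum>m<K. k n * dval (8 ^ n) (inset v (pnth S m)) (inset v' (pnth S m)) r)"
        by (intro isq_rsum nus_isq b dec)
      moreover have "(\<Sum>m<K. k n * dval (8 ^ n) (inset v (pnth S m)) (inset v' (pnth S m)) r) =
          k n * dval (8 ^ n) (inset v (pUnion S)) (inset v' (pUnion S)) r"
      proof -
        have "(\<Sum>m<K. dval (8 ^ n) (inset v (pnth S m)) (inset v' (pnth S m)) r) =
          (\<Sum>i<8 ^ n. (\<Sum>m<K. tv (pmem (v i) (pnth S m)) r) - (\<Sum>m<K. tv (pmem (v' i) (pnth S m)) r))"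
          unfolding dval_def sum_subtractf[symmetric] by (rule sum.swap)
        also have "\<dots> = dval (8 ^ n) (inset v (pUnion S)) (inset v' (pUnion S)) r"
          unfolding dval_def
        proof (rule sum.cong)
          fix i assume "i \<in> {..<(8::nat) ^ n}"
          then have "Q (v i) N r" "Q (v' i) N r" using N by auto
          then show "(\<Sum>m<K. tv (pmem (v i) (pnth S m)) r) - (\<Sum>m<K. tv (pmem (v' i) (pnth S m)) r) =
             tv (pmem (v i) (pUnion S)) r - tv (pmem (v' i) (pUnion S)) r"
            using tp(3) unfolding Q_def by metis
        qed simp
        finally show ?thesis by (simp flip: sum_distrib_left)
      qed
      moreover have "isq r (rval (nus k) n (pUnion S)) (k n * dval (8 ^ n) (inset v (pUnion S)) (inset v' (pUnion S)) r)"
        by (intro nus_isq is_borel_pUnion b decU)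
      ultimately show ?thesis using \<epsilon> by (intro isq_rclose) auto
    qed
    then show "\<exists>N. \<forall>K\<ge>N. rclose (rsum (\<lambda>m. rval (nus k) n (pnth S m)) K) (rval (nus k) n (pUnion S)) \<epsilon> r" by blast
  qed simp
qed

text \<open>The measure is carried by a finite set \<open>W\<close> of points. The points of
  \<open>W\<close> in \<open>B\<close> form a closed set \<open>K\<close>, and a subset of
  \<open>B\<close> disjoint from \<open>K\<close> contains no point of \<open>W\<close>, hence has
  measure 0.\<close>

lemma nus_regular:
  assumes p: "p \<le> p0" and bor: "is_borel B p" and \<epsilon>: "0 < \<epsilon>"
  shows "\<exists>K. is_closed K p \<and> psub K B p \<and>
    (\<forall>C. \<forall>q\<le>p. is_borel C q \<longrightarrow> psub C B q \<longrightarrow> pdisj C K q \<longrightarrow> rlt (rabs (rval (nus k) n C)) (rof \<epsilon>) q)"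
proof -
  define W where "W = v ` {..<8 ^ n} \<union> v' ` {..<8 ^ n}"
  have W: "finite W" "\<And>w q. w \<in> W \<Longrightarrow> q \<le> p \<Longrightarrow> stone w q"
    unfolding W_def using st_le st'_le order_trans[OF _ p] by auto
  define K where "K = compr (\<lambda>u r. pmem u B r \<and> dns r (\<lambda>s. \<exists>w\<in>W. set_eq geq u w s))"
  have pK: "pmem u K r \<longleftrightarrow> pmem u B r \<and> dns r (\<lambda>s. \<exists>w\<in>W. set_eq geq u w s)" for u r
  proof -
    have "pmem u K = (\<lambda>r. pmem u B r \<and> dns r (\<lambda>s. \<exists>w\<in>W. set_eq geq u w s))" unfolding K_def
    proof (rule pmem_compr)
      fix u w r assume *: "set_eq geq u w r" "pmem w B r \<and> dns r (\<lambda>s. \<exists>x\<in>W. set_eq geq w x s)"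
      have "dns r (\<lambda>s. \<exists>x\<in>W. set_eq geq u x s)"
      proof (rule dns_mono[OF conjunct2[OF *(2)] order_refl])
        fix s assume s: "s \<le> r" "\<exists>x\<in>W. set_eq geq w x s"
        have "set_eq geq u w s" using regD[OF reg_set_eq *(1) s(1)] .
        then show "\<exists>x\<in>W. set_eq geq u x s" using s(2) eqv_trans[OF eqv_set_eq] by blast
      qed
      then show "pmem u B r \<and> dns r (\<lambda>s. \<exists>x\<in>W. set_eq geq u x s)" using pmem_cong *(1,2) by blast
    qed (intro reg_conj reg_mem reg_dnsI)
    then show ?thesis by simp
  qed
  have "psub K B p" unfolding psub_iff pK by blast
  moreover have "is_closed K p"
    unfolding is_closed_def fand_iff
  proof
    show "psub K stone_space p" unfolding psub_iff pK pmem_stone_space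
    proof (intro allI impI, elim conjE)
      fix u q assume q: "q \<le> p" "dns q (\<lambda>s. \<exists>w\<in>W. set_eq geq u w s)"
      show "stone u q"
        by (rule reg_bind[OF reg_stone q(2)]) (use W(2) stone_cong order_trans[OF _ q(1)] in blast)
    qed
    show "is_open (pcompl K) p" unfolding is_open_iff
    proof (intro conjI allI impI)
      show "psub (pcompl K) stone_space p" unfolding psub_iff by simp
    next
      fix u q assume q: "q \<le> p" "pmem u (pcompl K) q"
      then have su: "stone u q" and nK: "fnot (pmem u K) q" by auto
      \<comment> \<open>To be separated from \<open>u\<close> are those \<open>w\<close> that lie in
        \<open>B\<close>; a \<open>w\<close> equal to \<open>u\<close> is not in \<open>B\<close>,
        since \<open>u\<close> is outside \<open>K\<close>. Intersecting over the finite
        \<open>W\<close> gives a clopen neighbourhood of \<open>u\<close> that misses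
        \<open>K\<close>.\<close>
      let ?P = "\<lambda>w r. \<exists>a. mem geq a u r \<and> (fnot (pmem w B) r \<or> mem geq (- a) w r)"
      have "dns q (\<lambda>r. \<forall>w\<in>W. ?P w r)"
      proof (rule dns_ball_finite[OF W(1)])
        fix w assume w: "w \<in> W"
        show "dns q (?P w)"
        proof (rule dns_bind[OF decide[of q "set_eq geq u w"]], elim disjE)
          fix r assume r: "r \<le> q" "set_eq geq u w r"
          have "fnot (pmem w B) s" if s: "s \<le> r" for s unfolding fnot_iff
          proof (intro allI impI notI)
            fix t assume t: "t \<le> s" "pmem w B t"
            have tr: "t \<le> r" using t s order_trans by blast
            have e: "set_eq geq u w x" if "x \<le> t" for x
              using regD[OF reg_set_eq r(2) order_trans[OF that tr]] .
            have "pmem u B t" using pmem_cong[OF e[OF order_refl] t(2)] .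
            moreover have "dns t (\<lambda>s. \<exists>w\<in>W. set_eq geq u w s)" using e w by (intro dns_now) blast
            ultimately show False using nK pK order_trans[OF tr r(1)] unfolding fnot_iff by blast
          qed
          moreover have "mem geq top u s" if "s \<le> r" for s
            using stone_top[OF regD[OF reg_stone su order_trans[OF that r(1)]]] .
          ultimately show "dns r (?P w)" by (intro dns_now) blast
        next
          fix r assume r: "r \<le> q" "fnot (set_eq geq u w) r"
          have "dns r (\<lambda>r. \<exists>a. mem geq a u r \<and> mem geq (- a) w r)"
            using regD[OF reg_stone su r(1)] W(2)[OF w order_trans[OF r(1) q(1)]] r(2) by (rule stone_separate)
          then show "dns r (?P w)" by (rule dns_mono) auto
        qed
      next
        fix w r s assume "?P w r" and s: "s \<le> r"
        then obtain a where a: "mem geq a u r" "fnot (pmem w B) r \<or> mem geq (- a) w r" by blast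
        have "fnot (pmem w B) s \<or> mem geq (- a) w s"
          using a(2) fnot_le[OF _ s] regD[OF reg_mem _ s, of geq "- a" w] by blast
        then show "?P w s" using regD[OF reg_mem a(1) s] by blast
      qed
      then show "dns q (\<lambda>r. \<exists>a. mem geq a u r \<and> psub (clopen a) (pcompl K) r)"
      proof (rule dns_mono)
        fix r assume r: "r \<le> q" "\<forall>w\<in>W. ?P w r"
        have su: "stone u r" using regD[OF reg_stone su r(1)] .
        have "\<exists>a. mem geq a u r \<and> (\<forall>w\<in>F. fnot (pmem w B) r \<or> mem geq (- a) w r)" if "finite F" "F \<subseteq> W" for F
          using that
        proof (induction F rule: finite_induct)
          case empty
          then show ?case using stone_top[OF su] by blast
        next
          case (insert w F)
          then obtain a where a: "mem geq a u r" "\<forall>w\<in>F. fnot (pmem w B) r \<or> mem geq (- a) w r" by auto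
          obtain b where b: "mem geq b u r" "fnot (pmem w B) r \<or> mem geq (- b) w r" using r(2) insert.prems by blast
          have "mem geq (- inf a b) x r" if "x \<in> W" "mem geq (- a) x r \<or> mem geq (- b) x r" for x
            using that stone_up[OF W(2)[OF that(1) order_trans[OF r(1) q(1)]]] by (metis compl_inf sup_ge1 sup_ge2)
          then have "\<forall>x\<in>insert w F. fnot (pmem x B) r \<or> mem geq (- inf a b) x r"
            using a(2) b(2) insert.prems by blast
          then show ?case using stone_inf[OF su a(1) b(1)] by blast
        qed
        then obtain a where a: "mem geq a u r" "\<forall>w\<in>W. fnot (pmem w B) r \<or> mem geq (- a) w r" using W(1) by blast
        have "psub (clopen a) (pcompl K) r"
          unfolding psub_iff pmem_clopen pmem_pcompl fand_iff fnot_iff[of "pmem _ K"]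
        proof (intro allI impI conjI notI, elim conjE, assumption)
          fix x s t assume s: "s \<le> r" "stone x s \<and> mem geq a x s" and t: "t \<le> s" "pmem x K t"
          obtain y w where y: "y \<le> t" "w \<in> W" "set_eq geq x w y" using t(2) unfolding pK by (auto elim: dns_obtain)
          have yr: "y \<le> r" "y \<le> s" using y t s order_trans by metis+
          have "pmem x B t" using t(2) unfolding pK by blast
          then have "pmem x B y" by (rule regD[OF reg_mem _ y(1)])
          then have "pmem w B y" using pmem_cong[OF eqv_sym[OF eqv_set_eq y(3)]] by blast
          then have "\<not> fnot (pmem w B) r" using yr(1) unfolding fnot_iff by blast
          then have "mem geq (- a) w r" using a(2) y(2) by blast
          then have "mem geq (- a) w y" by (rule regD[OF reg_mem _ yr(1)])
          then have "mem geq (- a) x y" using set_eqD[OF y(3) order_refl] by blast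
          moreover have "stone x y" "mem geq a x y"
            using regD[OF reg_stone conjunct1[OF s(2)] yr(2)] regD[OF reg_mem conjunct2[OF s(2)] yr(2)] .
          ultimately show False using stone_disj[of x y a "- a"] by simp
        qed
        then show "\<exists>a. mem geq a u r \<and> psub (clopen a) (pcompl K) r" using a(1) by blast
      qed simp
    qed
  qed
  moreover have "rlt (rabs (rval (nus k) n C)) (rof \<epsilon>) q"
    if q: "q \<le> p" "is_borel C q" "psub C B q" "pdisj C K q" for C q
  proof -
    have n: "fnot (pmem w C) q" if "w \<in> W" for w
      unfolding fnot_iff
    proof (intro allI impI notI)
      fix r assume r: "r \<le> q" "pmem w C r"
      then have "pmem w B r" using q(3) unfolding psub_iff by blast
      moreover have "dns r (\<lambda>s. \<exists>x\<in>W. set_eq geq w x s)" using that eqv_refl[OF eqv_set_eq] by (intro dns_now) blast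
      ultimately show False using q(4) r unfolding pdisj_iff pK by blast
    qed
    have n1: "fnot (pmem (v i) C) q" "fnot (pmem (v' i) C) q" if "i < 8 ^ n" for i
      using that by (auto intro!: n simp: W_def)
    then have "decs (8 ^ n) (inset v C) (inset v' C) q" unfolding decs_def dec_def by blast
    from nus_isq[OF q(2) this] have "isq q (rval (nus k) n C) (k n * dval (8 ^ n) (inset v C) (inset v' C) q)" .
    moreover have "dval (8 ^ n) (inset v C) (inset v' C) q = 0"
      unfolding dval_def by (rule sum.neutral) (use n1 fnotD in \<open>auto simp: tv_def\<close>)
    ultimately have "isq q (rval (nus k) n C) 0" by simp
    from isq_rlt[OF isq_rabs[OF this]] show ?thesis using \<epsilon> by simp
  qed
  ultimately show ?thesis by blast
qed

lemma nus_radon: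
  assumes p: "p \<le> p0" shows "is_radon_seq (mus k) (nus k) p"
  unfolding is_radon_seq_def fand_iff[of _ _ p] fall_iff[of _ p]
proof (intro conjI allI nus_fun)
  fix n
  show "is_radon_extension (mval (mus k) n) (rval (nus k) n) p"
    unfolding is_radon_extension_def fand_iff[of _ _ p] fall_iff[of _ p]
  proof (intro conjI allI)
    fix S :: "('a, 'p) pseq"
    show "((\<^bold>\<forall>n. is_borel (pnth S n)) \<^bold>\<and> (\<^bold>\<forall>i j. ground (i \<noteq> j) \<^bold>\<longrightarrow> pdisj (pnth S i) (pnth S j)) \<^bold>\<longrightarrow>
        converges (rsum (\<lambda>m. rval (nus k) n (pnth S m))) (rval (nus k) n (pUnion S))) p"
      unfolding fimp_iff[of _ _ p]
    proof (intro allI impI nus_sigma_additive)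
      fix q assume q: "((\<^bold>\<forall>n. is_borel (pnth S n)) \<^bold>\<and> (\<^bold>\<forall>i j. ground (i \<noteq> j) \<^bold>\<longrightarrow> pdisj (pnth S i) (pnth S j))) q"
      then show "is_borel (pnth S m) q" for m by simp
      show "pdisj (pnth S i) (pnth S j) q" if "i \<noteq> j" for i j using q that by (simp add: fimp_ground)
    qed
  next
    fix B :: "('a, 'p) pset" and \<epsilon> :: rat
    show "(is_borel B \<^bold>\<and> ground (0 < \<epsilon>) \<^bold>\<longrightarrow>
         (\<^bold>\<exists>K. is_closed K \<^bold>\<and> psub K B \<^bold>\<and>
            (\<^bold>\<forall>C. is_borel C \<^bold>\<and> psub C B \<^bold>\<and> pdisj C K \<^bold>\<longrightarrow> rlt (rabs (rval (nus k) n C)) (rof \<epsilon>)))) p"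
      unfolding fimp_iff fand_iff fex_iff fall_iff ground_iff
    proof (intro allI impI dns_now, elim conjE)
      fix q r assume q: "q \<le> p" "r \<le> q" "is_borel B q" "0 < \<epsilon>"
      have "r \<le> p0" using q p order_trans by metis
      from nus_regular[OF this regD[OF reg_is_borel q(3,2)] q(4)]
      show "\<exists>K. is_closed K r \<and> psub K B r \<and> (\<forall>C. \<forall>q\<le>r. is_borel C q \<and> psub C B q \<and> pdisj C K q \<longrightarrow>
           rlt (rabs (rval (nus k) n C)) (rof \<epsilon>) q)" by blast
    qed
  next
    fix a
    have "req (dsum (k n) (8 ^ n) (inset v (clopen a)) (inset v' (clopen a))) (dsum (k n) (8 ^ n) (inpt v a) (inpt v' a)) p"
      by (rule dsum_cong) (use st_le st'_le order_trans[OF _ p] in auto)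
    then have "req (dsum (k n) (8 ^ n) (inset v (clopen a)) (inset v' (clopen a))) (mval (mus k) n a) p"
      by (rule req_trans[OF _ req_sym[OF mus_val]])
    then show "req (rval (nus k) n (clopen a)) (mval (mus k) n a) p"
      by (rule req_trans[OF nus_val[OF is_borel_clopen]])
  qed
qed

end

section \<open>Weak* nullity of the sequence with bounded norms\<close>

context point_pairs
begin

abbreviation k8 :: "nat \<Rightarrow> rat" where
  "k8 n \<equiv> 1 / 8 ^ n"

text \<open>The integral of \<open>F\<close> against the \<open>n\<close>-th measure: for Dirac
  measures, integration is evaluation.\<close>

definition lin :: "(('a, 'p) point \<Rightarrow> 'p rname) \<Rightarrow> nat \<Rightarrow> 'p rname" where
  "lin F n = rsum (\<lambda>i. rscale (k8 n) (rdiff (F (v i)) (F (v' i)))) (8 ^ n)"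

lemma is_real_lin:
  "(\<And>i. is_real (F (v i)) p) \<Longrightarrow> (\<And>i. is_real (F (v' i)) p) \<Longrightarrow> is_real (lin F n) p"
  unfolding lin_def by (intro is_real_rsum is_real_rscale is_real_rdiff)

text \<open>\<open>J i\<close> and \<open>J' i\<close> are the pieces containing \<open>v i\<close>
  and \<open>v' i\<close>; regrouping by pieces turns point values into measures of pieces. The 8 ^
  n errors carry the weight 1 / 8 ^ n, so their total does not depend on \<open>n\<close>: this is
  the effect of bounded norms. The slack \<open>\<eta>'\<close> is that of
  \<open>near_rsum\<close>.\<close>

lemma lin_near:
  fixes m :: nat
  assumes J: "\<And>i. i < 8 ^ n \<Longrightarrow> J i < m \<and> near t (F (v i)) (c (J i)) \<eta> \<and> (\<forall>j<m. \<phi> j i t \<longleftrightarrow> j = J i)"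
    and J': "\<And>i. i < 8 ^ n \<Longrightarrow> J' i < m \<and> near t (F (v' i)) (c (J' i)) \<eta> \<and> (\<forall>j<m. \<phi>' j i t \<longleftrightarrow> j = J' i)"
    and "0 < \<eta>'"
  shows "near t (lin F n) (\<Sum>j<m. c j * (k8 n * dval (8 ^ n) (\<phi> j) (\<phi>' j) t)) (2 * \<eta> + \<eta>')"
proof -
  have "near t (lin F n) (\<Sum>i<8 ^ n. k8 n * (c (J i) - c (J' i))) (of_nat (8 ^ n) * (k8 n * (\<eta> + \<eta>)) + \<eta>')"
    unfolding lin_def
    by (intro near_rsum near_rscale_pos near_rdiff assms(3)) (use J J' in auto)
  moreover have "of_nat (8 ^ n) * (k8 n * (\<eta> + \<eta>)) + \<eta>' = 2 * \<eta> + \<eta>'" by simp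
  moreover have "(\<Sum>i<8 ^ n. k8 n * (c (J i) - c (J' i))) = (\<Sum>j<m. c j * (k8 n * dval (8 ^ n) (\<phi> j) (\<phi>' j) t))"
  proof -
    have 1: "c (J i) = (\<Sum>j<m. c j * tv (\<phi> j i) t)" if "i < 8 ^ n" for i
    proof -
      have "(\<Sum>j<m. c j * tv (\<phi> j i) t) = (\<Sum>j<m. if j = J i then c j else 0)"
        by (rule sum.cong) (use J[OF that] in \<open>auto simp: tv_def\<close>)
      also have "\<dots> = c (J i)" using J[OF that] by (subst sum.delta) auto
      finally show ?thesis by simp
    qed
    have 2: "c (J' i) = (\<Sum>j<m. c j * tv (\<phi>' j i) t)" if "i < 8 ^ n" for i
    proof -
      have "(\<Sum>j<m. c j * tv (\<phi>' j i) t) = (\<Sum>j<m. if j = J' i then c j else 0)"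
        by (rule sum.cong) (use J'[OF that] in \<open>auto simp: tv_def\<close>)
      also have "\<dots> = c (J' i)" using J'[OF that] by (subst sum.delta) auto
      finally show ?thesis by simp
    qed
    have "(\<Sum>i<8 ^ n. k8 n * (c (J i) - c (J' i))) = (\<Sum>i<8 ^ n. \<Sum>j<m. c j * (k8 n * (tv (\<phi> j i) t - tv (\<phi>' j i) t)))"
    proof (rule sum.cong)
      fix i assume "i \<in> {..<(8::nat) ^ n}"
      then have i: "i < 8 ^ n" by simp
      show "k8 n * (c (J i) - c (J' i)) = (\<Sum>j<m. c j * (k8 n * (tv (\<phi> j i) t - tv (\<phi>' j i) t)))"
        unfolding 1[OF i] 2[OF i] sum_subtractf[symmetric] sum_distrib_left
        by (rule sum.cong) (auto simp: algebra_simps)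
    qed simp
    also have "\<dots> = (\<Sum>j<m. \<Sum>i<8 ^ n. c j * (k8 n * (tv (\<phi> j i) t - tv (\<phi>' j i) t)))" by (rule sum.swap)
    also have "\<dots> = (\<Sum>j<m. c j * (k8 n * dval (8 ^ n) (\<phi> j) (\<phi>' j) t))"
      unfolding dval_def by (simp add: sum_distrib_left)
    finally show ?thesis .
  qed
  ultimately show ?thesis by simp
qed

lemma lin_integral:
  assumes p: "p \<le> p0" and real: "\<And>u q. q \<le> p \<Longrightarrow> stone u q \<Longrightarrow> is_real (F u) q"
    and l: "req l (lin F n) p"
  shows "is_integral F (rval (nus k8) n) l p"
  unfolding is_integral_iff
proof (intro conjI allI impI)
  have lr: "is_real (lin F n) p"
    using real[OF order_refl] st_le[OF p] st'_le[OF p] by (intro is_real_lin) blast+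
  then show "is_real l p" using is_real_cong[OF req_sym[OF l]] by blast
  fix \<epsilon> :: rat assume \<epsilon>: "0 < \<epsilon>"
  \<comment> \<open>Six of the eight parts are spent: five in \<open>near_l\<close>, where
    \<open>F\<close> is within 2 \<open>\<delta>\<close> of the value of its piece, and one for the
    rational sum.\<close>
  define \<delta> where "\<delta> = \<epsilon> / 8"
  have \<delta>: "0 < \<delta>" using \<epsilon> by (simp add: \<delta>_def)
  have "rclose (rsum (\<lambda>i. rscale (c ! i) (rval (nus k8) n (pnth S i))) (length c)) l \<epsilon> q"
    if q: "q \<le> p" and sa: "simple_approx F c S \<delta> q" for c S q
  proof -
    have bor: "\<And>i. i < length c \<Longrightarrow> is_borel (pnth S i) q"
      and disj: "\<And>i j. i < j \<Longrightarrow> j < length c \<Longrightarrow> pdisj (pnth S i) (pnth S j) q"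
      and cov: "\<And>u s. s \<le> q \<Longrightarrow> stone u s \<Longrightarrow> dns s (\<lambda>t. \<exists>i<length c. pmem u (pnth S i) t)"
      and apx: "\<And>i u s. s \<le> q \<Longrightarrow> i < length c \<Longrightarrow> pmem u (pnth S i) s \<Longrightarrow> rle (rabs (rdiff (F u) (rof (c ! i)))) (rof \<delta>) s"
    proof -
      note * = sa[unfolded simple_approx_iff]
      show "\<And>i. i < length c \<Longrightarrow> is_borel (pnth S i) q" using conjunct1[OF *] by blast
      show "\<And>i j. i < j \<Longrightarrow> j < length c \<Longrightarrow> pdisj (pnth S i) (pnth S j) q"
        using conjunct1[OF conjunct2[OF *]] by blast
      show "\<And>u s. s \<le> q \<Longrightarrow> stone u s \<Longrightarrow> dns s (\<lambda>t. \<exists>i<length c. pmem u (pnth S i) t)"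
        using conjunct1[OF conjunct2[OF conjunct2[OF *]]] by blast
      show "\<And>i u s. s \<le> q \<Longrightarrow> i < length c \<Longrightarrow> pmem u (pnth S i) s \<Longrightarrow> rle (rabs (rdiff (F u) (rof (c ! i)))) (rof \<delta>) s"
        using conjunct2[OF conjunct2[OF conjunct2[OF *]]] by blast
    qed
    define Q where "Q u j r \<longleftrightarrow> j < length c \<and> pmem u (pnth S j) r \<and> near r (F u) (c ! j) (2 * \<delta>)" for u j r
    have Q_le: "Q u j s" if Q: "Q u j r" and s: "s \<le> r" for u j r s
    proof -
      have "j < length c" and m: "pmem u (pnth S j) r" and nr: "near r (F u) (c ! j) (2 * \<delta>)"
        using Q unfolding Q_def by blast+
      then show ?thesis unfolding Q_def using regD[OF reg_mem m s] near_le[OF nr s] by blast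
    qed
    have Q_dns: "dns s (\<lambda>r. \<exists>j. Q u j r)" if s: "s \<le> q" "stone u s" for u s
    proof (rule dns_bind[OF cov[OF s]], elim exE conjE)
      fix r i assume r: "r \<le> s" "i < length c" "pmem u (pnth S i) r"
      have rq: "r \<le> q" using r s order_trans by blast
      have "rclose (F u) (rof (c ! i)) (3 / 2 * \<delta>) r"
        using apx[OF rq r(2,3)] \<delta> by (intro rle_rlt) auto
      moreover have "is_real (F u) r"
        using real[OF order_trans[OF rq q] regD[OF reg_stone s(2) r(1)]] .
      ultimately have "dns r (\<lambda>r. near r (F u) (c ! i) (3 / 2 * \<delta> + \<delta> / 2))"
        using \<delta> by (intro rclose_isq'[OF req_refl]) auto
      then show "dns r (\<lambda>r. \<exists>j. Q u j r)"
        by (rule dns_mono) (use r regD[OF reg_mem r(3)] in \<open>auto simp: Q_def intro!: exI[of _ i]\<close>)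
    qed
    have qs: "stone (v i) q" "stone (v' i) q" for i using st_le st'_le order_trans[OF q p] by blast+
    have "dns q (\<lambda>r. \<forall>i\<in>{..<8 ^ n}. \<exists>j j'. Q (v i) j r \<and> Q (v' i) j' r)"
    proof (rule dns_ball_finite)
      fix i
      show "dns q (\<lambda>r. \<exists>j j'. Q (v i) j r \<and> Q (v' i) j' r)"
      proof (rule dns_bind[OF Q_dns[OF order_refl qs(1)[of i]]], elim exE)
        fix r j assume r: "r \<le> q" "Q (v i) j r"
        show "dns r (\<lambda>r. \<exists>j j'. Q (v i) j r \<and> Q (v' i) j' r)"
          by (rule dns_mono[OF Q_dns[OF order_refl qs(2)[of i]] r(1)]) (use Q_le[OF r(2)] in blast)
      qed
    next
      fix i r s assume "\<exists>j j'. Q (v i) j r \<and> Q (v' i) j' r" "s \<le> r"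
      then show "\<exists>j j'. Q (v i) j s \<and> Q (v' i) j' s" using Q_le by blast
    qed simp
    then show ?thesis
    proof (rule reg_bind[OF reg_rlt])
      fix t assume t: "t \<le> q" "\<forall>i\<in>{..<8 ^ n}. \<exists>j j'. Q (v i) j t \<and> Q (v' i) j' t"
      then have "\<forall>i\<in>{..<8 ^ n}. \<exists>jj. Q (v i) (fst jj) t \<and> Q (v' i) (snd jj) t" by simp
      from bchoice[OF this] obtain g where g: "\<And>i. i < 8 ^ n \<Longrightarrow> Q (v i) (fst (g i)) t \<and> Q (v' i) (snd (g i)) t" by auto
      have disjt: "fnot (pmem u (pnth S j)) t" if "Q u i t" "j < length c" "j \<noteq> i" for u i j
      proof -
        have "pdisj (pnth S i) (pnth S j) q \<or> pdisj (pnth S j) (pnth S i) q"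
          using disj[of i j] disj[of j i] that unfolding Q_def by linarith
        moreover have m: "pmem u (pnth S i) t" using that(1) unfolding Q_def by blast
        have "pmem u (pnth S i) s" "s \<le> q" if "s \<le> t" for s
          using regD[OF reg_mem m that] order_trans[OF that t(1)] .
        ultimately show ?thesis unfolding pdisj_iff fnot_iff by blast
      qed
      have exact: "pmem u (pnth S j) t \<longleftrightarrow> j = i" "dec (pmem u (pnth S j)) t" if "Q u i t" "j < length c" for u i j
        using disjt[OF that] that fnotD unfolding Q_def dec_def by blast+
      have dec: "decs (8 ^ n) (inset v (pnth S j)) (inset v' (pnth S j)) t" if "j < length c" for j
        unfolding decs_def using exact(2) g that by blast
      have near_l: "near t (lin F n) (\<Sum>j<length c. c ! j * (k8 n * dval (8 ^ n) (inset v (pnth S j)) (inset v' (pnth S j)) t))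
          (2 * (2 * \<delta>) + \<delta>)"
        by (rule lin_near[where J = "\<lambda>i. fst (g i)" and J' = "\<lambda>i. snd (g i)"])
          (use g exact(1) \<delta> in \<open>auto simp: Q_def\<close>)
      have "isq t (rsum (\<lambda>i. rscale (c ! i) (rval (nus k8) n (pnth S i))) (length c))
         (\<Sum>j<length c. c ! j * (k8 n * dval (8 ^ n) (inset v (pnth S j)) (inset v' (pnth S j)) t))"
        by (intro isq_rsum isq_rscale nus_isq dec regD[OF reg_is_borel bor t(1)])
      from near_rclose[OF isq_near[OF this \<delta>] near_l, of \<epsilon>] \<epsilon>
      have "rclose (rsum (\<lambda>i. rscale (c ! i) (rval (nus k8) n (pnth S i))) (length c)) (lin F n) \<epsilon> t"
        by (simp add: \<delta>_def)
      then show "rclose (rsum (\<lambda>i. rscale (c ! i) (rval (nus k8) n (pnth S i))) (length c)) l \<epsilon> t"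
        by (rule rclose_cong[OF req_refl req_sym[OF req_le[OF l order_trans[OF t(1) q]]]])
    qed
  qed
  then show "dns p (\<lambda>r. \<exists>\<delta>>0. \<forall>c S. \<forall>q\<le>r. simple_approx F c S \<delta> q \<longrightarrow>
      rclose (rsum (\<lambda>i. rscale (c ! i) (rval (nus k8) n (pnth S i))) (length c)) l \<epsilon> q)"
    using \<delta> order_trans by (intro dns_now exI[of _ \<delta>]) blast
qed

text \<open>\<open>compact_cover\<close> yields finitely many elements covering the space on which
  \<open>F\<close> is nearly constant. After disjointing them, \<open>lin F n\<close> is, up to an
  error uniform in \<open>n\<close>, a fixed linear combination of measures of ground elements, and
  these tend to 0 by \<open>small\<close>.\<close>

lemma lin_converges:
  assumes p: "p \<le> p0" and cont: "is_continuous f p"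
    and real: "\<And>u q. q \<le> p \<Longrightarrow> stone u q \<Longrightarrow> is_real (app (set_eq geq) f u) q"
  shows "converges (lin (app (set_eq geq) f)) (rof 0) p"
proof (rule convergesI)
  fix \<epsilon>0 :: rat assume \<epsilon>0: "0 < \<epsilon>0"
  \<comment> \<open>At most 7 \<open>\<epsilon>\<close> are spent: five by \<open>lin_near\<close>,
    one by the combination of measures and one by the name for 0.\<close>
  define \<epsilon> where "\<epsilon> = \<epsilon>0 / 16"
  have \<epsilon>: "0 < \<epsilon>" using \<epsilon>0 by (simp add: \<epsilon>_def)
  define F where "F = app (set_eq geq) f"
  have nontriv: "(bot :: 'a) \<noteq> top" using stone_top[OF st] stone_bot[OF st] by metis
  show "dns p (\<lambda>r. \<exists>N. \<forall>n\<ge>N. rclose (lin (app (set_eq geq) f) n) (rof 0) \<epsilon>0 r)"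
    unfolding F_def[symmetric]
  proof (rule dns_bind[OF compact_cover[OF nontriv cont \<epsilon>, folded F_def]], elim exE conjE)
    fix r m and A :: "nat \<Rightarrow> 'a" and c
    assume r: "r \<le> p" and top: "supn A m = top" and
      sm: "\<forall>j<m. \<forall>u. \<forall>s\<le>r. stone u s \<longrightarrow> mem geq (A j) u s \<longrightarrow> rclose (F u) (rof (c j)) \<epsilon> s"
    define A' where "A' = disjointed_elt A"
    \<comment> \<open>The added 1 keeps \<open>M\<close> positive when all coefficients vanish;
      \<open>\<zeta>\<close> is the measure allowed to each piece so that the combination stays
      within \<open>\<epsilon>\<close>.\<close>
    define M where "M = (\<Sum>j<m. \<bar>c j\<bar>) + 1"
    have M: "0 < M" unfolding M_def by (rule add_nonneg_pos[OF sum_nonneg]) auto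
    define \<zeta> where "\<zeta> = \<epsilon> / M"
    have \<zeta>: "0 < \<zeta>" using \<epsilon> M by (simp add: \<zeta>_def)
    define G where "G j N r \<longleftrightarrow> (\<forall>n\<ge>N. \<forall>s\<le>r. decs (8 ^ n) (inpt v (A' j)) (inpt v' (A' j)) s \<longrightarrow>
        \<bar>dval (8 ^ n) (inpt v (A' j)) (inpt v' (A' j)) s\<bar> < \<zeta> * 4 ^ n)" for j and N :: nat and r
    have G_le: "G j N r \<Longrightarrow> s \<le> r \<Longrightarrow> G j N s" for j N r s
      unfolding G_def using order_trans by blast
    have r0: "r \<le> p0" using r p order_trans by blast
    have "dns r (\<lambda>r. \<forall>j\<in>{..<m}. \<exists>N. G j N r)"
    proof (rule dns_ball_finite)
      fix j show "dns r (\<lambda>r. \<exists>N. G j N r)" unfolding G_def using dns_le[OF small[OF \<zeta>] r0] .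
    next
      fix j q s assume "\<exists>N. G j N q" "s \<le> q"
      then show "\<exists>N. G j N s" using G_le by blast
    qed simp
    then show "dns r (\<lambda>r. \<exists>N. \<forall>n\<ge>N. rclose (lin F n) (rof 0) \<epsilon>0 r)"
    proof (rule dns_mono)
      fix t assume t: "t \<le> r" "\<forall>j\<in>{..<m}. \<exists>N. G j N t"
      from bchoice[OF t(2)] obtain g where g: "\<And>j. j < m \<Longrightarrow> G j (g j) t" by auto
      define N where "N = (\<Sum>j<m. g j)"
      have gN: "g j \<le> N" if "j < m" for j unfolding N_def using that by (intro member_le_sum) auto
      have "rclose (lin F n) (rof 0) \<epsilon>0 t" if n: "N \<le> n" for n
      proof -
        define Q where "Q u r \<longleftrightarrow> (\<forall>j<m. dec (mem geq (A j) u) r) \<and>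
           (\<forall>j<m. mem geq (A j) u r \<longrightarrow> near r (F u) (c j) (2 * \<epsilon>))" for u r
        have Q_le: "Q u s" if "Q u x" "s \<le> x" for u x s
        proof -
          have "mem geq (A j) u x" if "j < m" "mem geq (A j) u s" for j
            using \<open>Q u x\<close> that \<open>s \<le> x\<close> unfolding Q_def dec_def fnot_iff by blast
          moreover have "near s (F u) (c j) (2 * \<epsilon>)" if "near x (F u) (c j) (2 * \<epsilon>)" for j
            using near_le[OF that \<open>s \<le> x\<close>] .
          moreover have "dec (mem geq (A j) u) s" if "j < m" for j
          proof -
            have "dec (mem geq (A j) u) x" using \<open>Q u x\<close> that unfolding Q_def by blast
            then show ?thesis by (rule dec_le[OF reg_mem _ \<open>s \<le> x\<close>])
          qed
          ultimately show ?thesis using \<open>Q u x\<close> unfolding Q_def by blast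
        qed
        have Q_dns: "dns x (Q u)" if x: "x \<le> t" "stone u x" for u x
        proof -
          have "dns x (\<lambda>r. \<forall>j\<in>{..<m}. dec (mem geq (A j) u) r \<and> (mem geq (A j) u r \<longrightarrow> near r (F u) (c j) (2 * \<epsilon>)))"
          proof (rule dns_ball_finite)
            fix j assume "j \<in> {..<m}"
            then have j: "j < m" by simp
            show "dns x (\<lambda>r. dec (mem geq (A j) u) r \<and> (mem geq (A j) u r \<longrightarrow> near r (F u) (c j) (2 * \<epsilon>)))"
            proof (rule dns_bind[OF decide[of x "mem geq (A j) u"]], elim disjE)
              fix y assume y: "y \<le> x" "mem geq (A j) u y"
              have yr: "y \<le> r" using y x t order_trans by metis
              have su: "stone u y" using regD[OF reg_stone x(2) y(1)] .
              have "dns y (\<lambda>r. near r (F u) (c j) (\<epsilon> + \<epsilon>))"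
                using sm j yr su y(2) real[OF order_trans[OF yr r] su] \<epsilon>
                by (intro rclose_isq'[OF req_refl]) (auto simp: F_def)
              then show "dns y (\<lambda>r. dec (mem geq (A j) u) r \<and> (mem geq (A j) u r \<longrightarrow> near r (F u) (c j) (2 * \<epsilon>)))"
                by (rule dns_mono) (use regD[OF reg_mem y(2)] in \<open>auto simp: dec_def\<close>)
            next
              fix y assume y: "fnot (mem geq (A j) u) y"
              show "dns y (\<lambda>r. dec (mem geq (A j) u) r \<and> (mem geq (A j) u r \<longrightarrow> near r (F u) (c j) (2 * \<epsilon>)))"
                by (rule dns_now) (use fnot_le[OF y] fnotD in \<open>auto simp: dec_def\<close>)
            qed
          next
            fix j q s assume *: "dec (mem geq (A j) u) q \<and> (mem geq (A j) u q \<longrightarrow> near q (F u) (c j) (2 * \<epsilon>))" "s \<le> q"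
            then have "mem geq (A j) u s \<Longrightarrow> mem geq (A j) u q" unfolding dec_def fnot_iff by blast
            moreover have "near q (F u) (c j) (2 * \<epsilon>) \<Longrightarrow> near s (F u) (c j) (2 * \<epsilon>)" by (rule near_le[OF _ *(2)])
            ultimately show "dec (mem geq (A j) u) s \<and> (mem geq (A j) u s \<longrightarrow> near s (F u) (c j) (2 * \<epsilon>))"
              using *(1) dec_le[OF reg_mem conjunct1[OF *(1)] *(2)] by blast
          qed simp
          then show ?thesis by (rule dns_mono) (auto simp: Q_def)
        qed
        have ts: "stone (v i) t" "stone (v' i) t" for i using st_le st'_le order_trans[OF t(1) r0] by blast+
        have "dns t (\<lambda>r. \<forall>i\<in>{..<8 ^ n}. Q (v i) r \<and> Q (v' i) r)"
        proof (rule dns_ball_finite)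
          fix i show "dns t (\<lambda>r. Q (v i) r \<and> Q (v' i) r)"
          proof (rule dns_bind[OF Q_dns[OF order_refl ts(1)[of i]]])
            fix r assume r: "r \<le> t" "Q (v i) r"
            show "dns r (\<lambda>r. Q (v i) r \<and> Q (v' i) r)"
              by (rule dns_mono[OF Q_dns[OF order_refl ts(2)[of i]] r(1)]) (use Q_le[OF r(2)] in blast)
          qed
        qed (use Q_le in auto)
        then show ?thesis
        proof (rule reg_bind[OF reg_rlt])
          fix s assume s: "s \<le> t" "\<forall>i\<in>{..<8 ^ n}. Q (v i) s \<and> Q (v' i) s"
          have ss: "stone (v i) s" "stone (v' i) s" for i using ts regD[OF reg_stone _ s(1)] by blast+
          have ex: "\<exists>J. J < m \<and> near s (F u) (c J) (2 * \<epsilon>) \<and> (\<forall>j<m. mem geq (A' j) u s \<longleftrightarrow> j = J) \<and>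
             (\<forall>j<m. dec (mem geq (A' j) u) s)" if "stone u s" "Q u s" for u
          proof -
            have "\<And>j. j < m \<Longrightarrow> dec (mem geq (A j) u) s" using that(2) unfolding Q_def by blast
            from stone_partition[OF that(1) top this] obtain J where
              "J < m" "mem geq (A J) u s" "\<And>j. j < m \<Longrightarrow> mem geq (A' j) u s \<longleftrightarrow> j = J"
              "\<And>j. j < m \<Longrightarrow> dec (mem geq (A' j) u) s" unfolding A'_def by metis
            then show ?thesis using that(2) unfolding Q_def by blast
          qed
          have "\<forall>i\<in>{..<8 ^ n}. \<exists>J. J < m \<and> near s (F (v i)) (c J) (2 * \<epsilon>) \<and> (\<forall>j<m. mem geq (A' j) (v i) s \<longleftrightarrow> j = J) \<and>
             (\<forall>j<m. dec (mem geq (A' j) (v i)) s)" using ex[OF ss(1)] s(2) by blast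
          from bchoice[OF this] obtain J where J: "\<And>i. i < 8 ^ n \<Longrightarrow> J i < m \<and> near s (F (v i)) (c (J i)) (2 * \<epsilon>) \<and>
              (\<forall>j<m. mem geq (A' j) (v i) s \<longleftrightarrow> j = J i) \<and> (\<forall>j<m. dec (mem geq (A' j) (v i)) s)" by auto
          have "\<forall>i\<in>{..<8 ^ n}. \<exists>J. J < m \<and> near s (F (v' i)) (c J) (2 * \<epsilon>) \<and> (\<forall>j<m. mem geq (A' j) (v' i) s \<longleftrightarrow> j = J) \<and>
             (\<forall>j<m. dec (mem geq (A' j) (v' i)) s)" using ex[OF ss(2)] s(2) by blast
          from bchoice[OF this] obtain J' where J': "\<And>i. i < 8 ^ n \<Longrightarrow> J' i < m \<and> near s (F (v' i)) (c (J' i)) (2 * \<epsilon>) \<and>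
              (\<forall>j<m. mem geq (A' j) (v' i) s \<longleftrightarrow> j = J' i) \<and> (\<forall>j<m. dec (mem geq (A' j) (v' i)) s)" by auto
          let ?C = "\<Sum>j<m. c j * (k8 n * dval (8 ^ n) (inpt v (A' j)) (inpt v' (A' j)) s)"
          have nl: "near s (lin F n) ?C (2 * (2 * \<epsilon>) + \<epsilon>)"
            by (rule lin_near[where J = J and J' = J']) (use J J' \<epsilon> in auto)
          have dj: "k8 n * \<bar>dval (8 ^ n) (inpt v (A' j)) (inpt v' (A' j)) s\<bar> \<le> \<zeta>" if "j < m" for j
          proof -
            have "decs (8 ^ n) (inpt v (A' j)) (inpt v' (A' j)) s"
              unfolding decs_def using J J' that by blast
            then have "\<bar>dval (8 ^ n) (inpt v (A' j)) (inpt v' (A' j)) s\<bar> < \<zeta> * 4 ^ n"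
              using g[OF that] gN[OF that] n s(1) unfolding G_def by (meson order_trans)
            also have "\<dots> \<le> \<zeta> * 8 ^ n" using \<zeta> by (intro mult_left_mono power_mono) auto
            finally show ?thesis by (simp add: field_simps)
          qed
          have "\<bar>?C\<bar> \<le> (\<Sum>j<m. \<bar>c j * (k8 n * dval (8 ^ n) (inpt v (A' j)) (inpt v' (A' j)) s)\<bar>)" by (rule sum_abs)
          also have "\<dots> \<le> (\<Sum>j<m. \<bar>c j\<bar> * \<zeta>)"
          proof (rule sum_mono)
            fix j assume "j \<in> {..<m}"
            then show "\<bar>c j * (k8 n * dval (8 ^ n) (inpt v (A' j)) (inpt v' (A' j)) s)\<bar> \<le> \<bar>c j\<bar> * \<zeta>"
              using mult_left_mono[OF dj abs_ge_zero, of j "c j"] by (simp add: abs_mult)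
          qed
          also have "\<dots> \<le> M * \<zeta>" unfolding sum_distrib_right[symmetric] using \<zeta> by (intro mult_right_mono) (auto simp: M_def)
          also have "\<dots> = \<epsilon>" using M by (simp add: \<zeta>_def)
          finally have C: "\<bar>?C - 0\<bar> \<le> \<epsilon>" by simp
          have "near s (rof 0) 0 \<epsilon>" by (rule isq_near[OF req_refl \<epsilon>])
          from near_rclose[OF nl this, of \<epsilon>0] C \<epsilon>0 show "rclose (lin F n) (rof 0) \<epsilon>0 s"
            by (simp add: \<epsilon>_def)
        qed
      qed
      then show "\<exists>N. \<forall>n\<ge>N. rclose (lin F n) (rof 0) \<epsilon>0 t" by blast
    qed simp
  qed
qed

lemma weak_star_null_mus:
  assumes p: "p \<le> p0" shows "weak_star_null (mus k8) p"
  unfolding weak_star_null_def fex_iff[of _ p]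
proof (intro dns_now exI[of _ "nus k8"])
  fix r assume r: "r \<le> p"
  have r0: "r \<le> p0" using r p order_trans by blast
  show "(is_radon_seq (mus k8) (nus k8) \<^bold>\<and>
        (\<^bold>\<forall>f. is_continuous f \<^bold>\<longrightarrow>
           (\<^bold>\<exists>l. is_fun geq (\<lambda>x. ground True) l \<^bold>\<and>
              (\<^bold>\<forall>n. is_integral (app (set_eq geq) f) (rval (nus k8) n) (app geq l n)) \<^bold>\<and>
              converges (app geq l) (rof 0)))) r"
    unfolding fand_iff[of _ _ r] fall_iff[of _ r] fimp_iff[of _ _ r]
  proof (intro conjI allI impI nus_radon[OF r0])
    fix f :: "(('a, 'p) point \<times> 'p rname, 'p) name" and q assume q: "q \<le> r" "is_continuous f q"
    have q0: "q \<le> p0" using q r0 order_trans by blast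
    define F where "F = app (set_eq geq) f"
    have fn: "is_fun (set_eq geq) stone f q" using q(2) unfolding is_continuous_def by simp
    have real: "is_real (F u) s" if "s \<le> q" "stone u s" for u s
    proof -
      have "is_fun (set_eq geq) stone f s" by (rule regD[OF reg_is_fun[OF eqv_set_eq reg_stone] fn that(1)])
      then show ?thesis unfolding F_def using that(2) by (rule app_real)
    qed
    define l where "l = fname (\<lambda>_. ground True) (lin F)"
    have lv: "req (app geq l n) (lin F n) s" for n s
      unfolding l_def by (rule app_fname) (auto simp: geq_iff)
    have lreal: "is_real (lin F n) s" if s: "s \<le> q" for n s
      using real[OF s] st_le st'_le order_trans[OF s q0] by (intro is_real_lin) blast+
    have sq: "(is_fun geq (\<lambda>x. ground True) l \<^bold>\<and>
              (\<^bold>\<forall>n. is_integral F (rval (nus k8) n) (app geq l n)) \<^bold>\<and>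
              converges (app geq l) (rof 0)) s" if s: "s \<le> q" for s
      unfolding fand_iff[of _ _ s] fall_iff[of _ s]
    proof (intro conjI allI)
      show "is_fun geq (\<lambda>x. ground True) l s"
        unfolding l_def by (rule is_fun_fname) (use lreal order_trans[OF _ s] in \<open>auto simp: geq_iff\<close>)
      show "is_integral F (rval (nus k8) n) (app geq l n) s" for n
        by (rule lin_integral[OF order_trans[OF s q0] _ lv]) (use real order_trans[OF _ s] in blast)
      have "converges (lin F) (rof 0) q"
        unfolding F_def by (rule lin_converges[OF q0 q(2)]) (use real F_def in auto)
      then have "converges (lin F) (rof 0) s" by (rule regD[OF reg_converges _ s])
      then show "converges (app geq l) (rof 0) s"
        by (rule converges_cong[rotated 2]) (auto intro: req_sym lv)
    qed
    show "(\<^bold>\<exists>l. is_fun geq (\<lambda>x. ground True) l \<^bold>\<and>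
              (\<^bold>\<forall>n. is_integral (app (set_eq geq) f) (rval (nus k8) n) (app geq l n)) \<^bold>\<and>
              converges (app geq l) (rof 0)) q"
      unfolding fex_iff[of _ q] F_def[symmetric] by (intro dns_now exI[of _ l] sq)
  qed
qed

theorem not_nikodym: "\<not> nikodym TYPE('a) p0"
proof
  assume "nikodym TYPE('a) p0"
  then have "is_mseq (mus (\<lambda>n. 1 / 4 ^ n)) p0 \<and> pointwise_null (mus (\<lambda>n. 1 / 4 ^ n)) p0 \<longrightarrow>
      weak_star_null (mus (\<lambda>n. 1 / 4 ^ n)) p0"
    unfolding nikodym_def fall_iff fimp_iff fand_iff by blast
  then show False
    using not_weak_star_null[OF order_refl] is_mseq_mus[OF order_refl]
      pointwise_null_mus[OF order_refl, of "\<lambda>n. 1 / 4 ^ n"] by simp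
qed

theorem not_grothendieck: "\<not> grothendieck TYPE('a) p0"
proof
  assume "grothendieck TYPE('a) p0"
  then have "is_mseq (mus k8) p0 \<and> weak_star_null (mus k8) p0 \<longrightarrow> weakly_null (mus k8) p0"
    unfolding grothendieck_def fall_iff fimp_iff fand_iff by blast
  then show False
    using not_weakly_null[OF order_refl] is_mseq_mus[OF order_refl] weak_star_null_mus[OF order_refl] by blast
qed

end

section \<open>Elements with finitely many parts\<close>

text \<open>Equivalently, \<open>a\<close> is a finite join of atoms. These elements form an ideal;
  an element that cannot be split into two that are not thin, and is not thin itself, is an atom of
  the quotient.\<close>

definition thin :: "'a::boolean_algebra \<Rightarrow> bool" where
  "thin a \<longleftrightarrow> finite {b. b \<le> a}"

lemma thin_down: "thin a \<Longrightarrow> b \<le> a \<Longrightarrow> thin b"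
  unfolding thin_def by (erule finite_subset[rotated]) (auto intro: order_trans)

lemma thin_bot: "thin bot"
  unfolding thin_def by (simp add: bot_unique)

lemma thin_sup:
  assumes "thin a" "thin b" shows "thin (sup a b)"
proof -
  have "{c. c \<le> sup a b} \<subseteq> (\<lambda>(x, y). sup x y) ` ({c. c \<le> a} \<times> {c. c \<le> b})"
  proof
    fix c assume "c \<in> {c. c \<le> sup a b}"
    then have "c = sup (inf c a) (inf c b)" by (simp add: inf_absorb1 flip: inf_sup_distrib1)
    then show "c \<in> (\<lambda>(x, y). sup x y) ` ({c. c \<le> a} \<times> {c. c \<le> b})"
      by (intro image_eqI[of _ _ "(inf c a, inf c b)"]) auto
  qed
  then show ?thesis using assms finite_subset unfolding thin_def by blast
qed

lemma le_split: "e \<le> sup b (inf e (- b))" for e :: "'a::boolean_algebra"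
  by (simp add: sup_inf_distrib1)

lemma thin_split: "thin b \<Longrightarrow> thin (inf e (- b)) \<Longrightarrow> thin e"
  using thin_down[OF thin_sup le_split] by blast

definition ultra :: "'a::boolean_algebra set \<Rightarrow> bool" where
  "ultra X \<longleftrightarrow> top \<in> X \<and> bot \<notin> X \<and> (\<forall>b c. b \<in> X \<longrightarrow> b \<le> c \<longrightarrow> c \<in> X) \<and>
     (\<forall>b c. b \<in> X \<longrightarrow> c \<in> X \<longrightarrow> inf b c \<in> X) \<and> (\<forall>b. b \<in> X \<or> - b \<in> X)"

lemma ultraD:
  assumes "ultra X"
  shows "top \<in> X" "bot \<notin> X" "b \<in> X \<Longrightarrow> b \<le> c \<Longrightarrow> c \<in> X" "b \<in> X \<Longrightarrow> c \<in> X \<Longrightarrow> inf b c \<in> X" "b \<in> X \<or> - b \<in> X"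
proof -
  note * = assms[unfolded ultra_def]
  show "top \<in> X" "bot \<notin> X" using * by blast+
  have "\<forall>b c. b \<in> X \<longrightarrow> b \<le> c \<longrightarrow> c \<in> X" using * by (elim conjE)
  then show "b \<in> X \<Longrightarrow> b \<le> c \<Longrightarrow> c \<in> X" by blast
  have "\<forall>b c. b \<in> X \<longrightarrow> c \<in> X \<longrightarrow> inf b c \<in> X" using * by (elim conjE)
  then show "b \<in> X \<Longrightarrow> c \<in> X \<Longrightarrow> inf b c \<in> X" by blast
  show "b \<in> X \<or> - b \<in> X" using * by blast
qed

lemma ultra_disj: "ultra X \<Longrightarrow> b \<in> X \<Longrightarrow> inf b c = bot \<Longrightarrow> c \<notin> X"
  using ultraD(2,4) by metis

lemma ultra_ex:
  fixes a :: "'a::boolean_algebra"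
  assumes "a \<noteq> bot" shows "\<exists>X. ultra X \<and> a \<in> X"
proof (rule ultrafilter_exists[OF assms])
  fix X assume "a \<in> X" "top \<in> X" "bot \<notin> X" "\<And>b c. b \<in> X \<Longrightarrow> b \<le> c \<Longrightarrow> c \<in> X"
    "\<And>b c. b \<in> X \<Longrightarrow> c \<in> X \<Longrightarrow> inf b c \<in> X" "\<And>b. b \<in> X \<or> - b \<in> X"
  then show ?thesis by (intro exI[of _ X]) (simp add: ultra_def)
qed

text \<open>
  If \<open>e\<close> cannot be split into two elements that are not thin, then the elements with thin
  complement in \<open>e\<close> form an ultrafilter, and points in disjoint thin parts of \<open>e\<close> converge to it.
\<close>

lemma convergent_sequence:
  fixes e :: "'a::boolean_algebra"
  assumes e: "\<not> thin e" and unsplit: "\<And>b. b \<le> e \<Longrightarrow> thin b \<or> thin (inf e (- b))"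
  obtains X Y and D :: "nat \<Rightarrow> 'a" where "\<And>i. ultra (X i)" "ultra Y" "\<And>i. D i \<in> X i" "\<And>i. D i \<notin> Y"
    "\<And>i j. i \<noteq> j \<Longrightarrow> inf (D i) (D j) = bot" "\<And>a. a \<in> Y \<Longrightarrow> \<exists>N. \<forall>i\<ge>N. a \<in> X i"
proof -
  \<comment> \<open>For a proper nonzero part of \<open>e'\<close>, either it or its complement in
    \<open>e'\<close> is thin, and both are nonzero.\<close>
  have part: "\<exists>b. b \<le> e' \<and> b \<noteq> bot \<and> thin b" if e': "e' \<le> e" "\<not> thin e'" for e'
  proof -
    have "\<exists>b. b \<le> e' \<and> b \<noteq> bot \<and> b \<noteq> e'"
    proof (rule ccontr)
      assume "\<not> ?thesis"
      then have "{b. b \<le> e'} \<subseteq> {bot, e'}" by blast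
      then show False using e'(2) finite_subset unfolding thin_def by blast
    qed
    then obtain b where b: "b \<le> e'" "b \<noteq> bot" "b \<noteq> e'" by blast
    show ?thesis
    proof (cases "thin b")
      case False
      then have "thin (inf e (- b))" using unsplit b(1) e'(1) order_trans by blast
      then have "thin (inf e' (- b))" by (rule thin_down) (rule inf_mono[OF e'(1) order_refl])
      moreover have "inf e' (- b) \<noteq> bot" using b by (metis inf_shunt double_compl order_antisym)
      ultimately show ?thesis using inf_le1 by blast
    qed (use b in blast)
  qed
  define pick where "pick e' = (SOME b. b \<le> e' \<and> b \<noteq> bot \<and> thin b)" for e' :: 'a
  have pick: "pick e' \<le> e'" "pick e' \<noteq> bot" "thin (pick e')" if "e' \<le> e" "\<not> thin e'" for e'
    using someI_ex[OF part[OF that]] unfolding pick_def by blast+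
  \<comment> \<open>Removing a thin part from an element that is not thin leaves one that is not
    thin, so the choice never stops.\<close>
  define E where "E n = rec_nat e (\<lambda>_ e'. inf e' (- pick e')) n" for n
  have E0: "E 0 = e" and ES: "E (Suc n) = inf (E n) (- pick (E n))" for n by (simp_all add: E_def)
  have E: "E n \<le> e \<and> \<not> thin (E n)" for n
  proof (induction n)
    case 0
    then show ?case using e by (simp add: E0)
  next
    case (Suc n)
    then have "\<not> thin (E (Suc n))" unfolding ES using pick(3) thin_split by blast
    moreover have "E (Suc n) \<le> e" unfolding ES using Suc by (meson inf_le1 order_trans)
    ultimately show ?case by blast
  qed
  define D where "D n = pick (E n)" for n
  have D: "D n \<le> E n" "D n \<noteq> bot" "thin (D n)" for n using pick E D_def by auto
  have E_mono: "E n \<le> E m" if "m \<le> n" for m n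
    using that by (induction n rule: dec_induct) (auto simp: ES intro: le_infI1)
  have disj1: "inf (D i) (D j) = bot" if "i < j" for i j
  proof -
    have "D j \<le> E (Suc i)" using D(1) E_mono that order_trans by (metis Suc_leI)
    then have "D j \<le> - D i" unfolding ES D_def by simp
    then show ?thesis by (metis inf_commute inf_shunt)
  qed
  have disj: "inf (D i) (D j) = bot" if "i \<noteq> j" for i j
    using disj1[of i j] disj1[of j i] that by (metis inf_commute linorder_neqE_nat)
  obtain X where X: "\<And>i. ultra (X i) \<and> D i \<in> X i" using ultra_ex[OF D(2)] by metis
  \<comment> \<open>The dual of the thin ideal below \<open>e\<close>; it is an ultrafilter because
    \<open>e\<close> cannot be split.\<close>
  define Y where "Y = {a. \<not> thin (inf a e)}"
  have co: "thin (inf e (- a))" if "a \<in> Y" for a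
  proof -
    have "thin (inf e (- inf a e))" using unsplit[of "inf a e"] that unfolding Y_def by auto
    moreover have "inf e (- a) \<le> inf e (- inf a e)" by (simp add: le_infI2)
    ultimately show ?thesis by (rule thin_down)
  qed
  have "ultra Y" unfolding ultra_def
  proof (intro conjI allI impI)
    show "top \<in> Y" "bot \<notin> Y" using e thin_bot by (auto simp: Y_def)
    show "c \<in> Y" if "b \<in> Y" "b \<le> c" for b c
      using that thin_down[OF _ inf_mono[OF that(2) order_refl]] unfolding Y_def by blast
    show "inf b c \<in> Y" if "b \<in> Y" "c \<in> Y" for b c
    proof (rule ccontr)
      assume "inf b c \<notin> Y"
      then have "thin (inf (inf b c) e)" by (simp add: Y_def)
      moreover have "thin (sup (inf e (- b)) (inf e (- c)))" using co that thin_sup by blast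
      moreover have "e \<le> sup (inf (inf b c) e) (sup (inf e (- b)) (inf e (- c)))"
        by (simp add: inf_sup_distrib1[symmetric] inf_commute[of "inf b c"])
          (simp flip: compl_inf add: inf_sup_distrib1[symmetric])
      ultimately show False using e thin_down thin_sup by blast
    qed
    show "b \<in> Y \<or> - b \<in> Y" for b
    proof (rule ccontr)
      assume "\<not> ?thesis"
      then have "thin (sup (inf b e) (inf (- b) e))" using thin_sup unfolding Y_def by blast
      then show False using e by (simp flip: inf_sup_distrib2)
    qed
  qed
  moreover have "D i \<notin> Y" for i unfolding Y_def using thin_down[OF D(3) inf_le1] by blast
  moreover have "\<exists>N. \<forall>i\<ge>N. a \<in> X i" if a: "a \<in> Y" for a
  proof -
    \<comment> \<open>The parts of the \<open>D i\<close> outside \<open>a\<close> are distinct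
      elements below the thin element \<open>inf e (- a)\<close>, so all but finitely many
      \<open>D i\<close> lie below \<open>a\<close>.\<close>
    let ?I = "{i. inf (D i) (- a) \<noteq> bot}"
    have "inj_on (\<lambda>i. inf (D i) (- a)) ?I"
    proof (rule inj_onI)
      fix i j assume ij: "i \<in> ?I" "inf (D i) (- a) = inf (D j) (- a)"
      show "i = j"
      proof (rule ccontr)
        assume "i \<noteq> j"
        have "inf (D i) (- a) = inf (inf (D i) (- a)) (inf (D j) (- a))" using ij(2) by simp
        also have "\<dots> \<le> inf (D i) (D j)" by (intro inf_mono inf_le1)
        finally show False using ij(1) disj[OF \<open>i \<noteq> j\<close>] by (simp add: bot_unique)
      qed
    qed
    moreover have "(\<lambda>i. inf (D i) (- a)) ` ?I \<subseteq> {b. b \<le> inf e (- a)}"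
      using D(1) E by (auto intro: le_infI1 order_trans)
    ultimately have "finite ?I" using co[OF a] finite_subset finite_imageD unfolding thin_def by blast
    then obtain N where N: "\<And>i. i \<in> ?I \<Longrightarrow> i < N" using finite_nat_bounded by blast
    have "a \<in> X i" if "N \<le> i" for i
    proof -
      have "inf (D i) (- a) = bot" using N[of i] that by force
      then have "D i \<le> a" by (simp add: inf_shunt)
      then show ?thesis using X ultraD(3) by blast
    qed
    then show ?thesis by blast
  qed
  ultimately show ?thesis using that X disj by blast
qed

lemma splitting_tree:
  assumes top: "\<not> thin (top :: 'a::boolean_algebra)"
    and split: "\<And>e::'a::boolean_algebra. \<not> thin e \<Longrightarrow> \<exists>b\<le>e. \<not> thin b \<and> \<not> thin (inf e (- b))"
  obtains node :: "bool list \<Rightarrow> 'a::boolean_algebra" where "\<And>s. node s \<noteq> bot" "\<And>s b. node (s @ [b]) \<le> node s"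
    "\<And>s. inf (node (s @ [True])) (node (s @ [False])) = bot"
proof -
  define sp where "sp e = (SOME b. b \<le> e \<and> \<not> thin b \<and> \<not> thin (inf e (- b)))" for e :: 'a
  have sp: "sp e \<le> e \<and> \<not> thin (sp e) \<and> \<not> thin (inf e (- sp e))" if "\<not> thin e" for e
    unfolding sp_def by (rule someI_ex) (use split[OF that] in blast)
  \<comment> \<open>Recursion on lists consumes the head, while the tree grows at the end of the
    string; hence nodes are taken at reversed strings.\<close>
  define T where "T = rec_list top (\<lambda>b _ e. if b then sp e else inf e (- sp e))"
  have T: "T [] = top" "T (b # s) = (if b then sp (T s) else inf (T s) (- sp (T s)))" for b s
    by (simp_all add: T_def)
  have nt: "\<not> thin (T s)" for s by (induction s) (use top sp in \<open>auto simp: T\<close>)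
  show ?thesis
  proof (rule that[of "\<lambda>s. T (rev s)"])
    show "T (rev s) \<noteq> bot" for s using nt[of "rev s"] thin_bot by metis
    show "T (rev (s @ [b])) \<le> T (rev s)" for s b using sp[OF nt] by (simp add: T)
    show "inf (T (rev (s @ [True]))) (T (rev (s @ [False]))) = bot" for s
    proof -
      have "inf (sp e) (inf e (- sp e)) = bot" for e :: 'a
        by (metis inf_assoc inf_commute inf_compl_bot inf_bot_left)
      then show ?thesis by (simp add: T)
    qed
  qed
qed

section \<open>Points of the ground model\<close>

definition gpt :: "'a set \<Rightarrow> ('a, 'p::preorder) point" where
  "gpt X = compr (\<lambda>a. ground (a \<in> X))"

lemma mem_gpt [simp]: "mem geq a (gpt X) p \<longleftrightarrow> a \<in> X"
  unfolding gpt_def by simp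

text \<open>Being an ultrafilter speaks only of elements of the algebra, all of which lie in V, so a
  ground ultrafilter remains one in V[G].\<close>

lemma stone_gpt: "ultra X \<Longrightarrow> stone (gpt X) p"
  unfolding stone_iff fnot_iff mem_gpt dns_const using ultraD by blast

lemma stone_if_ultra:
  assumes "ultra X" "\<And>s a. s \<le> r \<Longrightarrow> mem geq a u s \<longleftrightarrow> a \<in> X" shows "stone u r"
  by (rule stone_cong[OF _ stone_gpt[OF assms(1)]]) (simp add: set_eq_iff' assms(2))

text \<open>At most \<open>N\<close> terms are nonzero and each has absolute value at most 1.
  Whenever pairs eventually agree, this bounds the count, and \<open>const_lt_pow4\<close>
  finishes.\<close>

lemma sum_eventually_eq:
  fixes \<alpha> \<beta> :: "nat \<Rightarrow> rat"
  assumes "\<And>i. i < M \<Longrightarrow> N \<le> i \<Longrightarrow> \<alpha> i = \<beta> i" "\<And>i. i < M \<Longrightarrow> \<bar>\<alpha> i - \<beta> i\<bar> \<le> 1"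
  shows "\<bar>\<Sum>i<M. \<alpha> i - \<beta> i\<bar> \<le> of_nat N"
proof -
  have "\<bar>\<Sum>i<M. \<alpha> i - \<beta> i\<bar> \<le> (\<Sum>i<M. \<bar>\<alpha> i - \<beta> i\<bar>)" by (rule sum_abs)
  also have "\<dots> \<le> (\<Sum>i<M. if i < N then 1 else 0)"
    by (rule sum_mono) (use assms in \<open>auto simp: not_less\<close>)
  also have "\<dots> = of_nat (card {i. i < M \<and> i < N})" by (simp add: sum.If_cases Int_def)
  also have "\<dots> \<le> of_nat (card {..<N})" by (intro of_nat_mono card_mono) auto
  finally show ?thesis by simp
qed

lemma const_lt_pow4:
  assumes "0 < (\<epsilon>::rat)" obtains N where "\<And>n. N \<le> n \<Longrightarrow> C < \<epsilon> * 4 ^ n"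
proof -
  obtain N :: nat where N: "C / \<epsilon> < of_nat N" using reals_Archimedean2 by blast
  have "C < \<epsilon> * 4 ^ n" if "N \<le> n" for n
  proof -
    have "n < 4 ^ n" by (induction n) auto
    then have "N < 4 ^ n" using that by linarith
    then have "(of_nat N :: rat) < of_nat (4 ^ n)" by (simp only: of_nat_less_iff)
    then have "C / \<epsilon> < of_nat (4 ^ n)" by (rule less_trans[OF N])
    then have "C / \<epsilon> < 4 ^ n" by simp
    then show ?thesis using assms by (simp add: field_simps)
  qed
  then show ?thesis using that by blast
qed

text \<open>Here everything lies in V. Either \<open>a\<close> or \<open>- a\<close> belongs to
  \<open>Y\<close>, and convergence puts the same one into almost all \<open>X i\<close>, so almost
  all differences vanish at \<open>a\<close>.\<close>

lemma point_pairs_convergent: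
  fixes D :: "nat \<Rightarrow> 'a::boolean_algebra" and p :: "'p::preorder"
  assumes X: "\<And>i. ultra (X i)" and Y: "ultra Y" and D: "\<And>i. D i \<in> X i" "\<And>i. D i \<notin> Y"
    "\<And>i j. i \<noteq> j \<Longrightarrow> inf (D i) (D j) = bot" and conv: "\<And>a. a \<in> Y \<Longrightarrow> \<exists>N. \<forall>i\<ge>N. a \<in> X i"
  shows "point_pairs p (\<lambda>i. gpt (X i)) (\<lambda>_. gpt Y) (\<lambda>i a. ground (a = D i))"
proof
  fix a and \<epsilon> :: rat assume \<epsilon>: "0 < \<epsilon>"
  have "\<exists>N. \<forall>i\<ge>N. a \<in> X i \<longleftrightarrow> a \<in> Y"
  proof (cases "a \<in> Y")
    case True
    then show ?thesis using conv by blast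
  next
    case False
    then have "- a \<in> Y" using ultraD(5)[OF Y, of a] by blast
    then obtain N where "\<forall>i\<ge>N. - a \<in> X i" using conv by blast
    then have "\<forall>i\<ge>N. a \<notin> X i" using ultra_disj[OF X, of "- a"] by auto
    then show ?thesis using False by blast
  qed
  then obtain N where N: "\<And>i. N \<le> i \<Longrightarrow> a \<in> X i \<longleftrightarrow> a \<in> Y" by blast
  obtain N' where N': "\<And>n. N' \<le> n \<Longrightarrow> of_nat N < \<epsilon> * 4 ^ n" using const_lt_pow4[OF \<epsilon>] by blast
  have "\<bar>dval (8 ^ n) (inpt (\<lambda>i. gpt (X i)) a) (inpt (\<lambda>_. gpt Y) a) s\<bar> < \<epsilon> * 4 ^ n" if "N' \<le> n" for n and s :: 'p
    unfolding dval_def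
    by (rule le_less_trans[OF sum_eventually_eq N'[OF that]]) (use N in \<open>auto simp: tv_def\<close>)
  then show "dns p (\<lambda>r. \<exists>N. \<forall>n\<ge>N. \<forall>s\<le>r. decs (8 ^ n) (inpt (\<lambda>i. gpt (X i)) a) (inpt (\<lambda>_. gpt Y) a) s \<longrightarrow>
     \<bar>dval (8 ^ n) (inpt (\<lambda>i. gpt (X i)) a) (inpt (\<lambda>_. gpt Y) a) s\<bar> < \<epsilon> * 4 ^ n)"
    by (intro dns_now) blast
qed (simp_all add: X Y D stone_gpt)

section \<open>Points selected by a name for an index\<close>

text \<open>\<open>I i m r\<close> says that at \<open>r\<close> the \<open>i\<close>-th point is
  the ground point \<open>X m\<close>, and \<open>I'\<close> does this for the second point of the
  pair. \<open>I_small\<close> concerns all ground sets \<open>A\<close> of indices instead of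
  elements of the algebra: subsets of the natural numbers in V are what unsplit and random reals
  control.\<close>

locale index_pairs =
  fixes p :: "'p::preorder" and X :: "nat \<Rightarrow> 'a::boolean_algebra set" and D :: "nat \<Rightarrow> 'a"
    and I I' :: "nat \<Rightarrow> nat \<Rightarrow> 'p fm"
  assumes X: "\<And>m. ultra (X m)" and DX: "\<And>m. D m \<in> X m"
    and D_disj: "\<And>m m'. m \<noteq> m' \<Longrightarrow> inf (D m) (D m') = bot"
    and I_le: "\<And>i m r s. I i m r \<Longrightarrow> s \<le> r \<Longrightarrow> I i m s" and I'_le: "\<And>i m r s. I' i m r \<Longrightarrow> s \<le> r \<Longrightarrow> I' i m s"
    and I_ex: "\<And>i. dns p (\<lambda>r. \<exists>m. I i m r)" and I'_ex: "\<And>i. dns p (\<lambda>r. \<exists>m. I' i m r)"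
    and I_uniq: "\<And>i m m' r. r \<le> p \<Longrightarrow> I i m r \<Longrightarrow> I i m' r \<Longrightarrow> m = m'"
    and I'_uniq: "\<And>i m m' r. r \<le> p \<Longrightarrow> I' i m r \<Longrightarrow> I' i m' r \<Longrightarrow> m = m'"
    and I_dist: "\<And>i j m m' r. r \<le> p \<Longrightarrow> i \<noteq> j \<Longrightarrow> I i m r \<Longrightarrow> I j m' r \<Longrightarrow> m \<noteq> m'"
    and II'_dist: "\<And>i j m m' r. r \<le> p \<Longrightarrow> I i m r \<Longrightarrow> I' j m' r \<Longrightarrow> m \<noteq> m'"
    and I_small: "\<And>A \<epsilon>. 0 < \<epsilon> \<Longrightarrow> dns p (\<lambda>r. \<exists>N. \<forall>n\<ge>N. \<forall>s\<le>r. \<forall>J J'.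
        (\<forall>i<8 ^ n. I i (J i) s \<and> I' i (J' i) s) \<longrightarrow>
        \<bar>\<Sum>i<8 ^ n. of_bool (J i \<in> A) - of_bool (J' i \<in> A) :: rat\<bar> < \<epsilon> * 4 ^ n)"
begin

text \<open>The ground ultrafilter whose index is named by \<open>K\<close>; the index need only be
  decided densely.\<close>

definition sel :: "(nat \<Rightarrow> 'p fm) \<Rightarrow> ('a, 'p) point" where
  "sel K = compr (\<lambda>a r. dns r (\<lambda>s. \<exists>m. K m s \<and> a \<in> X m))"

lemma mem_sel:
  assumes "\<And>m r s. K m r \<Longrightarrow> s \<le> r \<Longrightarrow> K m s" "\<And>m m' r. r \<le> p \<Longrightarrow> K m r \<Longrightarrow> K m' r \<Longrightarrow> m = m'"
    "r \<le> p" "K m r"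
  shows "mem geq a (sel K) r \<longleftrightarrow> a \<in> X m"
proof -
  have "mem geq a (sel K) r \<longleftrightarrow> dns r (\<lambda>s. \<exists>m. K m s \<and> a \<in> X m)" unfolding sel_def by simp
  also have "\<dots> \<longleftrightarrow> dns r (\<lambda>s. a \<in> X m)"
  proof (rule dns_cong)
    fix s assume s: "s \<le> r"
    have "K m s" "s \<le> p" using assms(1)[OF assms(4) s] order_trans[OF s assms(3)] .
    then show "(\<exists>m. K m s \<and> a \<in> X m) = (a \<in> X m)" using assms(2) by blast
  qed
  finally show ?thesis by simp
qed

lemma stone_sel:
  assumes "\<And>m r s. K m r \<Longrightarrow> s \<le> r \<Longrightarrow> K m s" "\<And>m m' r. r \<le> p \<Longrightarrow> K m r \<Longrightarrow> K m' r \<Longrightarrow> m = m'"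
    "dns p (\<lambda>r. \<exists>m. K m r)"
  shows "stone (sel K) p"
proof (rule reg_bind[OF reg_stone assms(3)], elim exE)
  fix r m assume r: "r \<le> p" "K m r"
  show "stone (sel K) r"
  proof (rule stone_if_ultra[OF X[of m]])
    fix s a assume s: "s \<le> r"
    show "mem geq a (sel K) s \<longleftrightarrow> a \<in> X m"
      by (rule mem_sel) (fact assms(1) assms(2) order_trans[OF s r(1)] assms(1)[OF r(2) s])+
  qed
qed

lemma mem_selI: "r \<le> p \<Longrightarrow> I i m r \<Longrightarrow> mem geq a (sel (I i)) r \<longleftrightarrow> a \<in> X m"
  by (rule mem_sel) (auto intro: I_le I_uniq)

lemma mem_selI': "r \<le> p \<Longrightarrow> I' i m r \<Longrightarrow> mem geq a (sel (I' i)) r \<longleftrightarrow> a \<in> X m"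
  by (rule mem_sel) (auto intro: I'_le I'_uniq)

definition dsel :: "nat \<Rightarrow> 'a \<Rightarrow> 'p fm" where
  "dsel i a = (\<lambda>r. dns r (\<lambda>s. \<exists>m. I i m s \<and> a = D m))"

lemma D_notin: "m \<noteq> m' \<Longrightarrow> D m \<notin> X m'"
  using ultra_disj[OF X DX, of m' "D m"] D_disj[of m' m] by blast

lemma dsel_obtain:
  assumes "dsel i a r" obtains s m where "s \<le> r" "I i m s" "a = D m"
  using assms unfolding dsel_def by (auto elim: dns_obtain)

lemma point_pairs_sel: "point_pairs p (\<lambda>i. sel (I i)) (\<lambda>i. sel (I' i)) dsel"
proof
  show "stone (sel (I i)) p" for i by (rule stone_sel) (auto intro: I_le I_uniq I_ex)
  show "stone (sel (I' i)) p" for i by (rule stone_sel) (auto intro: I'_le I'_uniq I'_ex)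
  show "reg (dsel i a)" for i a unfolding dsel_def by simp
  show "dns p (\<lambda>r. \<exists>a. dsel i a r)" for i
  proof (rule dns_mono[OF I_ex[of i] order_refl], elim exE)
    fix r m assume "I i m r"
    then have "dsel i (D m) r" unfolding dsel_def using I_le by (intro dns_now) blast
    then show "\<exists>a. dsel i a r" by blast
  qed
next
  fix i a b r assume r: "r \<le> p" "dsel i a r" "dsel i b r"
  obtain s m where s: "s \<le> r" "I i m s" "a = D m" using r(2) by (rule dsel_obtain)
  have "dsel i b s" using r(3) s(1) unfolding dsel_def by (rule dns_le)
  then obtain t m' where t: "t \<le> s" "I i m' t" "b = D m'" by (rule dsel_obtain)
  have "t \<le> p" using t s r order_trans by metis
  then show "a = b" using I_uniq[OF _ I_le[OF s(2) t(1)] t(2)] s t by blast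
next
  fix i j a b r assume r: "r \<le> p" "i \<noteq> j" "dsel i a r" "dsel j b r"
  obtain s m where s: "s \<le> r" "I i m s" "a = D m" using r(3) by (rule dsel_obtain)
  have "dsel j b s" using r(4) s(1) unfolding dsel_def by (rule dns_le)
  then obtain t m' where t: "t \<le> s" "I j m' t" "b = D m'" by (rule dsel_obtain)
  have "t \<le> p" using t s r order_trans by metis
  then show "inf a b = bot" using I_dist[OF _ r(2) I_le[OF s(2) t(1)] t(2)] s t D_disj by blast
next
  fix i a r assume r: "r \<le> p" "dsel i a r"
  show "mem geq a (sel (I i)) r"
  proof (rule reg_bind[OF reg_mem r(2)[unfolded dsel_def]], elim exE conjE)
    fix s m assume s: "s \<le> r" "I i m s" "a = D m"
    show "mem geq a (sel (I i)) s" using mem_selI[OF order_trans[OF s(1) r(1)] s(2)] DX s(3) by blast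
  qed
next
  fix i j a r assume r: "r \<le> p" "dsel i a r"
  obtain s m where s: "s \<le> r" "I i m s" "a = D m" using r(2) by (rule dsel_obtain)
  have sp: "s \<le> p" using s r order_trans by blast
  obtain t m' where t: "t \<le> s" "I' j m' t" using dns_le[OF I'_ex sp, of j] by (auto elim: dns_obtain)
  have tp: "t \<le> p" using t sp order_trans by blast
  have "m \<noteq> m'" using II'_dist[OF tp I_le[OF s(2) t(1)] t(2)] .
  then have "\<not> mem geq a (sel (I' j)) t" using mem_selI'[OF tp t(2)] s(3) D_notin by blast
  then show "\<not> mem geq a (sel (I' j)) r"
    by (rule contrapos_nn) (rule regD[OF reg_mem _ order_trans[OF t(1) s(1)]])
next
  fix a and \<epsilon> :: rat assume \<epsilon>: "0 < \<epsilon>"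
  let ?v = "inpt (\<lambda>i. sel (I i)) a" and ?v' = "inpt (\<lambda>i. sel (I' i)) a"
  show "dns p (\<lambda>r. \<exists>N. \<forall>n\<ge>N. \<forall>s\<le>r. decs (8 ^ n) ?v ?v' s \<longrightarrow> \<bar>dval (8 ^ n) ?v ?v' s\<bar> < \<epsilon> * 4 ^ n)"
  \<comment> \<open>The ground set to be tested is the trace of \<open>a\<close> on the points
    \<open>X m\<close>.\<close>
  proof (rule dns_mono[OF I_small[OF \<epsilon>, of "{m. a \<in> X m}"] order_refl], elim exE)
    fix r N
    assume r: "r \<le> p" and N: "\<forall>n\<ge>N. \<forall>s\<le>r. \<forall>J J'. (\<forall>i<8 ^ n. I i (J i) s \<and> I' i (J' i) s) \<longrightarrow>
        \<bar>\<Sum>i<8 ^ n. of_bool (J i \<in> {m. a \<in> X m}) - of_bool (J' i \<in> {m. a \<in> X m}) :: rat\<bar> < \<epsilon> * 4 ^ n"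
    have "\<bar>dval (8 ^ n) ?v ?v' s\<bar> < \<epsilon> * 4 ^ n" if n: "N \<le> n" "s \<le> r" "decs (8 ^ n) ?v ?v' s" for n s
    proof -
      have sp: "s \<le> p" using n(2) r order_trans by blast
      have "dns s (\<lambda>r. \<forall>i\<in>{..<8 ^ n}. \<exists>m m'. I i m r \<and> I' i m' r)"
      proof (rule dns_ball_finite)
        fix i show "dns s (\<lambda>r. \<exists>m m'. I i m r \<and> I' i m' r)"
        proof (rule dns_bind[OF dns_le[OF I_ex sp, of i]], elim exE)
          fix t m assume t: "t \<le> s" "I i m t"
          show "dns t (\<lambda>r. \<exists>m m'. I i m r \<and> I' i m' r)"
            by (rule dns_mono[OF dns_le[OF I'_ex sp, of i] t(1)]) (use I_le[OF t(2)] in blast)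
        qed
      qed (use I_le I'_le in blast)+
      then obtain t where t: "t \<le> s" "\<forall>i\<in>{..<8 ^ n}. \<exists>m m'. I i m t \<and> I' i m' t" by (rule dns_obtain)
      have "\<forall>i\<in>{..<8 ^ n}. \<exists>m. I i m t" "\<forall>i\<in>{..<8 ^ n}. \<exists>m. I' i m t" using t(2) by blast+
      then obtain J J' where "\<forall>i\<in>{..<8 ^ n}. I i (J i) t" "\<forall>i\<in>{..<8 ^ n}. I' i (J' i) t"
        using bchoice[of "{..<8 ^ n}" "\<lambda>i m. I i m t"] bchoice[of "{..<8 ^ n}" "\<lambda>i m. I' i m t"] by blast
      then have J: "\<And>i. i < 8 ^ n \<Longrightarrow> I i (J i) t" "\<And>i. i < 8 ^ n \<Longrightarrow> I' i (J' i) t" by simp_all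
      have tp: "t \<le> p" and tr: "t \<le> r" using t sp n(2) order_trans by blast+
      have "dval (8 ^ n) ?v ?v' s = dval (8 ^ n) ?v ?v' t"
        using dval_le[OF reg_mem reg_mem n(3) t(1)] by simp
      also have "\<dots> = (\<Sum>i<8 ^ n. of_bool (J i \<in> {m. a \<in> X m}) - of_bool (J' i \<in> {m. a \<in> X m}))"
        unfolding dval_def tv_def
        by (rule sum.cong) (use mem_selI[OF tp J(1)] mem_selI'[OF tp J(2)] in auto)
      finally show ?thesis using N n(1) tr J by simp
    qed
    then show "\<exists>N. \<forall>n\<ge>N. \<forall>s\<le>r. decs (8 ^ n) ?v ?v' s \<longrightarrow> \<bar>dval (8 ^ n) ?v ?v' s\<bar> < \<epsilon> * 4 ^ n" by blast
  qed
qed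

end

section \<open>Unsplit reals\<close>

definition upto_set :: "(nat, 'p::preorder) name \<Rightarrow> nat \<Rightarrow> nat set \<Rightarrow> 'p \<Rightarrow> bool" where
  "upto_set U M F r \<longleftrightarrow> F \<subseteq> {..<M} \<and> (\<forall>k<M. if k \<in> F then mem geq k U r else fnot (mem geq k U) r)"

text \<open>The increasing enumeration of \<open>U\<close>, starting from index 0. Besides
  \<open>m\<close> itself, all numbers below \<open>m\<close> must be decided, which makes the
  position of \<open>m\<close> known.\<close>

definition nth_elt :: "(nat, 'p::preorder) name \<Rightarrow> nat \<Rightarrow> nat \<Rightarrow> 'p fm" where
  "nth_elt U i m r \<longleftrightarrow> mem geq m U r \<and> (\<exists>F. upto_set U m F r \<and> card F = i)"

lemma upto_set_le:
  assumes "upto_set U M F r" "s \<le> r" shows "upto_set U M F s"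
  using assms(1) regD[OF reg_mem _ assms(2), of geq _ U] fnot_le[OF _ assms(2)]
  unfolding upto_set_def by presburger

lemma nth_elt_le: "nth_elt U i m r \<Longrightarrow> s \<le> r \<Longrightarrow> nth_elt U i m s"
  unfolding nth_elt_def by (auto intro: upto_set_le regD[OF reg_mem])

lemma upto_set_iff: "upto_set U M F r \<Longrightarrow> k < M \<Longrightarrow> k \<in> F \<longleftrightarrow> mem geq k U r"
  unfolding upto_set_def using fnotD by metis

lemma nth_elt_less:
  assumes "nth_elt U i m r" "nth_elt U j m' r" "m < m'" shows "i < j"
proof -
  obtain F F' where F: "upto_set U m F r" "card F = i" "mem geq m U r" and F': "upto_set U m' F' r" "card F' = j"
    using assms(1,2) unfolding nth_elt_def by blast
  have fin: "finite F'" "F \<subseteq> {..<m}" using F F' finite_subset unfolding upto_set_def by auto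
  have "F \<subset> F'"
  proof
    show "F \<subseteq> F'" using upto_set_iff[OF F(1)] upto_set_iff[OF F'(1)] assms(3) fin by (meson lessThan_iff less_trans subsetI subset_iff)
    have "m \<in> F'" using upto_set_iff[OF F'(1) assms(3)] F(3) by blast
    then show "F \<noteq> F'" using fin(2) by auto
  qed
  from psubset_card_mono[OF fin(1) this] show ?thesis using F(2) F'(2) by simp
qed

lemma nth_elt_ge: assumes "nth_elt U i m r" shows "i \<le> m"
proof -
  obtain F where "F \<subseteq> {..<m}" "card F = i" using assms unfolding nth_elt_def upto_set_def by blast
  then show ?thesis using card_mono[of "{..<m}" F] by simp
qed

text \<open>\<open>U\<close> being infinite, some condition puts a number beyond \<open>M\<close>
  into it. Deciding all numbers up to that one identifies the least such element, and nothing joins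
  \<open>F\<close> before it.\<close>

lemma nth_elt_next:
  assumes inf: "fnot (fin U) p" and r: "r \<le> p" "upto_set U M F r"
  shows "dns r (\<lambda>s. \<exists>n\<ge>M. upto_set U n F s \<and> mem geq n U s)"
  unfolding dns_def
proof (intro allI impI)
  fix q assume q: "q \<le> r"
  have nf: "\<not> fin U q" using inf order_trans[OF q r(1)] unfolding fnot_iff by blast
  have "\<exists>s\<le>q. \<exists>n\<ge>M. mem geq n U s"
  proof (rule ccontr)
    assume "\<not> ?thesis"
    then have lt: "n < M" if "s \<le> q" "mem geq n U s" for s n using that not_less by blast
    have "\<forall>n. \<forall>x\<le>s. mem geq n U x \<longrightarrow> n < M" if "s \<le> q" for s
      by (intro allI impI) (erule (1) lt[OF order_trans[OF _ that]])
    then have "fin U q" unfolding fin_def fex_iff fall_iff fimp_iff ground_iff by (intro dns_now exI[of _ M])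
    then show False using nf by blast
  qed
  then obtain s n where s: "s \<le> q" "M \<le> n" "mem geq n U s" by blast
  have "dns s (\<lambda>r. \<forall>k\<in>{..n}. dec (mem geq k U) r)" by (rule dns_dec_finite) auto
  then obtain t where t: "t \<le> s" "\<forall>k\<in>{..n}. dec (mem geq k U) t" by (rule dns_obtain)
  have tq: "t \<le> q" by (rule order_trans[OF t(1) s(1)])
  have tr: "t \<le> r" by (rule order_trans[OF tq q])
  define n0 where "n0 = (LEAST k. M \<le> k \<and> mem geq k U t)"
  have ex: "M \<le> n \<and> mem geq n U t" using s(2) regD[OF reg_mem s(3) t(1)] by blast
  have n0: "M \<le> n0" "mem geq n0 U t" "n0 \<le> n"
    using LeastI[of "\<lambda>k. M \<le> k \<and> mem geq k U t", OF ex] Least_le[of "\<lambda>k. M \<le> k \<and> mem geq k U t", OF ex]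
    unfolding n0_def by blast+
  have u: "upto_set U M F t" using upto_set_le[OF r(2) tr] .
  have "upto_set U n0 F t" unfolding upto_set_def
  proof (intro conjI allI impI)
    show "F \<subseteq> {..<n0}" using u n0(1) unfolding upto_set_def by auto
    fix k assume k: "k < n0"
    show "if k \<in> F then mem geq k U t else fnot (mem geq k U) t"
    proof (cases "k < M")
      case True
      then show ?thesis using u unfolding upto_set_def by blast
    next
      case False
      then have "\<not> mem geq k U t" using not_less_Least[of k "\<lambda>k. M \<le> k \<and> mem geq k U t"] k unfolding n0_def by simp
      moreover have "dec (mem geq k U) t" using t(2) k n0(3) by simp
      moreover have "k \<notin> F" using u False unfolding upto_set_def by auto
      ultimately show ?thesis unfolding dec_def by simp
    qed
  qed
  then show "\<exists>s\<le>q. \<exists>n\<ge>M. upto_set U n F s \<and> mem geq n U s" using tq n0 by blast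
qed

lemma nth_elt_ex:
  assumes inf: "fnot (fin U) p" shows "dns p (\<lambda>r. \<exists>m. nth_elt U i m r)"
proof -
  have *: "dns p (\<lambda>r. \<exists>M F. upto_set U M F r \<and> card F = i)" for i
  proof (induction i)
    case 0
    have "upto_set U 0 {} r" for r unfolding upto_set_def by simp
    then show ?case by (intro dns_now exI[of _ 0] exI[of _ "{}"]) auto
  next
    case (Suc i)
    then show ?case
    proof (rule dns_bind, elim exE conjE)
      fix r M F assume r: "r \<le> p" "upto_set U M F r" "card F = i"
      show "dns r (\<lambda>r. \<exists>M F. upto_set U M F r \<and> card F = Suc i)"
      proof (rule dns_mono[OF nth_elt_next[OF inf r(1,2)] order_refl], elim exE conjE)
        fix s n assume s: "s \<le> r" "M \<le> n" "upto_set U n F s" "mem geq n U s"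
        have F: "F \<subseteq> {..<n}" using s(3) unfolding upto_set_def by blast
        have "upto_set U (Suc n) (insert n F) s"
          using s(3,4) unfolding upto_set_def by (auto simp: less_Suc_eq)
        moreover have "card (insert n F) = Suc i" using F r(3) finite_subset[OF F] by (subst card_insert_disjoint) auto
        ultimately show "\<exists>M F. upto_set U M F s \<and> card F = Suc i" by blast
      qed
    qed
  qed
  show ?thesis
  proof (rule dns_bind[OF *[of i]], elim exE conjE)
    fix r M F assume r: "r \<le> p" "upto_set U M F r" "card F = i"
    show "dns r (\<lambda>r. \<exists>m. nth_elt U i m r)"
      by (rule dns_mono[OF nth_elt_next[OF inf r(1,2)] order_refl]) (use r(3) in \<open>auto simp: nth_elt_def\<close>)
  qed
qed

text \<open>A ground set \<open>A\<close> does not split \<open>U\<close>: almost all of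
  \<open>U\<close> lies on one side of it. So from some index on, two consecutive elements of
  \<open>U\<close> agree about \<open>A\<close>, and the signed count is bounded.\<close>

lemma index_pairs_unsplit:
  fixes D :: "nat \<Rightarrow> 'a::boolean_algebra" and p :: "'p::preorder"
  assumes XD: "\<And>m. ultra (X m)" "\<And>m. D m \<in> X m" "\<And>m m'. m \<noteq> m' \<Longrightarrow> inf (D m) (D m') = bot"
    and U: "unsplit_over_ground U p"
  shows "index_pairs p X D (\<lambda>i. nth_elt U (2 * i)) (\<lambda>i. nth_elt U (2 * i + 1))"
proof
  have inf: "fnot (fin U) p" using U unfolding unsplit_over_ground_def fand_iff by blast
  show "dns p (\<lambda>r. \<exists>m. nth_elt U (2 * i) m r)" "dns p (\<lambda>r. \<exists>m. nth_elt U (2 * i + 1) m r)" for i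
    using nth_elt_ex[OF inf] by blast+
  have uniq: "m = m'" if "nth_elt U i m r" "nth_elt U i m' r" for i m m' and r :: 'p
    using nth_elt_less[OF that] nth_elt_less[OF that(2,1)] by (metis linorder_neqE_nat less_irrefl)
  then show "\<And>i m m' r. nth_elt U (2 * i) m r \<Longrightarrow> nth_elt U (2 * i) m' r \<Longrightarrow> m = m'"
    "\<And>i m m' r. nth_elt U (2 * i + 1) m r \<Longrightarrow> nth_elt U (2 * i + 1) m' r \<Longrightarrow> m = m'" by blast+
  have dist: "i = j" if ij: "nth_elt U i m r" "nth_elt U j m r" for i j m and r :: 'p
  proof -
    obtain F F' where F: "upto_set U m F r" "card F = i" "upto_set U m F' r" "card F' = j"
      using ij unfolding nth_elt_def by blast
    have "F = F'" using upto_set_iff[OF F(1)] upto_set_iff[OF F(3)] F(1,3) unfolding upto_set_def by blast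
    then show ?thesis using F by simp
  qed
  show "m \<noteq> m'" if "i \<noteq> j" "nth_elt U (2 * i) m r" "nth_elt U (2 * j) m' r" for i j m m' and r :: 'p
    using dist[of "2 * i" m r "2 * j"] that by auto
  show "m \<noteq> m'" if "nth_elt U (2 * i) m r" "nth_elt U (2 * j + 1) m' r" for i j m m' and r :: 'p
    using dist[of "2 * i" m r "2 * j + 1"] that by (metis even_mult_iff even_plus_one_iff even_numeral)
  fix A :: "nat set" and \<epsilon> :: rat assume \<epsilon>: "0 < \<epsilon>"
  let ?R = "\<lambda>r. \<exists>N. \<forall>n\<ge>N. \<forall>s\<le>r. \<forall>J J'.
        (\<forall>i<8 ^ n. nth_elt U (2 * i) (J i) s \<and> nth_elt U (2 * i + 1) (J' i) s) \<longrightarrow>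
        \<bar>\<Sum>i<8 ^ n. of_bool (J i \<in> A) - of_bool (J' i \<in> A) :: rat\<bar> < \<epsilon> * 4 ^ n"
  \<comment> \<open>\<open>b\<close> tells on which side of \<open>A\<close> the elements of
    \<open>U\<close> from \<open>m0\<close> on lie. The element with index j is at least j, so
    \<open>m0\<close> also bounds the number of exceptional pairs.\<close>
  have key: "?R r" if h: "\<And>n s. s \<le> r \<Longrightarrow> mem geq n U s \<Longrightarrow> m0 \<le> n \<Longrightarrow> (n \<in> A \<longleftrightarrow> b)" for r m0 b
  proof -
    obtain N where N: "\<And>n. N \<le> n \<Longrightarrow> of_nat m0 < \<epsilon> * 4 ^ n" using const_lt_pow4[OF \<epsilon>] by blast
    have "\<bar>\<Sum>i<8 ^ n. of_bool (J i \<in> A) - of_bool (J' i \<in> A) :: rat\<bar> < \<epsilon> * 4 ^ n"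
      if n: "N \<le> n" "s \<le> r" and J: "\<forall>i<8 ^ n. nth_elt U (2 * i) (J i) s \<and> nth_elt U (2 * i + 1) (J' i) s" for n s J J'
    proof (rule le_less_trans[OF sum_eventually_eq N[OF n(1)]])
      fix i assume i: "i < 8 ^ n" "m0 \<le> i"
      have 1: "nth_elt U (2 * i) (J i) s" "nth_elt U (2 * i + 1) (J' i) s" using J i(1) by blast+
      have 2: "m0 \<le> J i" "m0 \<le> J' i" using nth_elt_ge[OF 1(1)] nth_elt_ge[OF 1(2)] i(2) by auto
      have "J i \<in> A \<longleftrightarrow> b" "J' i \<in> A \<longleftrightarrow> b"
        using h[OF n(2) _ 2(1)] h[OF n(2) _ 2(2)] 1 unfolding nth_elt_def by blast+
      then show "of_bool (J i \<in> A) = (of_bool (J' i \<in> A) :: rat)" by simp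
    qed auto
    then show ?thesis by blast
  qed
  have "dns p (\<lambda>r. fin (compr (\<lambda>n. fand (mem geq n U) (ground (n \<in> A)))) r \<or>
      fin (compr (\<lambda>n. fand (mem geq n U) (ground (n \<notin> A)))) r)"
    using U unfolding unsplit_over_ground_def fand_iff[of _ _ p] fall_iff f_or_iff by blast
  note d = this
  have f: "dns r (\<lambda>s. \<exists>m. \<forall>n. \<forall>q\<le>s. mem geq n U q \<and> P n \<longrightarrow> n < m)"
    if "fin (compr (\<lambda>n. fand (mem geq n U) (ground (P n)))) r" for P and r :: 'p
  proof -
    have "mem geq n (compr (\<lambda>n. fand (mem geq n U) (ground (P n)))) = fand (mem geq n U) (ground (P n))" for n
      by (rule mem_geq_compr) simp
    then show ?thesis using that unfolding fin_def fex_iff fall_iff fimp_iff ground_iff by simp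
  qed
  show "dns p ?R"
  proof (rule dns_bind[OF d], elim disjE)
    fix r assume r: "fin (compr (\<lambda>n. fand (mem geq n U) (ground (n \<in> A)))) r"
    show "dns r ?R"
    proof (rule dns_mono[OF f[OF r] order_refl], elim exE)
      fix s m assume "\<forall>n. \<forall>q\<le>s. mem geq n U q \<and> n \<in> A \<longrightarrow> n < m"
      then show "?R s" by (intro key[of s m False]) (auto simp: not_less[symmetric])
    qed
  next
    fix r assume r: "fin (compr (\<lambda>n. fand (mem geq n U) (ground (n \<notin> A)))) r"
    show "dns r ?R"
    proof (rule dns_mono[OF f[OF r] order_refl], elim exE)
      fix s m assume "\<forall>n. \<forall>q\<le>s. mem geq n U q \<and> n \<notin> A \<longrightarrow> n < m"
      then show "?R s" by (intro key[of s m True]) (auto simp: not_less[symmetric])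
    qed
  qed
qed (use XD nth_elt_le in auto)

section \<open>Initial segments of a new real\<close>

definition cut :: "(nat \<times> bool, 'p::preorder) name \<Rightarrow> bool list \<Rightarrow> 'p fm" where
  "cut x s r \<longleftrightarrow> (\<forall>k<length s. mem geq (k, s ! k) x r)"

lemma cut_le: "cut x s r \<Longrightarrow> q \<le> r \<Longrightarrow> cut x s q"
  unfolding cut_def by (auto intro: regD[OF reg_mem])

lemma in_cantor_ex:
  assumes "in_cantor x p" shows "dns p (\<lambda>r. \<exists>b. mem geq (n, b) x r)"
proof -
  have "dns p (\<lambda>r. \<exists>b. mem geq (n, b) x r \<and> (\<forall>b'. \<forall>q\<le>r. mem geq (n, b') x q \<longrightarrow> b' = b))"
    using assms unfolding in_cantor_def fall_iff fex_iff fand_iff fimp_iff ground_iff by blast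
  then show ?thesis by (rule dns_mono) auto
qed

lemma in_cantor_uniq:
  assumes "in_cantor x p" "r \<le> p" "mem geq (n, b) x r" "mem geq (n, b') x r" shows "b = b'"
proof -
  have "dns p (\<lambda>r. \<exists>b. mem geq (n, b) x r \<and> (\<forall>b'. \<forall>q\<le>r. mem geq (n, b') x q \<longrightarrow> b' = b))"
    using assms unfolding in_cantor_def fall_iff fex_iff fand_iff fimp_iff ground_iff by blast
  from dns_le[OF this assms(2)] obtain s c where s: "s \<le> r" "\<forall>b'. \<forall>q\<le>s. mem geq (n, b') x q \<longrightarrow> b' = c"
    by (elim dns_obtain exE conjE) (rule that)
  then show ?thesis using regD[OF reg_mem assms(3) s(1)] regD[OF reg_mem assms(4) s(1)] by blast
qed

lemma cut_ex:
  assumes "in_cantor x p" shows "dns p (\<lambda>r. \<exists>s. length s = n \<and> cut x s r)"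
proof -
  have "dns p (\<lambda>r. \<forall>k\<in>{..<n}. \<exists>b. mem geq (k, b) x r)"
    by (rule dns_ball_finite) (auto intro: in_cantor_ex[OF assms] regD[OF reg_mem])
  then show ?thesis
  proof (rule dns_mono)
    fix r assume "\<forall>k\<in>{..<n}. \<exists>b. mem geq (k, b) x r"
    from bchoice[OF this] obtain g where "\<forall>k\<in>{..<n}. mem geq (k, g k) x r" ..
    then have "cut x (map g [0..<n]) r" by (simp add: cut_def)
    then show "\<exists>s. length s = n \<and> cut x s r" by (intro exI[of _ "map g [0..<n]"]) simp
  qed simp
qed

lemma cut_nth:
  assumes "in_cantor x p" "r \<le> p" "cut x s r" "cut x t r" "k < length s" "k < length t"
  shows "s ! k = t ! k"
  using in_cantor_uniq[OF assms(1,2)] assms(3-6) unfolding cut_def by blast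

lemma cut_take:
  assumes "in_cantor x p" "r \<le> p" "cut x s r" "cut x t r" "length s \<le> length t"
  shows "s = take (length s) t"
  by (rule nth_equalityI) (use assms cut_nth[OF assms(1-4)] in auto)

section \<open>Cohen reals\<close>

definition ext :: "bool list \<Rightarrow> bool list \<Rightarrow> bool" where
  "ext t s \<longleftrightarrow> (\<exists>u. t = s @ u)"

lemma ext_refl: "ext s s"
  by (simp add: ext_def)

lemma ext_trans: "ext t s \<Longrightarrow> ext s r \<Longrightarrow> ext t r"
  unfolding ext_def by auto

lemma ext_take: "ext t (take n t)"
  unfolding ext_def by (metis append_take_drop_id)

definition flip :: "nat \<Rightarrow> bool list \<Rightarrow> bool list" where
  "flip i s = s[i := \<not> s ! i]"

lemma flip_append: "i < length s \<Longrightarrow> flip i (s @ u) = flip i s @ u"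
  unfolding flip_def by (simp add: list_update_append nth_append)

lemma flip_append2: "length s \<le> i \<Longrightarrow> ext (flip i (s @ u)) s"
  unfolding flip_def ext_def by (simp add: list_update_append)

lemma flip_take: "i < length s \<Longrightarrow> take (Suc i) (flip i s) = take i s @ [\<not> s ! i]"
  unfolding flip_def by (simp add: take_Suc_conv_app_nth)

definition finmap_of :: "bool list \<Rightarrow> nat \<rightharpoonup> bool" where
  "finmap_of s = (\<lambda>n. if n < length s then Some (s ! n) else None)"

text \<open>Genericity is stated for finite partial functions. A set of strings that is dense under
  extension gives a dense set of those, because every finite partial function is contained in a
  string.\<close>

lemma cohen_meets:
  assumes c: "cohen_over_ground x p" and L: "\<And>t. \<exists>s\<in>L. ext s t"
  shows "dns p (\<lambda>r. \<exists>s\<in>L. cut x s r)"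
proof -
  have "cohen_dense (finmap_of ` L)" unfolding cohen_dense_def
  proof (intro conjI ballI allI impI)
    fix s assume "s \<in> finmap_of ` L"
    then obtain l where "s = finmap_of l" by blast
    then have "dom s \<subseteq> {..<length l}" by (auto simp: finmap_of_def split: if_splits)
    then show "finite (dom s)" using finite_subset by blast
  next
    fix t :: "nat \<rightharpoonup> bool" assume "finite (dom t)"
    then obtain M where M: "dom t \<subseteq> {..<M}" using finite_nat_bounded by blast
    \<comment> \<open>Positions below \<open>M\<close> outside the domain of \<open>t\<close>
      receive an unspecified value.\<close>
    define t' where "t' = map (\<lambda>k. the (t k)) [0..<M]"
    obtain s where s: "s \<in> L" "ext s t'" using L by blast
    have "t \<subseteq>\<^sub>m finmap_of s" unfolding map_le_def
    proof
      fix k assume k: "k \<in> dom t"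
      then have "k < length t'" "t' ! k = the (t k)" using M by (auto simp: t'_def)
      then show "t k = finmap_of s k" using s(2) k by (auto simp: finmap_of_def ext_def nth_append)
    qed
    then show "\<exists>s\<in>finmap_of ` L. t \<subseteq>\<^sub>m s" using s(1) by blast
  qed
  moreover have "\<forall>D. \<forall>q\<le>p. cohen_dense D \<longrightarrow> dns q (\<lambda>r. \<exists>s. s \<in> D \<and> (\<forall>n b. \<forall>q\<le>r. s n = Some b \<longrightarrow> mem geq (n, b) x q))"
    using c unfolding cohen_over_ground_def fand_iff fall_iff fimp_iff fex_iff ground_iff by (elim conjE)
  ultimately have "dns p (\<lambda>r. \<exists>s. s \<in> finmap_of ` L \<and> (\<forall>n b. \<forall>q\<le>r. s n = Some b \<longrightarrow> mem geq (n, b) x q))"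
    by blast
  then show ?thesis
  proof (rule dns_mono)
    fix r assume "\<exists>s. s \<in> finmap_of ` L \<and> (\<forall>n b. \<forall>q\<le>r. s n = Some b \<longrightarrow> mem geq (n, b) x q)"
    then obtain l where l: "l \<in> L" "\<forall>n b. \<forall>q\<le>r. finmap_of l n = Some b \<longrightarrow> mem geq (n, b) x q" by blast
    have "cut x l r" unfolding cut_def using l(2) by (auto simp: finmap_of_def)
    then show "\<exists>s\<in>L. cut x s r" using l(1) by blast
  qed simp
qed

lemma tree_ext:
  fixes node :: "bool list \<Rightarrow> 'a::order"
  assumes step: "\<And>s b. node (s @ [b]) \<le> node s" and "ext t s" shows "node t \<le> node s"
proof -
  have "node (s @ u) \<le> node s" for u
  proof (induction u rule: rev_induct)
    case (snoc b u)
    have "node ((s @ u) @ [b]) \<le> node (s @ u)" by (rule step)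
    then show ?case using snoc order_trans by (metis append.assoc)
  qed simp
  then show ?thesis using assms(2) unfolding ext_def by blast
qed

text \<open>\<open>H s a\<close> says that the string \<open>s\<close> puts \<open>a\<close> into
  the ultrafilter. The tree alone would not do: a branch that is new in V[G] has no ultrafilter
  chosen for it in V, so \<open>H\<close> is a name for one in the forcing with strings, and it is
  evaluated along \<open>x\<close>. \<open>H_node\<close> ties it to the branch,
  \<open>H_dec\<close> is exploited through genericity.\<close>

locale cohen_tree =
  fixes node :: "bool list \<Rightarrow> 'a::boolean_algebra" and x :: "(nat \<times> bool, 'p::preorder) name" and p :: 'p
    and H :: "bool list \<Rightarrow> 'a \<Rightarrow> bool"
  assumes node_step: "\<And>s b. node (s @ [b]) \<le> node s"
    and node_disj: "\<And>s. inf (node (s @ [True])) (node (s @ [False])) = bot"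
    and cohen: "cohen_over_ground x p"
    and H_ext: "\<And>s t a. H s a \<Longrightarrow> ext t s \<Longrightarrow> H t a" and H_top: "\<And>s. H s top" and H_bot: "\<And>s. \<not> H s bot"
    and H_up: "\<And>s a b. H s a \<Longrightarrow> a \<le> b \<Longrightarrow> H s b" and H_inf: "\<And>s a b. H s a \<Longrightarrow> H s b \<Longrightarrow> H s (inf a b)"
    and H_node: "\<And>s a. H s a \<Longrightarrow> inf a (node s) \<noteq> bot" and H_dec: "\<And>s a. \<exists>t. ext t s \<and> (H t a \<or> H t (- a))"
begin

lemma cantor: "in_cantor x p"
  using cohen unfolding cohen_over_ground_def fand_iff by blast

lemma node_ext: "ext t s \<Longrightarrow> node t \<le> node s"
  by (rule tree_ext[OF node_step])

lemma cut_ext: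
  assumes "r \<le> p" "cut x s r" "cut x t r" "length s \<le> length t" shows "ext t s"
  using cut_take[OF cantor assms] ext_take[of t "length s"] by simp

text \<open>The ultrafilter that \<open>H\<close> gives along the real obtained from
  \<open>x\<close> by \<open>g\<close>. Initial segments shorter than \<open>l\<close> are left out,
  since they may lack the digits that \<open>g\<close> changes.\<close>

definition pt :: "(bool list \<Rightarrow> bool list) \<Rightarrow> nat \<Rightarrow> ('a, 'p) point" where
  "pt g l = compr (\<lambda>a r. dns r (\<lambda>q. \<exists>s. l \<le> length s \<and> cut x s q \<and> H (g s) a))"

lemma mem_pt: "mem geq a (pt g l) r \<longleftrightarrow> dns r (\<lambda>q. \<exists>s. l \<le> length s \<and> cut x s q \<and> H (g s) a)"
  unfolding pt_def by simp

text \<open>\<open>g\<close> rewrites a prefix of length \<open>l\<close> and copies the rest. It is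
  therefore coherent on initial segments, and extensions of \<open>g s\<close> come from extensions
  of \<open>s\<close>, so the modified real inherits genericity.\<close>

definition admissible :: "(bool list \<Rightarrow> bool list) \<Rightarrow> nat \<Rightarrow> bool" where
  "admissible g l \<longleftrightarrow> (\<forall>s u. l \<le> length s \<longrightarrow> g (s @ u) = g s @ u)"

lemma admissible_id: "admissible (\<lambda>s. s) 0"
  by (simp add: admissible_def)

lemma admissible_flip: "admissible (flip i) (Suc i)"
  unfolding admissible_def using flip_append Suc_le_lessD by blast

lemma admissible_ext: "admissible g l \<Longrightarrow> l \<le> length s \<Longrightarrow> ext t s \<Longrightarrow> ext (g t) (g s)"
  unfolding admissible_def ext_def by blast

text \<open>Initial segments of \<open>x\<close> are comparable, which gives closure under meets.
  For the ultrafilter property, the strings \<open>s\<close> for which \<open>H (g s)\<close>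
  contains \<open>a\<close> or \<open>- a\<close> are dense, so \<open>x\<close> meets them.\<close>

lemma stone_pt:
  assumes g: "admissible g l" shows "stone (pt g l) p"
  unfolding stone_iff fnot_iff mem_pt
proof (intro conjI allI impI)
  show "dns p (\<lambda>q. \<exists>s. l \<le> length s \<and> cut x s q \<and> H (g s) top)"
    by (rule dns_mono[OF cut_ex[OF cantor, of l] order_refl]) (use H_top in auto)
  show "\<not> dns r (\<lambda>q. \<exists>s. l \<le> length s \<and> cut x s q \<and> H (g s) bot)" for r
    using H_bot by (auto elim: dns_obtain)
  show "dns r (\<lambda>q. \<exists>s. l \<le> length s \<and> cut x s q \<and> H (g s) b)"
    if ab: "dns r (\<lambda>q. \<exists>s. l \<le> length s \<and> cut x s q \<and> H (g s) a)" "a \<le> b" for r a b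
    by (rule dns_mono[OF ab(1) order_refl]) (use H_up[OF _ ab(2)] in blast)
  show "dns r (\<lambda>q. \<exists>s. l \<le> length s \<and> cut x s q \<and> H (g s) (inf a b))"
    if r: "r \<le> p" and a: "dns r (\<lambda>q. \<exists>s. l \<le> length s \<and> cut x s q \<and> H (g s) a)"
      and b: "dns r (\<lambda>q. \<exists>s. l \<le> length s \<and> cut x s q \<and> H (g s) b)" for r a b
  proof (rule dns_bind[OF a], elim exE conjE)
    fix q s assume q: "q \<le> r" and s: "l \<le> length s" "cut x s q" "H (g s) a"
    show "dns q (\<lambda>q. \<exists>s. l \<le> length s \<and> cut x s q \<and> H (g s) (inf a b))"
    proof (rule dns_mono[OF b q], elim exE conjE)
      fix y t assume y: "y \<le> q" and t: "l \<le> length t" "cut x t y" "H (g t) b"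
      have yp: "y \<le> p" using y q r order_trans by metis
      have s': "cut x s y" using cut_le[OF s(2) y] .
      show "\<exists>s. l \<le> length s \<and> cut x s y \<and> H (g s) (inf a b)"
      proof (cases "length s \<le> length t")
        case True
        then have "H (g t) a" using H_ext[OF s(3) admissible_ext[OF g s(1) cut_ext[OF yp s' t(2)]]] by blast
        then show ?thesis using t H_inf by blast
      next
        case False
        then have "ext s t" using cut_ext[OF yp t(2) s'] by simp
        then have "H (g s) b" using H_ext[OF t(3) admissible_ext[OF g t(1)]] by blast
        then show ?thesis using s s' H_inf by blast
      qed
    qed
  qed
  show "dns p (\<lambda>r. dns r (\<lambda>q. \<exists>s. l \<le> length s \<and> cut x s q \<and> H (g s) a) \<or>
      dns r (\<lambda>q. \<exists>s. l \<le> length s \<and> cut x s q \<and> H (g s) (- a)))" for a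
  proof (rule dns_mono[OF cohen_meets[OF cohen, of "{s. l \<le> length s \<and> (H (g s) a \<or> H (g s) (- a))}"] order_refl])
    fix t
    \<comment> \<open>Padding to length at least \<open>l\<close>, from where on \<open>g\<close>
      commutes with appending.\<close>
    let ?t = "t @ replicate l False"
    obtain w where w: "ext w (g ?t)" "H w a \<or> H w (- a)" using H_dec by blast
    then obtain u where u: "w = g ?t @ u" unfolding ext_def by blast
    have "l \<le> length ?t" by simp
    then have "g (?t @ u) = w" using g unfolding admissible_def u by blast
    then have "?t @ u \<in> {s. l \<le> length s \<and> (H (g s) a \<or> H (g s) (- a))}" using w(2) by auto
    moreover have "ext (?t @ u) t" unfolding ext_def by auto
    ultimately show "\<exists>s\<in>{s. l \<le> length s \<and> (H (g s) a \<or> H (g s) (- a))}. ext s t" by blast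
  next
    fix r assume "\<exists>s\<in>{s. l \<le> length s \<and> (H (g s) a \<or> H (g s) (- a))}. cut x s r"
    then obtain s where s: "l \<le> length s" "H (g s) a \<or> H (g s) (- a)" "cut x s r" by blast
    have "dns r (\<lambda>q. \<exists>s. l \<le> length s \<and> cut x s q \<and> H (g s) b)" if "H (g s) b" for b
      using s(1) that cut_le[OF s(3)] by (intro dns_now) blast
    then show "dns r (\<lambda>q. \<exists>s. l \<le> length s \<and> cut x s q \<and> H (g s) a) \<or>
      dns r (\<lambda>q. \<exists>s. l \<le> length s \<and> cut x s q \<and> H (g s) (- a))" using s(2) by blast
  qed
qed

text \<open>\<open>H\<close> only promises elements that meet the node, not the node itself. But if
  the complement of \<open>node (g s)\<close> were in the ultrafilter, some extension
  \<open>w\<close> of \<open>g s\<close> would have it in \<open>H w\<close>, although it is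
  disjoint from \<open>node w\<close>.\<close>

lemma mem_pt_node:
  assumes g: "admissible g l" and r: "r \<le> p" and s: "l \<le> length s" "cut x s r"
  shows "mem geq (node (g s)) (pt g l) r"
proof -
  have st: "stone (pt g l) r" using regD[OF reg_stone stone_pt[OF g] r] .
  have "fnot (mem geq (- node (g s)) (pt g l)) r" unfolding fnot_iff
  proof (intro allI impI notI)
    fix q assume q: "q \<le> r" "mem geq (- node (g s)) (pt g l) q"
    from q(2)[unfolded mem_pt] obtain y t where y: "y \<le> q" and t: "l \<le> length t" "cut x t y" "H (g t) (- node (g s))"
      by (elim dns_obtain exE conjE) (rule that)
    have yr: "y \<le> r" and yp: "y \<le> p" using y q r order_trans by metis+
    have s': "cut x s y" using cut_le[OF s(2) yr] .
    have "\<exists>w. ext w (g s) \<and> H w (- node (g s))"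
    proof (cases "length s \<le> length t")
      case True
      then show ?thesis using admissible_ext[OF g s(1) cut_ext[OF yp s' t(2)]] t(3) by blast
    next
      case False
      then have "ext s t" using cut_ext[OF yp t(2) s'] by simp
      then show ?thesis using H_ext[OF t(3) admissible_ext[OF g t(1)]] ext_refl by blast
    qed
    then obtain w where w: "ext w (g s)" "H w (- node (g s))" by blast
    have "inf (- node (g s)) (node w) \<le> inf (- node (g s)) (node (g s))"
      by (rule inf_mono[OF order_refl node_ext[OF w(1)]])
    then show False using H_node[OF w(2)] by (simp add: bot_unique)
  qed
  then have "mem geq (- (- node (g s))) (pt g l) r" using stone_compl[OF st] by blast
  then show ?thesis by simp
qed

text \<open>The sibling node through which the flipped branch leaves \<open>x\<close>; the length
  \<open>Suc i\<close> is the least that contains digit \<open>i\<close>. Siblings at different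
  levels are disjoint from each other, and all of them are disjoint from the nodes along
  \<open>x\<close> beyond their level.\<close>

definition dflip :: "nat \<Rightarrow> 'a \<Rightarrow> 'p fm" where
  "dflip i a = (\<lambda>r. dns r (\<lambda>q. \<exists>s. length s = Suc i \<and> cut x s q \<and> a = node (flip i s)))"

lemma dflip_obtain:
  assumes "dflip i a r" obtains q s where "q \<le> r" "length s = Suc i" "cut x s q" "a = node (flip i s)"
  using assms unfolding dflip_def by (elim dns_obtain exE conjE) (rule that)

lemma flip_disj:
  assumes "length s = Suc i" "ext t s" shows "inf (node (flip i s)) (node t) = bot"
proof -
  have f: "flip i s = take i s @ [\<not> s ! i]"
    using flip_take[of i s] assms(1) by (simp add: flip_def)
  have s: "s = take i s @ [s ! i]" using assms(1) by (metis lessI take_Suc_conv_app_nth take_all order_refl)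
  have "inf (node (flip i s)) (node s) = bot"
    unfolding f by (subst (3) s) (cases "s ! i"; use node_disj[of "take i s"] in \<open>simp add: inf_commute\<close>)
  moreover have "inf (node (flip i s)) (node t) \<le> inf (node (flip i s)) (node s)"
    by (rule inf_mono[OF order_refl node_ext[OF assms(2)]])
  ultimately show ?thesis by (simp add: bot_unique)
qed

text \<open>Some initial segment \<open>t\<close> of \<open>x\<close> puts \<open>a\<close> or
  \<open>- a\<close> into the ultrafilter. Flipping a digit at a position from
  \<open>length t\<close> on leaves \<open>t\<close> intact, so all later points agree with the
  limit point about \<open>a\<close>.\<close>

lemma point_pairs_cohen: "point_pairs p (\<lambda>i. pt (flip i) (Suc i)) (\<lambda>_. pt (\<lambda>s. s) 0) dflip"
proof
  show "stone (pt (flip i) (Suc i)) p" "stone (pt (\<lambda>s. s) 0) p" for i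
    using stone_pt admissible_flip admissible_id by blast+
  show "reg (dflip i a)" for i a unfolding dflip_def by simp
  show "dns p (\<lambda>r. \<exists>a. dflip i a r)" for i
  proof (rule dns_mono[OF cut_ex[OF cantor, of "Suc i"] order_refl], elim exE conjE)
    fix r s assume s: "length s = Suc i" "cut x s r"
    have "dflip i (node (flip i s)) r" unfolding dflip_def using s(1) cut_le[OF s(2)] by (intro dns_now) blast
    then show "\<exists>a. dflip i a r" by blast
  qed
next
  fix i a b r assume r: "r \<le> p" "dflip i a r" "dflip i b r"
  obtain q s where q: "q \<le> r" and s: "length s = Suc i" "cut x s q" "a = node (flip i s)"
    using r(2) by (rule dflip_obtain)
  have "dflip i b q" using r(3) q unfolding dflip_def by (rule dns_le)
  then obtain y t where y: "y \<le> q" and t: "length t = Suc i" "cut x t y" "b = node (flip i t)" by (rule dflip_obtain)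
  have "y \<le> p" using y q r order_trans by metis
  from cut_take[OF cantor this cut_le[OF s(2) y] t(2)] have "s = t" using s(1) t(1) by simp
  then show "a = b" using s t by simp
next
  have *: "inf a b = bot" if ij: "i < j" and r: "r \<le> p" "dflip i a r" "dflip j b r" for i j a b r
  proof -
    obtain q s where q: "q \<le> r" and s: "length s = Suc i" "cut x s q" "a = node (flip i s)"
      using r(2) by (rule dflip_obtain)
    have "dflip j b q" using r(3) q unfolding dflip_def by (rule dns_le)
    then obtain y t where y: "y \<le> q" and t: "length t = Suc j" "cut x t y" "b = node (flip j t)" by (rule dflip_obtain)
    have "y \<le> p" using y q r order_trans by metis
    from cut_ext[OF this cut_le[OF s(2) y] t(2)] have "ext t s" using s(1) t(1) ij by simp
    then obtain u where "t = s @ u" unfolding ext_def by blast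
    then have "ext (flip j t) s" using flip_append2[of s j u] s(1) ij by simp
    then show ?thesis using flip_disj[OF s(1)] s t by simp
  qed
  fix i j :: nat and a b r assume "r \<le> p" "i \<noteq> j" "dflip i a r" "dflip j b r"
  then show "inf a b = bot" using *[of i j r a b] *[of j i r b a] by (metis inf_commute linorder_neqE_nat)
next
  fix i a r assume r: "r \<le> p" "dflip i a r"
  show "mem geq a (pt (flip i) (Suc i)) r"
  proof (rule reg_bind[OF reg_mem r(2)[unfolded dflip_def]], elim exE conjE)
    fix q s assume s: "q \<le> r" "length s = Suc i" "cut x s q" "a = node (flip i s)"
    show "mem geq a (pt (flip i) (Suc i)) q"
      using mem_pt_node[OF admissible_flip order_trans[OF s(1) r(1)] _ s(3)] s(2,4) by simp
  qed
next
  fix i :: nat and a r assume r: "r \<le> p" "dflip i a r"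
  obtain q s where q: "q \<le> r" and s: "length s = Suc i" "cut x s q" "a = node (flip i s)"
    using r(2) by (rule dflip_obtain)
  have qp: "q \<le> p" using q r order_trans by blast
  have m: "mem geq (node s) (pt (\<lambda>s. s) 0) q" using mem_pt_node[OF admissible_id qp _ s(2)] by simp
  have "inf (node s) a = bot" using flip_disj[OF s(1) ext_refl] s(3) by (simp add: inf_commute)
  then have "\<not> mem geq a (pt (\<lambda>s. s) 0) q"
    using stone_disj[OF regD[OF reg_stone stone_pt[OF admissible_id] qp] m] by blast
  then show "\<not> mem geq a (pt (\<lambda>s. s) 0) r"
    by (rule contrapos_nn) (rule regD[OF reg_mem _ q])
next
  fix a and \<epsilon> :: rat assume \<epsilon>: "0 < \<epsilon>"
  let ?v = "inpt (\<lambda>i. pt (flip i) (Suc i)) a" and ?v' = "inpt (\<lambda>_. pt (\<lambda>s. s) 0) a"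
  have ev: "mem geq b (pt (flip i) (Suc i)) r" "mem geq b (pt (\<lambda>s. s) 0) r"
    if r: "r \<le> p" and s: "cut x s r" "H s b" "length s \<le> i" for r s b i
  proof -
    have "dns r (\<lambda>q. \<exists>s. length s = Suc i \<and> cut x s q)" using dns_le[OF cut_ex[OF cantor] r] .
    then show "mem geq b (pt (flip i) (Suc i)) r" unfolding mem_pt
    proof (rule dns_mono)
      fix q assume q: "q \<le> r" "\<exists>s. length s = Suc i \<and> cut x s q"
      then obtain t where t: "length t = Suc i" "cut x t q" by blast
      have "ext t s" using cut_ext[OF order_trans[OF q(1) r] cut_le[OF s(1) q(1)] t(2)] s(3) t(1) by simp
      then have "ext (flip i t) s" using flip_append2[OF s(3)] unfolding ext_def[of t] by blast
      then have "H (flip i t) b" using H_ext[OF s(2)] by blast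
      then show "\<exists>s. Suc i \<le> length s \<and> cut x s q \<and> H (flip i s) b" using t by (intro exI[of _ t]) auto
    qed simp
    show "mem geq b (pt (\<lambda>s. s) 0) r" unfolding mem_pt
      using s(2) cut_le[OF s(1)] by (intro dns_now) blast
  qed
  show "dns p (\<lambda>r. \<exists>N. \<forall>n\<ge>N. \<forall>s\<le>r. decs (8 ^ n) ?v ?v' s \<longrightarrow> \<bar>dval (8 ^ n) ?v ?v' s\<bar> < \<epsilon> * 4 ^ n)"
  proof (rule dns_mono[OF cohen_meets[OF cohen, of "{s. H s a \<or> H s (- a)}"] order_refl])
    show "\<exists>s\<in>{s. H s a \<or> H s (- a)}. ext s t" for t using H_dec[of t a] by blast
    fix r assume r: "r \<le> p" "\<exists>s\<in>{s. H s a \<or> H s (- a)}. cut x s r"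
    then obtain t where t: "H t a \<or> H t (- a)" "cut x t r" by blast
    obtain N where N: "\<And>n. N \<le> n \<Longrightarrow> of_nat (length t) < \<epsilon> * 4 ^ n" using const_lt_pow4[OF \<epsilon>] by blast
    have eq: "tv (?v i) s = tv (?v' i) s" if s: "s \<le> r" and i: "length t \<le> i" for s i
    proof -
      have sp: "s \<le> p" and ts: "cut x t s" using s r(1) order_trans cut_le[OF t(2)] by blast+
      from t(1) show ?thesis
      proof
        assume "H t a"
        then show ?thesis using ev[OF sp ts _ i] by (simp add: tv_def)
      next
        assume h: "H t (- a)"
        have "\<not> mem geq a u s" if "stone u p" "mem geq (- a) u s" for u
          using stone_disj[OF regD[OF reg_stone that(1) sp] that(2), of a] by simp
        then show ?thesis
          using ev[OF sp ts h i] stone_pt[OF admissible_id] stone_pt[OF admissible_flip] by (simp add: tv_def)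
      qed
    qed
    have "\<bar>dval (8 ^ n) ?v ?v' s\<bar> < \<epsilon> * 4 ^ n" if n: "N \<le> n" "s \<le> r" for n s
      unfolding dval_def
    proof (rule le_less_trans[OF sum_eventually_eq N[OF n(1)]])
      show "tv (?v i) s = tv (?v' i) s" if "length t \<le> i" for i by (rule eq[OF n(2) that])
      show "\<bar>tv (?v i) s - tv (?v' i) s\<bar> \<le> 1" for i by (simp add: tv_def)
    qed
    then show "\<exists>N. \<forall>n\<ge>N. \<forall>s\<le>r. decs (8 ^ n) ?v ?v' s \<longrightarrow> \<bar>dval (8 ^ n) ?v ?v' s\<bar> < \<epsilon> * 4 ^ n" by blast
  qed
qed

end

text \<open>The elements to be avoided at \<open>s\<close> are those disjoint from
  \<open>node s\<close>, so that the ultrafilter concentrates on the branch. The order is extension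
  of strings, a poset of V unrelated to \<open>'p\<close>.\<close>

lemma cohen_tree_exists:
  assumes "\<And>s. node s \<noteq> bot" "\<And>s b. node (s @ [b]) \<le> node s"
    "\<And>s. inf (node (s @ [True])) (node (s @ [False])) = bot" and "cohen_over_ground x p"
  shows "\<exists>H. cohen_tree node x p H"
proof -
  have node_ext: "node t \<le> node s" if "ext t s" for s t by (rule tree_ext[OF assms(2) that])
  show ?thesis
  proof (rule generic_ultrafilter[of ext "\<lambda>s a. inf a (node s) = bot"])
    show "ext s s" for s by (rule ext_refl)
    show "ext s t \<Longrightarrow> ext t r \<Longrightarrow> ext s r" for s t r by (rule ext_trans)
    show "inf a (node t) = bot" if "inf a (node s) = bot" "ext t s" for a s t
      using inf_mono[OF order_refl node_ext[OF that(2)], of a] that(1) by (simp add: bot_unique)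
    show "inf b (node s) = bot" if "inf a (node s) = bot" "b \<le> a" for a b s
      using inf_mono[OF that(2) order_refl, of "node s"] that(1) by (simp add: bot_unique)
    show "inf (sup a b) (node s) = bot" if "inf a (node s) = bot" "inf b (node s) = bot" for a b s
      using that by (simp add: inf_sup_distrib2)
    show "inf bot (node s) = bot" for s by simp
    show "\<not> inf top (node s) = bot" for s using assms(1) by simp
    fix H
    assume H: "\<And>p q a. H p a \<Longrightarrow> ext q p \<Longrightarrow> H q a" "\<And>p. H p top" "\<And>p. \<not> H p bot"
      "\<And>p a b. H p a \<Longrightarrow> a \<le> b \<Longrightarrow> H p b" "\<And>p a b. H p a \<Longrightarrow> H p b \<Longrightarrow> H p (inf a b)"
      "\<And>p a. H p a \<Longrightarrow> inf a (node p) \<noteq> bot" "\<And>p a. \<exists>q. ext q p \<and> (H q a \<or> H q (- a))"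
    show ?thesis
      by (rule exI[of _ H], unfold_locales) (fact assms H)+
  qed
qed

section \<open>Random reals\<close>

lemma prob_space_cantor: "prob_space cantor_measure"
  unfolding cantor_measure_def by (intro prob_space_PiM prob_space_measure_pmf)

lemma space_cantor [simp]: "space cantor_measure = UNIV"
  unfolding cantor_measure_def by (simp add: space_PiM)

lemma coordinate_measurable [measurable]:
  "(\<lambda>x. x i) \<in> cantor_measure \<rightarrow>\<^sub>M measure_pmf (bernoulli_pmf (1/2))"
  unfolding cantor_measure_def by (rule measurable_component_singleton) simp

lemma coordinate_function_measurable [measurable]:
  "(\<lambda>x. f (x i) :: real) \<in> borel_measurable cantor_measure"
  by (rule measurable_compose[OF coordinate_measurable]) simp

lemma distr_coordinate:
  "distr cantor_measure (measure_pmf (bernoulli_pmf (1/2))) (\<lambda>x. x i) = measure_pmf (bernoulli_pmf (1/2))"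
  unfolding cantor_measure_def
  using distr_PiM_component[of UNIV "\<lambda>_. measure_pmf (bernoulli_pmf (1/2))" i] by (simp add: prob_space_measure_pmf)

lemma indep_coordinates:
  "prob_space.indep_vars cantor_measure (\<lambda>_. measure_pmf (bernoulli_pmf (1/2))) (\<lambda>i x. x i) (UNIV :: nat set)"
proof -
  interpret prob_space cantor_measure by (rule prob_space_cantor)
  have "distr cantor_measure (\<Pi>\<^sub>M i\<in>UNIV. measure_pmf (bernoulli_pmf (1/2))) (\<lambda>x. \<lambda>i\<in>UNIV. x i) =
      distr cantor_measure cantor_measure (\<lambda>x. x)"
    by (rule distr_cong) (auto simp: cantor_measure_def)
  also have "\<dots> = (\<Pi>\<^sub>M i\<in>UNIV. distr cantor_measure (measure_pmf (bernoulli_pmf (1/2))) (\<lambda>x. x i))"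
    unfolding distr_coordinate distr_id[unfolded id_def] by (simp add: cantor_measure_def)
  finally show ?thesis
    by (rule iffD2[OF indep_vars_iff_distr_eq_PiM'[OF UNIV_not_empty coordinate_measurable]])
qed

lemma expectation_coordinate:
  "prob_space.expectation cantor_measure (\<lambda>x. (if x i then 1 else - 1) * t :: real) = 0"
proof -
  have "prob_space.expectation cantor_measure (\<lambda>x. (if x i then 1 else - 1) * t) =
     integral\<^sup>L (distr cantor_measure (measure_pmf (bernoulli_pmf (1/2))) (\<lambda>x. x i)) (\<lambda>b. (if b then 1 else - 1) * t)"
    by (subst integral_distr[OF coordinate_measurable]) auto
  also have "\<dots> = 0" unfolding distr_coordinate by (subst integral_bernoulli_pmf) auto
  finally show ?thesis .
qed

text \<open>The exponent in Hoeffding's inequality is the square of \<open>\<epsilon>\<close> 4 ^ n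
  divided by 2 * 8 ^ n, which grows like 2 ^ n since 16 / 8 = 2. Deviations of order 4 ^ n among 8 ^
  n signs are thus summably rare.\<close>

lemma cantor_deviation:
  fixes t :: "nat \<Rightarrow> real"
  assumes t: "\<And>i. \<bar>t i\<bar> \<le> 1" and \<epsilon>: "0 < \<epsilon>"
  shows "measure cantor_measure {x. \<epsilon> * 4 ^ n \<le> \<bar>\<Sum>i<8 ^ n. (if x i then 1 else - 1) * t i\<bar>} \<le> 4 / \<epsilon>\<^sup>2 * (1 / 2) ^ n"
proof -
  interpret prob_space cantor_measure by (rule prob_space_cantor)
  have "indep_vars (\<lambda>_. measure_pmf (bernoulli_pmf (1/2))) (\<lambda>i x. x i) {..<(8::nat) ^ n}"
    by (rule indep_vars_subset[OF indep_coordinates]) auto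
  then have ind: "indep_vars (\<lambda>_. borel) (\<lambda>i x. (if x i then 1 else - 1) * t i) {..<(8::nat) ^ n}"
    by (rule indep_vars_compose2[where Y = "\<lambda>i b. (if b then 1 else - 1) * t i"]) simp
  interpret Hoeffding_ineq cantor_measure "{..<(8::nat) ^ n}" "\<lambda>i x. (if x i then 1 else - 1) * t i" "\<lambda>_. -1" "\<lambda>_. 1"
     "\<Sum>i<8 ^ n. expectation (\<lambda>x. (if x i then 1 else - 1) * t i)"
  proof (unfold_locales)
    show "AE x in cantor_measure. (if x i then 1 else - 1) * t i \<in> {- 1..1}" for i
      using t[of i] by (auto simp: abs_le_iff)
  qed (use ind in auto)
  define y where "y = \<epsilon>\<^sup>2 / 2 * 2 ^ n"
  have y: "0 < y" using \<epsilon> by (simp add: y_def)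
  have "measure cantor_measure {x. \<epsilon> * 4 ^ n \<le> \<bar>\<Sum>i<8 ^ n. (if x i then 1 else - 1) * t i\<bar>} \<le>
     2 * exp (- 2 * (\<epsilon> * 4 ^ n)\<^sup>2 / (\<Sum>i<(8::nat) ^ n. (1 - (- 1))\<^sup>2))"
    using Hoeffding_ineq_abs_ge[of "\<epsilon> * 4 ^ n", unfolded expectation_coordinate] \<epsilon> by simp
  also have "- 2 * (\<epsilon> * 4 ^ n)\<^sup>2 / (\<Sum>i<(8::nat) ^ n. (1 - (- 1))\<^sup>2) = - y"
  proof -
    have "((4::real) ^ n)\<^sup>2 = 2 ^ n * 8 ^ n" by (simp add: power2_eq_square flip: power_mult_distrib)
    then show ?thesis by (simp add: y_def power_mult_distrib)
  qed
  \<comment> \<open>The crude bound 1 / y for exp (- y) already decays geometrically in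
    \<open>n\<close>.\<close>
  also have "2 * exp (- y) \<le> 2 * (1 / y)"
  proof -
    have "y \<le> exp y" using exp_ge_add_one_self[of y] by linarith
    then show ?thesis using y by (simp add: exp_minus field_simps)
  qed
  also have "\<dots> = 4 / \<epsilon>\<^sup>2 * (1 / 2) ^ n" by (simp add: y_def power_one_over)
  finally show ?thesis .
qed

text \<open>Borel-Cantelli for the bounds of \<open>cantor_deviation\<close>. The limsup is written
  with indices \<open>N + k\<close>, so that union and intersection range over all natural numbers
  as in a Borel code.\<close>

lemma cantor_deviation_null:
  fixes t :: "nat \<Rightarrow> real"
  assumes t: "\<And>i. \<bar>t i\<bar> \<le> 1" and \<epsilon>: "0 < \<epsilon>"
  shows "(\<Inter>N. \<Union>k. {x. \<epsilon> * 4 ^ (N + k) \<le> \<bar>\<Sum>i<8 ^ (N + k). (if x i then 1 else - 1) * t i\<bar>}) \<in> null_sets cantor_measure"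
proof -
  interpret prob_space cantor_measure by (rule prob_space_cantor)
  define E where "E n = {x. \<epsilon> * 4 ^ n \<le> \<bar>\<Sum>i<8 ^ n. (if x i then 1 else - 1) * t i\<bar>}" for n
  have [measurable]: "E n \<in> sets cantor_measure" for n
  proof -
    have "{x \<in> space cantor_measure. \<epsilon> * 4 ^ n \<le> \<bar>\<Sum>i<8 ^ n. (if x i then 1 else - 1) * t i\<bar>} \<in> sets cantor_measure"
      using coordinate_function_measurable[of "\<lambda>b. if b then 1 else - 1"] by measurable
    then show ?thesis by (simp add: E_def)
  qed
  have "summable (\<lambda>n. measure cantor_measure (E n))"
  proof (rule summable_comparison_test)
    show "summable (\<lambda>n. 4 / \<epsilon>\<^sup>2 * (1 / 2 :: real) ^ n)" by (intro summable_mult summable_geometric) simp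
    show "\<exists>N. \<forall>n\<ge>N. norm (measure cantor_measure (E n)) \<le> 4 / \<epsilon>\<^sup>2 * (1 / 2) ^ n"
      using cantor_deviation[of t \<epsilon>] assms unfolding E_def by auto
  qed
  then have "limsup E \<in> null_sets cantor_measure"
    by (intro borel_cantelli_limsup1) (auto simp: less_top[symmetric])
  moreover have "limsup E = (\<Inter>N. \<Union>k. E (N + k))"
  proof -
    have "(\<Union>k\<in>{N..}. E k) = (\<Union>k. E (N + k))" for N
      by (auto simp: le_iff_add) (metis le_add1 le_iff_add atLeast_iff)
    then show ?thesis by (simp add: limsup_INF_SUP)
  qed
  ultimately show ?thesis by (simp add: E_def)
qed

text \<open>Codes have no constructor for the empty set. The two basic sets at coordinate 0 cover
  the space, and the complement of their union is used to pad unions that must be indexed by all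
  natural numbers.\<close>

definition empty_code :: borel_code where
  "empty_code = CCompl (CUnion (\<lambda>k. CBasic 0 (k = 0)))"

definition cylinder_code :: "bool list \<Rightarrow> borel_code" where
  "cylinder_code l = CCompl (CUnion (\<lambda>i. if i < length l then CBasic i (\<not> l ! i) else empty_code))"

text \<open>An event that depends on the first \<open>n\<close> digits, as a union of cylinders
  along an enumeration of all strings.\<close>

definition event_code :: "(bool list \<Rightarrow> bool) \<Rightarrow> nat \<Rightarrow> borel_code" where
  "event_code P n = CUnion (\<lambda>k. let l = from_nat k in if length l = n \<and> P l then cylinder_code l else empty_code)"

lemma code_set_empty_code: "code_set empty_code = {}"
proof -
  have "x \<in> (\<Union>k::nat. {x. x 0 = (k = 0)})" for x :: "nat \<Rightarrow> bool"
    by (cases "x 0") (auto intro: exI[of _ 0] exI[of _ 1])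
  then have "(\<Union>k::nat. {x :: nat \<Rightarrow> bool. x 0 = (k = 0)}) = UNIV" by blast
  then show ?thesis unfolding empty_code_def code_set.simps by simp
qed

lemma code_set_cylinder_code: "code_set (cylinder_code l) = {x. \<forall>i<length l. x i = l ! i}"
  unfolding cylinder_code_def by (auto simp: code_set_empty_code split: if_splits)

lemma code_set_event_code: "code_set (event_code P n) = {x. P (map x [0..<n])}"
proof -
  have 1: "x \<in> code_set (cylinder_code l) \<longleftrightarrow> l = map x [0..<n]" if "length l = n" for x l
  proof
    assume "x \<in> code_set (cylinder_code l)"
    then show "l = map x [0..<n]" using that unfolding code_set_cylinder_code by (auto intro: nth_equalityI)
  next
    assume l: "l = map x [0..<n]"
    show "x \<in> code_set (cylinder_code l)" unfolding l code_set_cylinder_code by simp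
  qed
  have "x \<in> code_set (event_code P n) \<longleftrightarrow> (\<exists>l :: bool list. length l = n \<and> P l \<and> x \<in> code_set (cylinder_code l))" for x
  proof -
    have "x \<in> code_set (event_code P n) \<longleftrightarrow>
      (\<exists>k. length (from_nat k :: bool list) = n \<and> P (from_nat k) \<and> x \<in> code_set (cylinder_code (from_nat k)))"
      unfolding event_code_def by (auto simp: Let_def code_set_empty_code split: if_splits) 
    then show ?thesis by (metis from_nat_to_nat)
  qed
  then have "x \<in> code_set (event_code P n) \<longleftrightarrow> P (map x [0..<n])" for x
    using 1[of _ x] by (metis length_map length_upt minus_nat.diff_0)
  then show ?thesis by blast
qed

lemma in_code_empty_code:
  assumes "in_cantor x p" "r \<le> p" shows "\<not> in_code x empty_code r"
proof
  assume "in_code x empty_code r"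
  then have n: "fnot (fex (\<lambda>k. mem geq (0, k = (0::nat)) x)) r" unfolding empty_code_def by simp
  have "dns r (\<lambda>s. \<exists>b. mem geq (0, b) x s)" using dns_le[OF in_cantor_ex[OF assms(1)] assms(2)] .
  then have "fex (\<lambda>k. mem geq (0, k = (0::nat)) x) r" unfolding fex_iff
  proof (rule dns_mono)
    fix s assume "\<exists>b. mem geq (0, b) x s"
    then obtain b where "mem geq (0, b) x s" ..
    then show "\<exists>k. mem geq (0, k = (0::nat)) x s" by (cases b) (auto intro: exI[of _ 0] exI[of _ 1])
  qed simp
  then show False using n by (auto dest: fnotD)
qed

lemma in_code_cylinder_code:
  assumes "in_cantor x p" "r \<le> p" "cut x l r" shows "in_code x (cylinder_code l) r"
proof -
  have "\<not> in_code x (if i < length l then CBasic i (\<not> l ! i) else empty_code) s" if s: "s \<le> r" for i s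
  proof -
    have sp: "s \<le> p" using s assms(2) order_trans by blast
    show ?thesis
    proof (cases "i < length l")
      case True
      then have "mem geq (i, l ! i) x s" using cut_le[OF assms(3) s] unfolding cut_def by blast
      then show ?thesis using in_cantor_uniq[OF assms(1) sp] True by auto
    qed (simp add: in_code_empty_code[OF assms(1) sp])
  qed
  then show ?thesis unfolding cylinder_code_def in_code.simps fnot_iff fex_iff
    by (blast elim: dns_obtain intro: order_trans)
qed

text \<open>Once the digits in question are decided, the reinterpretation in V[G] follows the
  meaning in V: the cylinder of \<open>l\<close> occurs in the union at index
  \<open>to_nat l\<close>.\<close>

lemma in_code_event_code:
  assumes "in_cantor x p" "r \<le> p" "cut x l r" "length l = n" "P l" shows "in_code x (event_code P n) r"
  unfolding event_code_def in_code.simps fex_iff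
proof (intro dns_now exI[of _ "to_nat l"])
  fix s assume s: "s \<le> r"
  have "in_code x (cylinder_code l) s"
    using in_code_cylinder_code[OF assms(1) order_trans[OF s assms(2)] cut_le[OF assms(3) s]] .
  then show "in_code x (let l = from_nat (to_nat l) in if length l = n \<and> P l then cylinder_code l else empty_code) s"
    using assms by (simp add: Let_def)
qed

text \<open>\<open>c\<close> is the role in the pair: \<open>True\<close> for the positive and
  \<open>False\<close> for the negative point mass. Both roles read the same digit, so they receive
  different members of the pair.\<close>

definition pick_index :: "(nat \<times> bool, 'p::preorder) name \<Rightarrow> bool \<Rightarrow> nat \<Rightarrow> nat \<Rightarrow> 'p fm" where
  "pick_index x c i m r \<longleftrightarrow> (\<exists>b. mem geq (i, b) x r \<and> m = (if b = c then 2 * i else 2 * i + 1))"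

text \<open>Digit \<open>i\<close> attaches a sign to a number \<open>t i\<close> that lies in V, so
  the count is a random signed sum. The reals for which it reaches \<open>\<epsilon>\<close> 4 ^ n
  infinitely often form a null set coded in V, and \<open>x\<close> avoids it.\<close>

lemma index_pairs_random:
  fixes D :: "nat \<Rightarrow> 'a::boolean_algebra" and p :: "'p::preorder"
  assumes XD: "\<And>m. ultra (X m)" "\<And>m. D m \<in> X m" "\<And>m m'. m \<noteq> m' \<Longrightarrow> inf (D m) (D m') = bot"
    and x: "random_over_ground x p"
  shows "index_pairs p X D (pick_index x True) (pick_index x False)"
proof
  have cantor: "in_cantor x p" using x unfolding random_over_ground_def fand_iff by blast
  have uniq: "b = b'" if "r \<le> p" "mem geq (i, b) x r" "mem geq (i, b') x r" for i b b' r
    using in_cantor_uniq[OF cantor that] .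
  have "pick_index x c i m s" if ch: "pick_index x c i m r" and s: "s \<le> r" for c i m and r s :: 'p
  proof -
    obtain b where "mem geq (i, b) x r" "m = (if b = c then 2 * i else 2 * i + 1)"
      using ch unfolding pick_index_def by blast
    then show ?thesis unfolding pick_index_def using regD[OF reg_mem _ s, of geq "(i, b)" x] by blast
  qed
  then show "\<And>i m r s. pick_index x True i m r \<Longrightarrow> s \<le> r \<Longrightarrow> pick_index x True i m s"
    "\<And>i m r s. pick_index x False i m r \<Longrightarrow> s \<le> r \<Longrightarrow> pick_index x False i m s" by blast+
  have "dns p (\<lambda>r. \<exists>m. pick_index x c i m r)" for c i
    by (rule dns_mono[OF in_cantor_ex[OF cantor, of i] order_refl]) (auto simp: pick_index_def)
  then show "\<And>i. dns p (\<lambda>r. \<exists>m. pick_index x True i m r)" "\<And>i. dns p (\<lambda>r. \<exists>m. pick_index x False i m r)" by blast+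
  have "m = m'" if ch: "r \<le> p" "pick_index x c i m r" "pick_index x c i m' r" for c i m m' r
  proof -
    obtain b b' where b: "mem geq (i, b) x r" "m = (if b = c then 2 * i else 2 * i + 1)"
      "mem geq (i, b') x r" "m' = (if b' = c then 2 * i else 2 * i + 1)"
      using ch unfolding pick_index_def by blast
    then show ?thesis using uniq[OF ch(1) b(1,3)] by simp
  qed
  then show "\<And>i m m' r. r \<le> p \<Longrightarrow> pick_index x True i m r \<Longrightarrow> pick_index x True i m' r \<Longrightarrow> m = m'"
    "\<And>i m m' r. r \<le> p \<Longrightarrow> pick_index x False i m r \<Longrightarrow> pick_index x False i m' r \<Longrightarrow> m = m'" by blast+
  show "m \<noteq> m'" if "r \<le> p" "i \<noteq> j" "pick_index x True i m r" "pick_index x True j m' r" for i j m m' r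
    using that(2-) unfolding pick_index_def by (auto split: if_splits; presburger)
  show "m \<noteq> m'" if "r \<le> p" "pick_index x True i m r" "pick_index x False j m' r" for i j m m' r
  proof
    assume "m = m'"
    then have "i = j" using that(2,3) unfolding pick_index_def by (auto split: if_splits; presburger)
    then show False using \<open>m = m'\<close> that(2,3) uniq[OF that(1)] unfolding pick_index_def by (metis n_not_Suc_n Suc_eq_plus1)
  qed
  fix A :: "nat set" and \<epsilon> :: rat assume \<epsilon>: "0 < \<epsilon>"
  \<comment> \<open>The values are -1, 0 and 1; as integers they serve both the rational counts in
    V[G] and the real sums of the probability estimate.\<close>
  define t :: "nat \<Rightarrow> int" where "t i = of_bool (2 * i \<in> A) - of_bool (2 * i + 1 \<in> A)" for i
  define P where "P n l \<longleftrightarrow> \<epsilon> * 4 ^ n \<le> rat_of_int \<bar>\<Sum>i<8 ^ n. (if l ! i then 1 else - 1) * t i\<bar>" for n and l :: "bool list"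
  define c where "c n = event_code (P n) (8 ^ n)" for n
  \<comment> \<open>The limsup of the events, its intersection over \<open>N\<close> written as the
    complement of a union of complements.\<close>
  define lim where "lim = CCompl (CUnion (\<lambda>N. CCompl (CUnion (\<lambda>k. c (N + k)))))"
  have "code_set (c n) = {x. real_of_rat \<epsilon> * 4 ^ n \<le> \<bar>\<Sum>i<8 ^ n. (if x i then 1 else - 1) * real_of_int (t i)\<bar>}" for n
  proof -
    have "P n (map x [0..<8 ^ n]) \<longleftrightarrow> real_of_rat \<epsilon> * 4 ^ n \<le> \<bar>\<Sum>i<8 ^ n. (if x i then 1 else - 1) * real_of_int (t i)\<bar>" for x
    proof -
      have "(\<Sum>i<8 ^ n. (if map x [0..<8 ^ n] ! i then 1 else - 1) * t i) = (\<Sum>i<8 ^ n. (if x i then 1 else - 1) * t i)"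
        by (rule sum.cong) auto
      then have "P n (map x [0..<8 ^ n]) \<longleftrightarrow> \<epsilon> * 4 ^ n \<le> rat_of_int \<bar>\<Sum>i<8 ^ n. (if x i then 1 else - 1) * t i\<bar>"
        unfolding P_def by simp
      also have "\<dots> \<longleftrightarrow> real_of_rat (\<epsilon> * 4 ^ n) \<le> real_of_rat (rat_of_int \<bar>\<Sum>i<8 ^ n. (if x i then 1 else - 1) * t i\<bar>)"
        by (simp only: of_rat_less_eq)
      also have "real_of_rat (\<epsilon> * 4 ^ n) = real_of_rat \<epsilon> * 4 ^ n" by (simp add: of_rat_mult of_rat_power)
      also have "real_of_rat (rat_of_int \<bar>\<Sum>i<8 ^ n. (if x i then 1 else - 1) * t i\<bar>) =
          \<bar>\<Sum>i<8 ^ n. (if x i then 1 else - 1) * real_of_int (t i)\<bar>"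
      proof -
        have "real_of_int (\<Sum>i<8 ^ n. (if x i then 1 else - 1) * t i) = (\<Sum>i<8 ^ n. (if x i then 1 else - 1) * real_of_int (t i))"
          unfolding of_int_sum by (rule sum.cong) auto
        then show ?thesis by (subst of_rat_of_int_eq) (simp only: of_int_abs)
      qed
      finally show ?thesis .
    qed
    then show ?thesis unfolding c_def code_set_event_code by simp
  qed
  then have "code_set lim = (\<Inter>N. \<Union>k. {x. real_of_rat \<epsilon> * 4 ^ (N + k) \<le>
      \<bar>\<Sum>i<8 ^ (N + k). (if x i then 1 else - 1) * real_of_int (t i)\<bar>})"
    unfolding lim_def by simp
  also have "\<dots> \<in> null_sets cantor_measure"
    by (rule cantor_deviation_null) (use \<epsilon> in \<open>auto simp: t_def\<close>)
  finally have null: "code_set lim \<in> null_sets cantor_measure" .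
  have "\<forall>c. \<forall>q\<le>p. code_set c \<in> null_sets cantor_measure \<longrightarrow> (\<forall>r\<le>q. \<not> in_code x c r)"
    using x unfolding random_over_ground_def fand_iff fall_iff fimp_iff fnot_iff ground_iff by (elim conjE)
  then have "\<forall>r\<le>p. \<not> in_code x lim r" using null by blast
  \<comment> \<open>Lying outside \<open>lim\<close> is a doubly negated existential statement;
    regularity removes the negations and yields the index \<open>N\<close> densely.\<close>
  then have "fnot (fnot (fex (\<lambda>N. fnot (fex (\<lambda>k. in_code x (c (N + k))))))) p"
    unfolding lim_def in_code.simps fnot_iff[of "fnot _"] .
  from fnot_fnotD[OF reg_fex this]
  have d: "dns p (\<lambda>r. \<exists>N. fnot (fex (\<lambda>k. in_code x (c (N + k)))) r)" by (simp only: fex_iff)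
  show "dns p (\<lambda>r. \<exists>N. \<forall>n\<ge>N. \<forall>s\<le>r. \<forall>J J'. (\<forall>i<8 ^ n. pick_index x True i (J i) s \<and> pick_index x False i (J' i) s) \<longrightarrow>
        \<bar>\<Sum>i<8 ^ n. of_bool (J i \<in> A) - of_bool (J' i \<in> A) :: rat\<bar> < \<epsilon> * 4 ^ n)"
  proof (rule dns_mono[OF d order_refl], elim exE, intro exI allI impI)
    fix r N n s J J'
    assume r: "r \<le> p" and N: "fnot (fex (\<lambda>k. in_code x (c (N + k)))) r" and n: "N \<le> n" and s: "s \<le> r"
      and J: "\<forall>i<8 ^ n. pick_index x True i (J i) s \<and> pick_index x False i (J' i) s"
    have sp: "s \<le> p" using s r order_trans by blast
    \<comment> \<open>The initial segment of \<open>x\<close> is read off from the indices of the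
      positive masses: \<open>2 * i\<close> stands for the digit \<open>True\<close>.\<close>
    define l where "l = map (\<lambda>i. J i = 2 * i) [0..<8 ^ n]"
    have *: "mem geq (i, l ! i) x s \<and> of_bool (J i \<in> A) - of_bool (J' i \<in> A) = rat_of_int ((if l ! i then 1 else - 1) * t i)"
      if i: "i < 8 ^ n" for i
    proof -
      obtain b b' where b: "mem geq (i, b) x s" "J i = (if b then 2 * i else 2 * i + 1)"
        "mem geq (i, b') x s" "J' i = (if b' then 2 * i + 1 else 2 * i)"
        using J i unfolding pick_index_def by auto
      have "b = b'" using uniq[OF sp b(1,3)] .
      moreover have "l ! i = b" using i b(2) by (simp add: l_def)
      ultimately show ?thesis using b by (simp add: t_def)
    qed
    have cut: "cut x l s" unfolding cut_def using * by (simp add: l_def)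
    have "\<not> P n l"
    proof
      assume "P n l"
      then have "in_code x (c (N + (n - N))) y" if "y \<le> s" for y
        using in_code_event_code[OF cantor order_trans[OF that sp] cut_le[OF cut that]] n by (simp add: c_def l_def)
      then have "fex (\<lambda>k. in_code x (c (N + k))) s" unfolding fex_iff by (intro dns_now) blast
      then show False using N s unfolding fnot_iff by blast
    qed
    moreover have "(\<Sum>i<8 ^ n. of_bool (J i \<in> A) - of_bool (J' i \<in> A)) = rat_of_int (\<Sum>i<8 ^ n. (if l ! i then 1 else - 1) * t i)"
      unfolding of_int_sum by (rule sum.cong) (use * in auto)
    ultimately show "\<bar>\<Sum>i<8 ^ n. of_bool (J i \<in> A) - of_bool (J' i \<in> A) :: rat\<bar> < \<epsilon> * 4 ^ n"
      unfolding P_def by simp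
  qed
qed (use XD in auto)

section \<open>Pairs of points in the extension\<close>

text \<open>The nodes that leave the constantly \<open>False\<close> branch by a
  \<open>True\<close>, one at each level.\<close>

lemma tree_antichain:
  fixes node :: "bool list \<Rightarrow> 'a::boolean_algebra"
  assumes "\<And>s. node s \<noteq> bot" and step: "\<And>s b. node (s @ [b]) \<le> node s"
    and disj: "\<And>s. inf (node (s @ [True])) (node (s @ [False])) = bot"
  obtains X D where "\<And>m::nat. ultra (X m)" "\<And>m. (D m :: 'a) \<in> X m" "\<And>m m'. m \<noteq> m' \<Longrightarrow> inf (D m) (D m') = bot"
proof -
  define z where "z n = replicate n False" for n :: nat
  have z: "z n @ [False] = z (Suc n)" for n by (simp add: z_def replicate_append_same)
  have mono: "node (z n) \<le> node (z m)" if "m \<le> n" for m n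
    using that
  proof (induction n rule: dec_induct)
    case (step n)
    then show ?case using assms(2)[of "z n" False] unfolding z by (metis order_trans)
  qed simp
  define D where "D n = node (z n @ [True])" for n
  have lt: "inf (D m) (D n) = bot" if "m < n" for m n
  proof -
    have "D n \<le> node (z (Suc m))" unfolding D_def using step[of "z n" True] mono[of "Suc m" n] that by simp
    then have "inf (D m) (D n) \<le> inf (node (z m @ [True])) (node (z m @ [False]))"
      unfolding D_def z by (intro inf_mono) simp_all
    then show ?thesis using disj by (simp add: bot_unique)
  qed
  obtain X where X: "\<And>i. ultra (X i) \<and> D i \<in> X i" using ultra_ex[of "D _"] assms(1) unfolding D_def by metis
  show ?thesis
  proof (rule that[of X D])
    show "inf (D m) (D m') = bot" if "m \<noteq> m'" for m m'
      using lt[of m m'] lt[of m' m] that by (metis inf_commute linorder_neqE_nat)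
  qed (use X in auto)
qed

text \<open>Point pairs are found only at some condition below the given one. Heredity transports a
  supposed instance of the property there, where it is refuted.\<close>

lemma nikodym_le: "nikodym TYPE('a::boolean_algebra) (p :: 'p::preorder) \<Longrightarrow> q \<le> p \<Longrightarrow> nikodym TYPE('a) q"
  unfolding nikodym_def fall_iff fimp_iff by (meson order_trans)

lemma grothendieck_le: "grothendieck TYPE('a::boolean_algebra) (p :: 'p::preorder) \<Longrightarrow> q \<le> p \<Longrightarrow> grothendieck TYPE('a) q"
  unfolding grothendieck_def fall_iff fimp_iff by (meson order_trans)

lemma point_pairs_exist:
  fixes p :: "'p::preorder"
  assumes inf: "infinite (UNIV :: 'a::boolean_algebra set)"
    and new: "(\<exists>x. cohen_over_ground x p) \<or> (\<exists>U. unsplit_over_ground U p) \<or> (\<exists>x. random_over_ground x p)"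
  shows "\<exists>v v' (dd :: nat \<Rightarrow> 'a \<Rightarrow> 'p fm). point_pairs p v v' dd"
proof (cases "\<exists>e::'a. \<not> thin e \<and> (\<forall>b\<le>e. thin b \<or> thin (inf e (- b)))")
  case True
  then obtain e :: 'a where e: "\<not> thin e" "\<And>b. b \<le> e \<Longrightarrow> thin b \<or> thin (inf e (- b))" by blast
  show ?thesis
  proof (rule convergent_sequence[OF e])
    fix X Y and D :: "nat \<Rightarrow> 'a"
    assume "\<And>i. ultra (X i)" "ultra Y" "\<And>i. D i \<in> X i" "\<And>i. D i \<notin> Y"
      "\<And>i j. i \<noteq> j \<Longrightarrow> inf (D i) (D j) = bot" "\<And>a. a \<in> Y \<Longrightarrow> \<exists>N. \<forall>i\<ge>N. a \<in> X i"
    then have "point_pairs p (\<lambda>i. gpt (X i)) (\<lambda>_. gpt Y) (\<lambda>i a. ground (a = D i))"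
      by (rule point_pairs_convergent)
    then show ?thesis by (intro exI)
  qed
next
  case False
  then have split: "\<exists>b\<le>e. \<not> thin b \<and> \<not> thin (inf e (- b))" if "\<not> thin e" for e :: 'a using that by blast
  have top: "\<not> thin (top :: 'a)" using inf unfolding thin_def by simp
  obtain node :: "bool list \<Rightarrow> 'a" where node: "\<And>s. node s \<noteq> bot" "\<And>s b. node (s @ [b]) \<le> node s"
    "\<And>s. inf (node (s @ [True])) (node (s @ [False])) = bot"
    using splitting_tree[OF top split] by metis
  obtain X D where XD: "\<And>m::nat. ultra (X m)" "\<And>m. (D m :: 'a) \<in> X m" "\<And>m m'. m \<noteq> m' \<Longrightarrow> inf (D m) (D m') = bot"
    using tree_antichain[OF node] by metis
  from new show ?thesis
  proof (elim disjE exE)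
    fix x assume "cohen_over_ground x p"
    from cohen_tree_exists[OF node this] obtain H where "cohen_tree node x p H" ..
    from cohen_tree.point_pairs_cohen[OF this] show ?thesis by blast
  next
    fix U assume U: "unsplit_over_ground U p"
    have "index_pairs p X D (\<lambda>i. nth_elt U (2 * i)) (\<lambda>i. nth_elt U (2 * i + 1))"
      by (rule index_pairs_unsplit) (fact XD U)+
    from index_pairs.point_pairs_sel[OF this] show ?thesis by blast
  next
    fix x assume x: "random_over_ground x p"
    have "index_pairs p X D (pick_index x True) (pick_index x False)"
      by (rule index_pairs_random) (fact XD x)+
    from index_pairs.point_pairs_sel[OF this] show ?thesis by blast
  qed
qed

theorem theorem1p1:
  assumes "infinite (UNIV :: 'a::boolean_algebra set)"
    and "forced ((\<^bold>\<exists>x. cohen_over_ground x) \<^bold>\<or> (\<^bold>\<exists>U. unsplit_over_ground U) \<^bold>\<or>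
           (\<^bold>\<exists>x. random_over_ground x) :: 'p::preorder fm)"
  shows "forced (\<^bold>\<not> nikodym TYPE('a) \<^bold>\<and> \<^bold>\<not> grothendieck TYPE('a) :: 'p fm)"
proof -
  have new: "\<exists>r\<le>q. (\<exists>x. cohen_over_ground x r) \<or> (\<exists>U. unsplit_over_ground U r) \<or> (\<exists>x. random_over_ground x r)" for q :: 'p
  proof -
    have "dns q (\<lambda>r. dns r (\<lambda>r. \<exists>x. cohen_over_ground x r) \<or>
        dns r (\<lambda>r. dns r (\<lambda>r. \<exists>U. unsplit_over_ground U r) \<or> dns r (\<lambda>r. \<exists>x. random_over_ground x r)))"
      using assms(2) unfolding forced_def f_or_iff fex_iff by blast
    then have "dns q (\<lambda>r. (\<exists>x. cohen_over_ground x r) \<or> (\<exists>U. unsplit_over_ground U r) \<or> (\<exists>x. random_over_ground x r))"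
      by (rule dns_bind, elim disjE) ((erule dns_bind, elim disjE)?, erule dns_mono, simp, blast)+
    then show ?thesis by (rule dns_obtain) blast
  qed
  \<comment> \<open>A negation is forced by a condition if no stronger one forces the formula, so it
    is enough to show that no \<open>q\<close> forces either property.\<close>
  have *: "\<not> nikodym TYPE('a) q \<and> \<not> grothendieck TYPE('a) q" for q :: 'p
  proof -
    obtain r where r: "r \<le> q" "(\<exists>x. cohen_over_ground x r) \<or> (\<exists>U. unsplit_over_ground U r) \<or> (\<exists>x. random_over_ground x r)"
      using new by blast
    obtain v v' and dd :: "nat \<Rightarrow> 'a \<Rightarrow> 'p fm" where "point_pairs r v v' dd"
      using point_pairs_exist[OF assms(1) r(2)] by blast
    then interpret point_pairs r v v' dd .
    show ?thesis
      using not_nikodym not_grothendieck nikodym_le[OF _ r(1)] grothendieck_le[OF _ r(1)] by blast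
  qed
  then show ?thesis unfolding forced_def fand_iff fnot_iff by blast
qed

end
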